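(* Let $p$ be a prime and let $1\to N\to G\to Q\to1$ be an extension of finite (or profinite) groups with $Q$ elementary abelian of rank $r+1$, generated by $\tau_0,\dots,\tau_r$. Let $M$ be a $G$-module on which $N$ acts trivially. Choose a set-theoretic section $s:Q\to G$ with $s(\tau_0^{t_0}\cdots\tau_r^{t_r})=s(\tau_0)^{t_0}\cdots s(\tau_r)^{t_r}$ for $0\le t_i\le p-1$, and define $a_j=s(\tau_j)^p\in N$ for $0\le j\le r$ and $c_{j,k}=s(\tau_k)s(\tau_j)s(\tau_k)^{-1}s(\tau_j)^{-1}\in N$ for $0\le j<k\le r$. Let $\phi:N\to M$ be a homomorphism representing a class in $H^1(N,M)^Q$, and let $d_2:H^1(N,M)^Q\to H^2(Q,M)$ be the transgression. Then the class of $\phi$ lies in $\mathrm{Ker}(d_2)$ if and only if there exist $m_0,\dots,m_r\in M$ such that (1) $\phi(a_j)=-N_{\tau_j}m_j$ for all $0\le j\le r$, and (2) $\phi(c_{j,k})=(1-\tau_k)m_j-(1-\tau_j)m_k$ for all $0\le j<k\le r$, where $N_{\tau_j}=1+\tau_j+\cdots+\tau_j^{p-1}$.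
   Context: The transgression $d_2$ is the differential of the Lyndon–Hochschild–Serre spectral sequence for the extension, and $H^1(N,M)=\mathrm{Hom}(N,M)$ since $N$ acts trivially on $M$; $Q$ acts on $M$ through $G/N=Q$. *)

theory Defs
  imports "HOL-Analysis.Analysis" "HOL-Algebra.Algebra"
begin

section \<open>Profinite groups and discrete modules\<close>

definition topological_group :: "('g, 'a) monoid_scheme \<Rightarrow> 'g topology \<Rightarrow> bool" where
  "topological_group G T \<longleftrightarrow>
     group G \<and> topspace T = carrier G \<and>
     continuous_map (prod_topology T T) T (\<lambda>(x, y). x \<otimes>\<^bsub>G\<^esub> y) \<and>
     continuous_map T T (\<lambda>x. inv\<^bsub>G\<^esub> x)"

definition totally_disconnected_space :: "'g topology \<Rightarrow> bool" where
  "totally_disconnected_space T \<longleftrightarrow> (\<forall>S. connectedin T S \<longrightarrow> (\<exists>x. S \<subseteq> {x}))"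

definition profinite_group :: "('g, 'a) monoid_scheme \<Rightarrow> 'g topology \<Rightarrow> bool" where
  "profinite_group G T \<longleftrightarrow>
     topological_group G T \<and> compact_space T \<and> Hausdorff_space T \<and> totally_disconnected_space T"

text \<open>Finite groups are the profinite groups with finite carrier; their topology is discrete,
  so for them every continuity condition below is vacuous.\<close>

lemma profinite_group_finite_iff:
  assumes "group G" "finite (carrier G)"
  shows "profinite_group G T \<longleftrightarrow> T = discrete_topology (carrier G)"
proof
  assume "profinite_group G T"
  then show "T = discrete_topology (carrier G)"
    unfolding profinite_group_def topological_group_def
    using assms(2) finite_topspace_imp_discrete_topology by metis
next
  interpret group G by fact
  assume T: "T = discrete_topology (carrier G)"
  have "totally_disconnected_space T"
    unfolding totally_disconnected_space_def
  proof (intro allI impI)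
    fix S assume S: "connectedin T S"
    then have sub: "S \<subseteq> carrier G"
      using T connectedin_subset_topspace by fastforce
    have "connected_space (discrete_topology S)"
      using S sub T by (simp add: connectedin_def subtopology_discrete_topology inf.absorb2)
    then show "\<exists>x. S \<subseteq> {x}"
      by (auto simp: connected_space_discrete_topology)
  qed
  moreover have "prod_topology T T = discrete_topology (carrier G \<times> carrier G)"
    by (simp add: T prod_topology_discrete_topology)
  ultimately show "profinite_group G T"
    unfolding profinite_group_def topological_group_def
    using assms by (auto simp: T compact_space_discrete_topology)
qed

text \<open>Only the additive structure of the ring record \<open>M\<close> is used.\<close>

definition discrete_module ::
  "('g, 'a) monoid_scheme \<Rightarrow> 'g topology \<Rightarrow> ('m, 'b) ring_scheme \<Rightarrow> ('g \<Rightarrow> 'm \<Rightarrow> 'm) \<Rightarrow> bool" where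
  "discrete_module G T M act \<longleftrightarrow>
     abelian_group M \<and> group_action G (carrier M) act \<and>
     (\<forall>g\<in>carrier G. act g \<in> hom (add_monoid M) (add_monoid M)) \<and>
     continuous_map (prod_topology T (discrete_topology (carrier M)))
       (discrete_topology (carrier M)) (\<lambda>(g, m). act g m)"

definition induced_action ::
  "('g, 'a) monoid_scheme \<Rightarrow> ('g \<Rightarrow> 'q) \<Rightarrow> ('g \<Rightarrow> 'm \<Rightarrow> 'm) \<Rightarrow> 'q \<Rightarrow> 'm \<Rightarrow> 'm" where
  "induced_action G \<pi> act q = act (inv_into (carrier G) \<pi> q)"

lemma induced_action_eq:
  assumes "group_hom G Q \<pi>" "group_action G E act"
    and triv: "\<And>n m. n \<in> kernel G Q \<pi> \<Longrightarrow> m \<in> E \<Longrightarrow> act n m = m"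
    and g: "g \<in> carrier G" and m: "m \<in> E"
  shows "induced_action G \<pi> act (\<pi> g) m = act g m"
proof -
  interpret h: group_hom G Q \<pi> by fact
  interpret a: group_action G E act by fact
  define g' where "g' = inv_into (carrier G) \<pi> (\<pi> g)"
  have g': "g' \<in> carrier G" "\<pi> g' = \<pi> g"
    using g by (auto simp: g'_def inv_into_into f_inv_into_f)
  have "inv\<^bsub>G\<^esub> g \<otimes>\<^bsub>G\<^esub> g' \<in> kernel G Q \<pi>"
    using g g' by (simp add: kernel_def)
  then have "act g m = act g (act (inv\<^bsub>G\<^esub> g \<otimes>\<^bsub>G\<^esub> g') m)"
    using triv m by simp
  also have "\<dots> = act (g \<otimes>\<^bsub>G\<^esub> (inv\<^bsub>G\<^esub> g \<otimes>\<^bsub>G\<^esub> g')) m"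
    using g g' m by (intro a.composition_rule[symmetric]) auto
  also have "g \<otimes>\<^bsub>G\<^esub> (inv\<^bsub>G\<^esub> g \<otimes>\<^bsub>G\<^esub> g') = g'"
    using g g' by (simp add: h.G.m_assoc[symmetric])
  finally show ?thesis
    by (simp add: induced_action_def g'_def)
qed


section \<open>Continuous cochain cohomology\<close>

text \<open>An \<open>n\<close>-tuple of group elements is an extensional function on \<open>{..<n}\<close>.  Cochains are the
  normalized inhomogeneous ones: they vanish as soon as one argument is the identity.
  Normalization leaves cohomology unchanged, and it is what makes restriction to \<open>N\<close> well
  defined on \<open>E\<^sub>2\<^sup>0\<^sup>,\<^sup>1\<close> below.\<close>

abbreviation tuples :: "('g, 'a) monoid_scheme \<Rightarrow> nat \<Rightarrow> (nat \<Rightarrow> 'g) set" where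
  "tuples G n \<equiv> (\<Pi>\<^sub>E i\<in>{..<n}. carrier G)"

definition cochains ::
  "('g, 'a) monoid_scheme \<Rightarrow> 'g topology \<Rightarrow> ('m, 'b) ring_scheme \<Rightarrow> nat \<Rightarrow> ((nat \<Rightarrow> 'g) \<Rightarrow> 'm) set" where
  "cochains G T M n =
     {f \<in> extensional (tuples G n).
        continuous_map (product_topology (\<lambda>_. T) {..<n}) (discrete_topology (carrier M)) f \<and>
        (\<forall>x\<in>tuples G n. (\<exists>i<n. x i = \<one>\<^bsub>G\<^esub>) \<longrightarrow> f x = \<zero>\<^bsub>M\<^esub>)}"

definition zero_cochain ::
  "('g, 'a) monoid_scheme \<Rightarrow> ('m, 'b) ring_scheme \<Rightarrow> nat \<Rightarrow> (nat \<Rightarrow> 'g) \<Rightarrow> 'm" where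
  "zero_cochain G M n = (\<lambda>x\<in>tuples G n. \<zero>\<^bsub>M\<^esub>)"

definition cochain_group ::
  "('g, 'a) monoid_scheme \<Rightarrow> 'g topology \<Rightarrow> ('m, 'b) ring_scheme \<Rightarrow> nat \<Rightarrow> ((nat \<Rightarrow> 'g) \<Rightarrow> 'm) monoid" where
  "cochain_group G T M n =
     \<lparr>carrier = cochains G T M n,
      monoid.mult = (\<lambda>f g. \<lambda>x\<in>tuples G n. f x \<oplus>\<^bsub>M\<^esub> g x),
      one = zero_cochain G M n\<rparr>"

definition coboundary ::
  "('g, 'a) monoid_scheme \<Rightarrow> ('m, 'b) ring_scheme \<Rightarrow> ('g \<Rightarrow> 'm \<Rightarrow> 'm) \<Rightarrow> nat \<Rightarrow>
   ((nat \<Rightarrow> 'g) \<Rightarrow> 'm) \<Rightarrow> (nat \<Rightarrow> 'g) \<Rightarrow> 'm" where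
  "coboundary G M act n f =
     (\<lambda>x\<in>tuples G (Suc n).
        act (x 0) (f (\<lambda>j\<in>{..<n}. x (Suc j)))
        \<oplus>\<^bsub>M\<^esub> (\<Oplus>\<^bsub>M\<^esub>i\<in>{..<n}. add_pow M ((- 1 :: int) ^ Suc i)
               (f (\<lambda>j\<in>{..<n}. if j < i then x j
                              else if j = i then x i \<otimes>\<^bsub>G\<^esub> x (Suc i)
                              else x (Suc j))))
        \<oplus>\<^bsub>M\<^esub> add_pow M ((- 1 :: int) ^ Suc n) (f (\<lambda>j\<in>{..<n}. x j)))"

definition cocycles ::
  "('g, 'a) monoid_scheme \<Rightarrow> 'g topology \<Rightarrow> ('m, 'b) ring_scheme \<Rightarrow> ('g \<Rightarrow> 'm \<Rightarrow> 'm) \<Rightarrow> nat \<Rightarrow>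
   ((nat \<Rightarrow> 'g) \<Rightarrow> 'm) set" where
  "cocycles G T M act n =
     {f \<in> cochains G T M n. coboundary G M act n f = zero_cochain G M (Suc n)}"

definition coboundaries ::
  "('g, 'a) monoid_scheme \<Rightarrow> 'g topology \<Rightarrow> ('m, 'b) ring_scheme \<Rightarrow> ('g \<Rightarrow> 'm \<Rightarrow> 'm) \<Rightarrow> nat \<Rightarrow>
   ((nat \<Rightarrow> 'g) \<Rightarrow> 'm) set" where
  "coboundaries G T M act n =
     (case n of 0 \<Rightarrow> {zero_cochain G M 0}
              | Suc m \<Rightarrow> coboundary G M act m ` cochains G T M m)"

definition cohomology ::
  "('g, 'a) monoid_scheme \<Rightarrow> 'g topology \<Rightarrow> ('m, 'b) ring_scheme \<Rightarrow> ('g \<Rightarrow> 'm \<Rightarrow> 'm) \<Rightarrow> nat \<Rightarrow>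
   ((nat \<Rightarrow> 'g) \<Rightarrow> 'm) set monoid" where
  "cohomology G T M act n =
     (cochain_group G T M n)\<lparr>carrier := cocycles G T M act n\<rparr> Mod coboundaries G T M act n"

text \<open>The class of a cochain \<open>f\<close> modulo a subgroup \<open>B\<close>, and the map induced on classes by a map
  of cochains that is constant modulo \<open>B'\<close> on each class.\<close>

abbreviation cochain_class ::
  "('g, 'a) monoid_scheme \<Rightarrow> 'g topology \<Rightarrow> ('m, 'b) ring_scheme \<Rightarrow> nat \<Rightarrow>
   ((nat \<Rightarrow> 'g) \<Rightarrow> 'm) set \<Rightarrow> ((nat \<Rightarrow> 'g) \<Rightarrow> 'm) \<Rightarrow> ((nat \<Rightarrow> 'g) \<Rightarrow> 'm) set" where
  "cochain_class G T M n B f \<equiv> B #>\<^bsub>cochain_group G T M n\<^esub> f"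

definition map_class :: "('x \<Rightarrow> 'y set) \<Rightarrow> 'x set \<Rightarrow> 'y set" where
  "map_class F Y = the_elem (F ` Y)"


section \<open>The Lyndon-Hochschild-Serre spectral sequence\<close>

text \<open>Throughout, \<open>\<pi> : G \<rightarrow> Q\<close> is the projection of the extension, so two elements of \<open>G\<close> lie in the
  same coset of \<open>N\<close> iff they have the same image under \<open>\<pi>\<close>.

  The Hochschild-Serre filtration: for \<open>p \<le> n\<close>, \<open>F\<^sup>p C\<^sup>n(G, M)\<close> consists of the cochains that
  depend only on their first \<open>n - p\<close> arguments and on the \<open>N\<close>-cosets of the last \<open>p\<close> ones; it is
  everything for \<open>p \<le> 0\<close>, and zero for \<open>p > n\<close>.\<close>

definition hs_filtration ::
  "('g, 'a) monoid_scheme \<Rightarrow> 'g topology \<Rightarrow> ('m, 'b) ring_scheme \<Rightarrow> ('g \<Rightarrow> 'q) \<Rightarrow> int \<Rightarrow> nat \<Rightarrow>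
   ((nat \<Rightarrow> 'g) \<Rightarrow> 'm) set" where
  "hs_filtration G T M \<pi> p n =
     (if p \<le> int n
      then {f \<in> cochains G T M n.
              \<forall>x\<in>tuples G n. \<forall>y\<in>tuples G n.
                (\<forall>i<n. \<pi> (x i) = \<pi> (y i)) \<and> (\<forall>i<n. int i < int n - p \<longrightarrow> x i = y i)
                \<longrightarrow> f x = f y}
      else {zero_cochain G M n})"

text \<open>The spectral sequence of this filtered complex is indexed by the page \<open>k\<close>, the filtration
  degree \<open>p\<close> and the total degree \<open>n = p + q\<close>.  As usual
  \<open>Z\<^sub>k\<^sup>p = {f \<in> F\<^sup>p. d f \<in> F\<^sup>p\<^sup>+\<^sup>k}\<close>, \<open>B\<^sub>k\<^sup>p = Z\<^sub>k\<^sub>-\<^sub>1\<^sup>p\<^sup>+\<^sup>1 + d Z\<^sub>k\<^sub>-\<^sub>1\<^sup>p\<^sup>-\<^sup>k\<^sup>+\<^sup>1\<close> and \<open>E\<^sub>k\<^sup>p = Z\<^sub>k\<^sup>p / B\<^sub>k\<^sup>p\<close>.\<close>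

definition lhs_Z ::
  "('g, 'a) monoid_scheme \<Rightarrow> 'g topology \<Rightarrow> ('m, 'b) ring_scheme \<Rightarrow> ('g \<Rightarrow> 'm \<Rightarrow> 'm) \<Rightarrow> ('g \<Rightarrow> 'q) \<Rightarrow>
   int \<Rightarrow> int \<Rightarrow> nat \<Rightarrow> ((nat \<Rightarrow> 'g) \<Rightarrow> 'm) set" where
  "lhs_Z G T M act \<pi> k p n =
     {f \<in> hs_filtration G T M \<pi> p n. coboundary G M act n f \<in> hs_filtration G T M \<pi> (p + k) (Suc n)}"

definition lhs_B ::
  "('g, 'a) monoid_scheme \<Rightarrow> 'g topology \<Rightarrow> ('m, 'b) ring_scheme \<Rightarrow> ('g \<Rightarrow> 'm \<Rightarrow> 'm) \<Rightarrow> ('g \<Rightarrow> 'q) \<Rightarrow>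
   int \<Rightarrow> int \<Rightarrow> nat \<Rightarrow> ((nat \<Rightarrow> 'g) \<Rightarrow> 'm) set" where
  "lhs_B G T M act \<pi> k p n =
     lhs_Z G T M act \<pi> (k - 1) (p + 1) n <#>\<^bsub>cochain_group G T M n\<^esub>
     (case n of 0 \<Rightarrow> {zero_cochain G M 0}
              | Suc m \<Rightarrow> coboundary G M act m ` lhs_Z G T M act \<pi> (k - 1) (p - k + 1) m)"

definition lhs_E ::
  "('g, 'a) monoid_scheme \<Rightarrow> 'g topology \<Rightarrow> ('m, 'b) ring_scheme \<Rightarrow> ('g \<Rightarrow> 'm \<Rightarrow> 'm) \<Rightarrow> ('g \<Rightarrow> 'q) \<Rightarrow>
   int \<Rightarrow> int \<Rightarrow> nat \<Rightarrow> ((nat \<Rightarrow> 'g) \<Rightarrow> 'm) set monoid" where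
  "lhs_E G T M act \<pi> k p n =
     (cochain_group G T M n)\<lparr>carrier := lhs_Z G T M act \<pi> k p n\<rparr> Mod lhs_B G T M act \<pi> k p n"

definition lhs_d ::
  "('g, 'a) monoid_scheme \<Rightarrow> 'g topology \<Rightarrow> ('m, 'b) ring_scheme \<Rightarrow> ('g \<Rightarrow> 'm \<Rightarrow> 'm) \<Rightarrow> ('g \<Rightarrow> 'q) \<Rightarrow>
   int \<Rightarrow> int \<Rightarrow> nat \<Rightarrow> ((nat \<Rightarrow> 'g) \<Rightarrow> 'm) set \<Rightarrow> ((nat \<Rightarrow> 'g) \<Rightarrow> 'm) set" where
  "lhs_d G T M act \<pi> k p n =
     map_class (\<lambda>f. cochain_class G T M (Suc n) (lhs_B G T M act \<pi> k (p + k) (Suc n))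
                      (coboundary G M act n f))"


section \<open>The transgression\<close>

abbreviation subgroup_of :: "('g, 'a) monoid_scheme \<Rightarrow> 'g set \<Rightarrow> ('g, 'a) monoid_scheme" where
  "subgroup_of G N \<equiv> G\<lparr>carrier := N\<rparr>"

text \<open>\<open>G\<close> acts on cochains of a normal subgroup \<open>N\<close> by \<open>(g f)(x) = g f(g\<^sup>-\<^sup>1 x g)\<close>.  On
  \<open>H\<^sup>n(N, M)\<close> the elements of \<open>N\<close> act trivially, which gives the action of \<open>Q = G/N\<close>; its
  invariants are those of \<open>G\<close>.\<close>

definition conj_cochain ::
  "('g, 'a) monoid_scheme \<Rightarrow> ('g \<Rightarrow> 'm \<Rightarrow> 'm) \<Rightarrow> 'g set \<Rightarrow> nat \<Rightarrow> 'g \<Rightarrow>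
   ((nat \<Rightarrow> 'g) \<Rightarrow> 'm) \<Rightarrow> (nat \<Rightarrow> 'g) \<Rightarrow> 'm" where
  "conj_cochain G act N n g f =
     (\<lambda>x\<in>tuples (subgroup_of G N) n. act g (f (\<lambda>i\<in>{..<n}. inv\<^bsub>G\<^esub> g \<otimes>\<^bsub>G\<^esub> x i \<otimes>\<^bsub>G\<^esub> g)))"

definition invariant_cohomology ::
  "('g, 'a) monoid_scheme \<Rightarrow> 'g topology \<Rightarrow> ('m, 'b) ring_scheme \<Rightarrow> ('g \<Rightarrow> 'm \<Rightarrow> 'm) \<Rightarrow> 'g set \<Rightarrow> nat \<Rightarrow>
   ((nat \<Rightarrow> 'g) \<Rightarrow> 'm) set monoid" where
  "invariant_cohomology G T M act N n =
     (let H = cohomology (subgroup_of G N) (subtopology T N) M act n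
      in H\<lparr>carrier := {Y \<in> carrier H. \<forall>g\<in>carrier G. conj_cochain G act N n g ` Y = Y}\<rparr>)"

text \<open>The identification \<open>E\<^sub>2\<^sup>0\<^sup>,\<^sup>1 = H\<^sup>1(N, M)\<^sup>Q\<close>, induced by restriction of cochains to \<open>N\<close>.\<close>

definition edge_restriction ::
  "('g, 'a) monoid_scheme \<Rightarrow> 'g topology \<Rightarrow> ('m, 'b) ring_scheme \<Rightarrow> ('g \<Rightarrow> 'm \<Rightarrow> 'm) \<Rightarrow> 'g set \<Rightarrow>
   ((nat \<Rightarrow> 'g) \<Rightarrow> 'm) set \<Rightarrow> ((nat \<Rightarrow> 'g) \<Rightarrow> 'm) set" where
  "edge_restriction G T M act N =
     map_class (\<lambda>f. cochain_class (subgroup_of G N) (subtopology T N) M 1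
                      (coboundaries (subgroup_of G N) (subtopology T N) M act 1)
                      (restrict f (tuples (subgroup_of G N) 1)))"

text \<open>The identification \<open>H\<^sup>2(Q, M) = E\<^sub>2\<^sup>2\<^sup>,\<^sup>0\<close> (valid when \<open>N\<close> acts trivially on \<open>M\<close>), induced by
  inflation of cochains along \<open>\<pi>\<close>.\<close>

definition edge_inflation ::
  "('g, 'a) monoid_scheme \<Rightarrow> 'g topology \<Rightarrow> ('m, 'b) ring_scheme \<Rightarrow> ('g \<Rightarrow> 'm \<Rightarrow> 'm) \<Rightarrow> ('g \<Rightarrow> 'q) \<Rightarrow>
   ((nat \<Rightarrow> 'q) \<Rightarrow> 'm) set \<Rightarrow> ((nat \<Rightarrow> 'g) \<Rightarrow> 'm) set" where
  "edge_inflation G T M act \<pi> =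
     map_class (\<lambda>f. cochain_class G T M 2 (lhs_B G T M act \<pi> 2 2 2)
                      (\<lambda>x\<in>tuples G 2. f (\<lambda>i\<in>{..<2}. \<pi> (x i))))"

definition transgression ::
  "('g, 'a) monoid_scheme \<Rightarrow> 'g topology \<Rightarrow> ('q, 'c) monoid_scheme \<Rightarrow> 'q topology \<Rightarrow> ('g \<Rightarrow> 'q) \<Rightarrow>
   ('m, 'b) ring_scheme \<Rightarrow> ('g \<Rightarrow> 'm \<Rightarrow> 'm) \<Rightarrow>
   ((nat \<Rightarrow> 'g) \<Rightarrow> 'm) set \<Rightarrow> ((nat \<Rightarrow> 'q) \<Rightarrow> 'm) set" where
  "transgression G T Q TQ \<pi> M act Y =
     inv_into (carrier (cohomology Q TQ M (induced_action G \<pi> act) 2))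
       (edge_inflation G T M act \<pi>)
       (lhs_d G T M act \<pi> 2 0 1
          (inv_into (carrier (lhs_E G T M act \<pi> 2 0 1))
             (edge_restriction G T M act (kernel G Q \<pi>)) Y))"

text \<open>The class in \<open>H\<^sup>1(N, M)\<close> of a homomorphism \<open>\<phi> : N \<rightarrow> M\<close>.\<close>

definition hom_class ::
  "('g, 'a) monoid_scheme \<Rightarrow> 'g topology \<Rightarrow> ('m, 'b) ring_scheme \<Rightarrow> ('g \<Rightarrow> 'm \<Rightarrow> 'm) \<Rightarrow> 'g set \<Rightarrow>
   ('g \<Rightarrow> 'm) \<Rightarrow> ((nat \<Rightarrow> 'g) \<Rightarrow> 'm) set" where
  "hom_class G T M act N \<phi> =
     cochain_class (subgroup_of G N) (subtopology T N) M 1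
       (coboundaries (subgroup_of G N) (subtopology T N) M act 1)
       (\<lambda>x\<in>tuples (subgroup_of G N) 1. \<phi> (x 0))"


section \<open>Elementary abelian groups\<close>

definition elementary_abelian :: "nat \<Rightarrow> nat \<Rightarrow> ('q, 'c) monoid_scheme \<Rightarrow> bool" where
  "elementary_abelian p n Q \<longleftrightarrow> Q \<cong> product_group {..<n} (\<lambda>_. integer_mod_group p)"

text \<open>The ordered product \<open>x\<^sub>0\<^sup>t\<^sup>0 x\<^sub>1\<^sup>t\<^sup>1 \<dots>\<close> of the first \<open>n\<close> powers.\<close>

primrec ordered_monomial ::
  "('g, 'a) monoid_scheme \<Rightarrow> (nat \<Rightarrow> 'g) \<Rightarrow> (nat \<Rightarrow> nat) \<Rightarrow> nat \<Rightarrow> 'g" where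
  "ordered_monomial G x t 0 = \<one>\<^bsub>G\<^esub>"
| "ordered_monomial G x t (Suc n) = ordered_monomial G x t n \<otimes>\<^bsub>G\<^esub> x n [^]\<^bsub>G\<^esub> t n"

definition norm_element ::
  "('q, 'c) monoid_scheme \<Rightarrow> ('m, 'b) ring_scheme \<Rightarrow> ('q \<Rightarrow> 'm \<Rightarrow> 'm) \<Rightarrow> nat \<Rightarrow> 'q \<Rightarrow> 'm \<Rightarrow> 'm" where
  "norm_element Q M act p \<tau> m = (\<Oplus>\<^bsub>M\<^esub>i\<in>{..<p}. act (\<tau> [^]\<^bsub>Q\<^esub> i) m)"

end

theory Submission
  imports Defs
begin

text \<open>The transgression of \<open>\<phi>\<close> is computed by lifting \<open>\<phi>\<close> to a cochain \<open>f\<close> on \<open>G\<close> whose coboundary is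
  inflated from a cocycle \<open>c\<close> on \<open>Q\<close>; if \<open>c\<close> is the coboundary of \<open>h\<close>, subtracting the inflation of
  \<open>h\<close> from \<open>f\<close> gives a crossed homomorphism, and conversely. So the class of \<open>\<phi>\<close> is killed
  iff \<open>\<phi>\<close> extends to a crossed homomorphism \<open>F\<close> on \<open>G\<close>, and continuity of \<open>F\<close> is automatic because
  \<open>N\<close> is open. Given \<open>F\<close>, the elements \<open>m\<^sub>j = - F (s \<tau>\<^sub>j)\<close> satisfy (1) and (2), by expanding \<open>F\<close> on
  \<open>s(\<tau>\<^sub>j)\<^sup>p\<close> and on \<open>c\<^sub>j\<^sub>,\<^sub>k s(\<tau>\<^sub>j) s(\<tau>\<^sub>k) = s(\<tau>\<^sub>k) s(\<tau>\<^sub>j)\<close>. Conversely, a counting argument in \<open>M \<rtimes> G\<close>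
  modulo the graph of \<open>\<phi>\<close> produces \<open>F\<close> from the \<open>m\<^sub>j\<close>.\<close>

text \<open>The hard direction must make a function on all of G out of finitely many relations. A
  formula for F on ordered monomials would have to be checked against reordered generators and
  exponents that overflow p. Orders of groups replace that check: the relations bound a subgroup
  from above by p^(r+1), its projection onto Q bounds it from below by the same number, and no
  presentation of G or Q enters. The semidirect product is the right place because F is a crossed
  homomorphism exactly when its graph is a subgroup there. The minus sign in m_j comes from (1): a
  crossed homomorphism sends a p-th power to the norm of its value, and (1) carries the opposite
  sign. The other obstacle is that the transgression is a composite of chosen preimages and maps on
  classes. Normalization tames it: an inflated cochain vanishes as soon as one argument lies in
  N.\<close>

text \<open>Registers the additive rules with the \<open>algebra\<close> method. \<open>M\<close> is
  only an abelian group, so the rule set for rings does not apply to it.\<close>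

lemmas (in abelian_group) abelian_group_simprules
  [algebra abelian_group "ring.zero G" "ring.add G" "a_inv G" "a_minus G"] =
  a_closed zero_closed a_inv_closed minus_closed
  a_assoc l_zero l_neg a_comm minus_eq
  r_zero r_neg r_neg2 r_neg1 minus_add minus_minus minus_zero a_lcomm

section \<open>Crossed homomorphisms\<close>

text \<open>The centralizer of \<open>y\<close> is a subgroup.\<close>

lemma (in group) generate_commutes:
  assumes "z \<in> generate G A" "A \<subseteq> carrier G" "y \<in> carrier G"
    and comm: "\<And>x. x \<in> A \<Longrightarrow> x \<otimes> y = y \<otimes> x"
  shows "z \<otimes> y = y \<otimes> z"
  using assms(1)
proof induction
  case one
  then show ?case using assms(3) by simp
next
  case (incl h)
  then show ?case by (rule comm)
next
  case (inv h)
  then have h: "h \<in> carrier G" using assms(2) by auto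
  then have "inv h \<otimes> (y \<otimes> h) \<otimes> inv h = inv h \<otimes> (h \<otimes> y) \<otimes> inv h"
    using comm inv by simp
  moreover have "inv h \<otimes> (y \<otimes> h) \<otimes> inv h = inv h \<otimes> y"
    using h assms(3) by (simp add: m_assoc)
  moreover have "inv h \<otimes> (h \<otimes> y) \<otimes> inv h = y \<otimes> inv h"
    using h assms(3) by (simp add: m_assoc[symmetric])
  ultimately show ?case by simp
next
  case (eng h1 h2)
  then have h: "h1 \<in> carrier G" "h2 \<in> carrier G"
    using generate_in_carrier[OF assms(2)] by auto
  have "h1 \<otimes> h2 \<otimes> y = h1 \<otimes> y \<otimes> h2"
    using eng.IH(2) h assms(3) by (simp add: m_assoc)
  also have "\<dots> = y \<otimes> (h1 \<otimes> h2)"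
    using eng.IH(1) h assms(3) by (simp add: m_assoc[symmetric])
  finally show ?case .
qed

text \<open>Powers of \<open>y\<close> can be collected at the right end because \<open>y\<close>
  commutes with everything generated by \<open>A\<close>, and their exponents reduce modulo
  \<open>p\<close>. This is the inductive step of the count that follows.\<close>

lemma (in group) generate_insert_commuting:
  fixes p :: nat
  assumes A: "A \<subseteq> carrier G" and y: "y \<in> carrier G" "y [^] p = \<one>" and p: "p > 0"
    and comm: "\<And>x. x \<in> A \<Longrightarrow> x \<otimes> y = y \<otimes> x"
  shows "generate G (insert y A) \<subseteq> (\<lambda>(h, t). h \<otimes> y [^] t) ` (generate G A \<times> {..<p})"
    (is "_ \<subseteq> ?S")
proof
  have pow_mod: "y [^] (t mod p) = y [^] t" for t :: nat
  proof -
    have "y [^] t = y [^] (p * (t div p) + t mod p)" by simp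
    also have "\<dots> = y [^] (t mod p)"
      unfolding nat_pow_mult[OF y(1), symmetric] nat_pow_pow[OF y(1), symmetric] using y by simp
    finally show ?thesis by simp
  qed
  have S: "h \<otimes> y [^] t \<in> ?S" if "h \<in> generate G A" for h and t :: nat
  proof -
    have "h \<otimes> y [^] t = h \<otimes> y [^] (t mod p)" using pow_mod by simp
    then show ?thesis using that p by force
  qed
  have carr: "h \<in> carrier G" if "h \<in> generate G A" for h
    using that A by (rule generate_in_carrier[rotated])
  fix z assume "z \<in> generate G (insert y A)"
  then show "z \<in> ?S"
  proof induction
    case one
    then show ?case using S[OF generate.one, of 0] by simp
  next
    case (incl h)
    then consider "h = y" | "h \<in> A" by auto
    then show ?case
    proof cases
      case 1
      then show ?thesis using S[OF generate.one, of 1] y by simp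
    next
      case 2
      then have "h \<otimes> y [^] (0::nat) \<in> ?S"
        by (intro S generate.incl)
      moreover have "h \<otimes> y [^] (0::nat) = h" using 2 A by auto
      ultimately show ?thesis by (simp only:)
    qed
  next
    case (inv h)
    then consider "h = y" | "h \<in> A" by auto
    then show ?case
    proof cases
      case 1
      have "y [^] (p - 1) \<otimes> y = \<one>"
        using y p by (metis Suc_diff_1 nat_pow_Suc)
      then have "inv y = y [^] (p - 1)"
        using y by (simp add: inv_equality)
      then show ?thesis using S[OF generate.one, of "p - 1"] 1 y by simp
    next
      case 2
      then have "inv h \<otimes> y [^] (0::nat) \<in> ?S"
        by (intro S generate.inv)
      moreover have "inv h \<otimes> y [^] (0::nat) = inv h" using 2 A by auto
      ultimately show ?thesis by (simp only:)
    qed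
  next
    case (eng h1 h2)
    obtain g1 t1 where 1: "h1 = g1 \<otimes> y [^] (t1::nat)" "g1 \<in> generate G A" using eng by auto
    obtain g2 t2 where 2: "h2 = g2 \<otimes> y [^] (t2::nat)" "g2 \<in> generate G A" using eng by auto
    have c: "g2 \<otimes> y [^] t1 = y [^] t1 \<otimes> g2"
    proof (rule generate_commutes[OF 2(2) A])
      fix x assume "x \<in> A"
      then have "y \<otimes> x = x \<otimes> y" "x \<in> carrier G" using comm A by auto
      then show "x \<otimes> y [^] t1 = y [^] t1 \<otimes> x"
        using y by (simp add: group_commutes_pow)
    qed (use y in simp)
    have "h1 \<otimes> h2 = g1 \<otimes> (y [^] t1 \<otimes> g2) \<otimes> y [^] t2"
      using 1 2 carr y by (simp add: m_assoc)
    also have "\<dots> = (g1 \<otimes> g2) \<otimes> y [^] (t1 + t2)"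
      using 1 2 carr y by (simp add: m_assoc c[symmetric] nat_pow_mult)
    also have "\<dots> \<in> ?S" using 1 2 by (intro S generate.eng)
    finally show ?case .
  qed
qed

text \<open>Each further generator multiplies the order by at most \<open>p\<close>. The
  \<open>x i\<close> may be dependent, so this is only an upper bound; in the application a
  surjection onto \<open>Q\<close> forces equality.\<close>

lemma (in group) card_generate_commuting:
  fixes p n :: nat and x :: "nat \<Rightarrow> 'a"
  assumes "p > 0" and "\<And>i. i < n \<Longrightarrow> x i \<in> carrier G" "\<And>i. i < n \<Longrightarrow> x i [^] p = \<one>"
    and "\<And>i j. i < j \<Longrightarrow> j < n \<Longrightarrow> x i \<otimes> x j = x j \<otimes> x i"
  shows "finite (generate G (x ` {..<n})) \<and> card (generate G (x ` {..<n})) \<le> p ^ n"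
  using assms(2-)
proof (induction n)
  case 0
  then show ?case by (simp add: generate_empty)
next
  case (Suc n)
  let ?H = "generate G (x ` {..<n})" and ?m = "\<lambda>(h, t). h \<otimes> x n [^] t"
  have IH: "finite ?H" "card ?H \<le> p ^ n"
    using Suc.IH Suc.prems by (meson less_SucI)+
  have sub: "generate G (x ` {..<Suc n}) \<subseteq> ?m ` (?H \<times> {..<p})"
    unfolding lessThan_Suc image_insert
    using Suc.prems assms(1) by (intro generate_insert_commuting) auto
  have fin: "finite (?H \<times> {..<p})" using IH by simp
  have "card (generate G (x ` {..<Suc n})) \<le> card (?m ` (?H \<times> {..<p}))"
    using sub fin by (intro card_mono) auto
  also have "\<dots> \<le> card (?H \<times> {..<p})" using fin by (rule card_image_le)
  also have "\<dots> \<le> p ^ Suc n" using IH by (simp add: card_cartesian_product)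
  finally show ?case using sub fin finite_surj by blast
qed

text \<open>Trades a commutator for a relation between products, on which a crossed homomorphism
  expands without evaluating it at inverses.\<close>

lemma (in group) commutator_mult:
  assumes "x \<in> carrier G" "y \<in> carrier G"
  shows "x \<otimes> y \<otimes> inv x \<otimes> inv y \<otimes> (y \<otimes> x) = x \<otimes> y"
proof -
  have "inv x \<otimes> inv y \<otimes> (y \<otimes> x) = \<one>"
    using assms by (simp flip: inv_mult_group)
  then show ?thesis using assms by (simp add: m_assoc)
qed

section \<open>Modules, crossed homomorphisms and the semidirect product\<close>

text \<open>The module axioms in pointwise form, to be instantiated three times: for
  \<open>G\<close>, for \<open>Q\<close> with the induced action, and for the kernel.\<close>

locale gmodule = G: group G + M: abelian_group M
  for G :: "('g, 'a) monoid_scheme" and M :: "('m, 'b) ring_scheme" +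
  fixes act :: "'g \<Rightarrow> 'm \<Rightarrow> 'm"
  assumes act_closed [simp]: "g \<in> carrier G \<Longrightarrow> m \<in> carrier M \<Longrightarrow> act g m \<in> carrier M"
    and act_add: "g \<in> carrier G \<Longrightarrow> m \<in> carrier M \<Longrightarrow> m' \<in> carrier M \<Longrightarrow>
      act g (m \<oplus>\<^bsub>M\<^esub> m') = act g m \<oplus>\<^bsub>M\<^esub> act g m'"
    and act_mult: "g \<in> carrier G \<Longrightarrow> h \<in> carrier G \<Longrightarrow> m \<in> carrier M \<Longrightarrow>
      act (g \<otimes>\<^bsub>G\<^esub> h) m = act g (act h m)"
    and act_one [simp]: "m \<in> carrier M \<Longrightarrow> act \<one>\<^bsub>G\<^esub> m = m"
begin

lemma act_zero [simp]:
  assumes "g \<in> carrier G" shows "act g \<zero>\<^bsub>M\<^esub> = \<zero>\<^bsub>M\<^esub>"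
proof -
  have "act g \<zero>\<^bsub>M\<^esub> \<oplus>\<^bsub>M\<^esub> act g \<zero>\<^bsub>M\<^esub> = act g \<zero>\<^bsub>M\<^esub>"
    using assms by (simp flip: act_add)
  then show ?thesis using assms by (simp add: M.add.r_cancel_one)
qed

lemma act_minus:
  assumes "g \<in> carrier G" "m \<in> carrier M" shows "act g (\<ominus>\<^bsub>M\<^esub> m) = \<ominus>\<^bsub>M\<^esub> act g m"
proof -
  have "act g (\<ominus>\<^bsub>M\<^esub> m) \<oplus>\<^bsub>M\<^esub> act g m = act g (\<ominus>\<^bsub>M\<^esub> m \<oplus>\<^bsub>M\<^esub> m)"
    using assms by (intro act_add[symmetric]) auto
  then show ?thesis using assms by (simp add: M.l_neg M.minus_equality)
qed

lemma minus_zero: "\<ominus>\<^bsub>M\<^esub> \<zero>\<^bsub>M\<^esub> = \<zero>\<^bsub>M\<^esub>"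
  by (rule M.minus_equality) auto

lemma sum_act_minus:
  assumes "finite A" "g \<in> carrier G" "m \<in> carrier M"
  shows "(\<Oplus>\<^bsub>M\<^esub>i\<in>A. act (g [^]\<^bsub>G\<^esub> (i::nat)) (\<ominus>\<^bsub>M\<^esub> m)) = \<ominus>\<^bsub>M\<^esub> (\<Oplus>\<^bsub>M\<^esub>i\<in>A. act (g [^]\<^bsub>G\<^esub> i) m)"
  using assms(1)
  by (induction A rule: finite_induct)
    (use assms(2,3) in \<open>auto simp: act_minus M.minus_add minus_zero Pi_def\<close>)

text \<open>These are the 1-cocycles, as functions of group elements instead of tuples and without a
  continuity condition.\<close>

definition crossed_hom :: "('g \<Rightarrow> 'm) \<Rightarrow> bool" where
  "crossed_hom F \<longleftrightarrow> (\<forall>g\<in>carrier G. F g \<in> carrier M) \<and>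
     (\<forall>g\<in>carrier G. \<forall>h\<in>carrier G. F (g \<otimes>\<^bsub>G\<^esub> h) = F g \<oplus>\<^bsub>M\<^esub> act g (F h))"

text \<open>The homomorphic sections of the projection to \<open>G\<close> are the maps sending
  \<open>g\<close> to \<open>(F g, g)\<close> with \<open>F\<close> a crossed homomorphism.\<close>

definition semidirect :: "('m \<times> 'g) monoid" where
  "semidirect = \<lparr>carrier = carrier M \<times> carrier G,
     monoid.mult = (\<lambda>(m, g) (m', g'). (m \<oplus>\<^bsub>M\<^esub> act g m', g \<otimes>\<^bsub>G\<^esub> g')),
     one = (\<zero>\<^bsub>M\<^esub>, \<one>\<^bsub>G\<^esub>)\<rparr>"

lemma semidirect_simps [simp]:
  "carrier semidirect = carrier M \<times> carrier G"
  "(m, g) \<otimes>\<^bsub>semidirect\<^esub> (m', g') = (m \<oplus>\<^bsub>M\<^esub> act g m', g \<otimes>\<^bsub>G\<^esub> g')"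
  "\<one>\<^bsub>semidirect\<^esub> = (\<zero>\<^bsub>M\<^esub>, \<one>\<^bsub>G\<^esub>)"
  by (simp_all add: semidirect_def)

lemma group_semidirect: "group semidirect"
proof (rule groupI)
  fix x assume "x \<in> carrier semidirect"
  then obtain m g where x: "x = (m, g)" "m \<in> carrier M" "g \<in> carrier G" by auto
  then have "(act (inv\<^bsub>G\<^esub> g) (\<ominus>\<^bsub>M\<^esub> m), inv\<^bsub>G\<^esub> g) \<otimes>\<^bsub>semidirect\<^esub> x = \<one>\<^bsub>semidirect\<^esub>"
    by (simp add: M.l_neg act_minus)
  then show "\<exists>y\<in>carrier semidirect. y \<otimes>\<^bsub>semidirect\<^esub> x = \<one>\<^bsub>semidirect\<^esub>"
    using x by (intro bexI[of _ "(act (inv\<^bsub>G\<^esub> g) (\<ominus>\<^bsub>M\<^esub> m), inv\<^bsub>G\<^esub> g)"]) auto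
qed (auto simp: M.a_assoc G.m_assoc act_add act_mult)

text \<open>For \<open>n = p\<close> the first component is the norm of \<open>m\<close> that
  appears in (1).\<close>

lemma semidirect_pow:
  assumes "m \<in> carrier M" "g \<in> carrier G"
  shows "(m, g) [^]\<^bsub>semidirect\<^esub> (n::nat)
    = ((\<Oplus>\<^bsub>M\<^esub>i\<in>{..<n}. act (g [^]\<^bsub>G\<^esub> i) m), g [^]\<^bsub>G\<^esub> n)"
proof (induction n)
  case 0
  then show ?case by simp
next
  case (Suc n)
  then show ?case using assms
    by (simp add: lessThan_Suc M.finsum_insert[of "{..<n}" n] M.a_comm Pi_def)
qed

lemma crossed_hom_one:
  assumes "crossed_hom F" shows "F \<one>\<^bsub>G\<^esub> = \<zero>\<^bsub>M\<^esub>"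
proof -
  have c: "F \<one>\<^bsub>G\<^esub> \<in> carrier M" using assms by (simp add: crossed_hom_def)
  have "F (\<one>\<^bsub>G\<^esub> \<otimes>\<^bsub>G\<^esub> \<one>\<^bsub>G\<^esub>) = F \<one>\<^bsub>G\<^esub> \<oplus>\<^bsub>M\<^esub> act \<one>\<^bsub>G\<^esub> (F \<one>\<^bsub>G\<^esub>)"
    using assms unfolding crossed_hom_def by blast
  then have "F \<one>\<^bsub>G\<^esub> \<oplus>\<^bsub>M\<^esub> F \<one>\<^bsub>G\<^esub> = F \<one>\<^bsub>G\<^esub>" using c by simp
  then show ?thesis using c by (simp add: M.add.r_cancel_one)
qed

text \<open>The sum is that of \<open>semidirect_pow\<close>, since \<open>(F g, g)\<close> has
  \<open>(F (g^n), g^n)\<close> as its n-th power.\<close>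

lemma crossed_hom_pow:
  assumes F: "crossed_hom F" and g: "g \<in> carrier G"
  shows "F (g [^]\<^bsub>G\<^esub> (n::nat)) = (\<Oplus>\<^bsub>M\<^esub>i\<in>{..<n}. act (g [^]\<^bsub>G\<^esub> i) (F g))"
proof (induction n)
  case 0
  then show ?case using crossed_hom_one[OF F] by simp
next
  case (Suc n)
  have Fg: "F g \<in> carrier M" using F g by (simp add: crossed_hom_def)
  have "F (g [^]\<^bsub>G\<^esub> Suc n) = F (g [^]\<^bsub>G\<^esub> n) \<oplus>\<^bsub>M\<^esub> act (g [^]\<^bsub>G\<^esub> n) (F g)"
    using F g by (simp add: crossed_hom_def)
  then show ?case using Suc g Fg
    by (simp add: lessThan_Suc M.finsum_insert[of "{..<n}" n] M.a_comm Pi_def)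
qed

end

section \<open>Extensions whose kernel acts trivially, and the relations (1) and (2)\<close>

locale module_extension = gmodule G M act + group_hom G Q \<pi>
  for G :: "('g, 'a) monoid_scheme" and M :: "('m, 'b) ring_scheme"
    and act :: "'g \<Rightarrow> 'm \<Rightarrow> 'm" and Q :: "('q, 'c) monoid_scheme" and \<pi> :: "'g \<Rightarrow> 'q" +
  assumes surj: "\<pi> ` carrier G = carrier Q"
    and action: "group_action G (carrier M) act"
    and kernel_acts: "n \<in> kernel G Q \<pi> \<Longrightarrow> m \<in> carrier M \<Longrightarrow> act n m = m"
begin

abbreviation N :: "'g set" where "N \<equiv> kernel G Q \<pi>"

abbreviation qact :: "'q \<Rightarrow> 'm \<Rightarrow> 'm" where "qact \<equiv> induced_action G \<pi> act"

text \<open>The kernel acts trivially, so any preimage computes the action of \<open>Q\<close>; this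
  hides the choice made in \<open>induced_action\<close>.\<close>

lemma qact_eq [simp]:
  "g \<in> carrier G \<Longrightarrow> m \<in> carrier M \<Longrightarrow> qact (\<pi> g) m = act g m"
  by (rule induced_action_eq[OF group_hom_axioms action kernel_acts])

lemma qlift:
  assumes "q \<in> carrier Q" obtains g where "g \<in> carrier G" "q = \<pi> g"
  using assms surj by blast

lemma gmodule_Q: "gmodule Q M qact"
proof unfold_locales
  fix q m assume "q \<in> carrier Q" "m \<in> carrier M"
  then show "qact q m \<in> carrier M" by (auto elim!: qlift)
next
  fix q m m' assume "q \<in> carrier Q" "m \<in> carrier M" "m' \<in> carrier M"
  then show "qact q (m \<oplus>\<^bsub>M\<^esub> m') = qact q m \<oplus>\<^bsub>M\<^esub> qact q m'"
    by (auto elim!: qlift simp: act_add)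
next
  fix q q' m assume "q \<in> carrier Q" "q' \<in> carrier Q" "m \<in> carrier M"
  then show "qact (q \<otimes>\<^bsub>Q\<^esub> q') m = qact q (qact q' m)"
    by (auto elim!: qlift simp: act_mult simp flip: hom_mult)
next
  fix m assume "m \<in> carrier M"
  then show "qact \<one>\<^bsub>Q\<^esub> m = m"
    using qact_eq[of "\<one>\<^bsub>G\<^esub>" m] by simp
qed

lemma N_carrier: "n \<in> N \<Longrightarrow> n \<in> carrier G" and N_pi: "n \<in> N \<Longrightarrow> \<pi> n = \<one>\<^bsub>Q\<^esub>"
  by (auto simp: kernel_def)

lemma N_conj: "n \<in> N \<Longrightarrow> g \<in> carrier G \<Longrightarrow> g \<otimes>\<^bsub>G\<^esub> n \<otimes>\<^bsub>G\<^esub> inv\<^bsub>G\<^esub> g \<in> N"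
  by (auto simp: kernel_def)

lemma N_quotient:
  "g \<in> carrier G \<Longrightarrow> h \<in> carrier G \<Longrightarrow> \<pi> g = \<pi> h \<Longrightarrow> g \<otimes>\<^bsub>G\<^esub> inv\<^bsub>G\<^esub> h \<in> N"
  by (auto simp: kernel_def)

text \<open>The \<open>x j\<close> stand for the chosen lifts of the generators. The first relation
  is the power formula for \<open>F\<close>; the second compares the two expansions of
  \<open>F\<close> on \<open>x j * x i\<close>, written also as commutator times
  \<open>x i * x j\<close>.\<close>

lemma crossed_hom_imp_relations:
  fixes p k :: nat
  assumes F: "crossed_hom F" and ext: "\<And>n. n \<in> N \<Longrightarrow> F n = \<phi> n"
    and x: "\<And>j. j < k \<Longrightarrow> x j \<in> carrier G"
    and pow: "\<And>j. j < k \<Longrightarrow> x j [^]\<^bsub>G\<^esub> p \<in> N"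
    and comm: "\<And>i j. i < j \<Longrightarrow> j < k \<Longrightarrow>
      x j \<otimes>\<^bsub>G\<^esub> x i \<otimes>\<^bsub>G\<^esub> inv\<^bsub>G\<^esub> x j \<otimes>\<^bsub>G\<^esub> inv\<^bsub>G\<^esub> x i \<in> N"
  defines "m \<equiv> \<lambda>j. \<ominus>\<^bsub>M\<^esub> F (x j)"
  shows "j < k \<Longrightarrow> m j \<in> carrier M"
    and "j < k \<Longrightarrow> \<phi> (x j [^]\<^bsub>G\<^esub> p) = \<ominus>\<^bsub>M\<^esub> (\<Oplus>\<^bsub>M\<^esub>i\<in>{..<p}. act (x j [^]\<^bsub>G\<^esub> i) (m j))"
    and "i < j \<Longrightarrow> j < k \<Longrightarrow>
      \<phi> (x j \<otimes>\<^bsub>G\<^esub> x i \<otimes>\<^bsub>G\<^esub> inv\<^bsub>G\<^esub> x j \<otimes>\<^bsub>G\<^esub> inv\<^bsub>G\<^esub> x i)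
        = (m i \<ominus>\<^bsub>M\<^esub> act (x j) (m i)) \<ominus>\<^bsub>M\<^esub> (m j \<ominus>\<^bsub>M\<^esub> act (x i) (m j))"
proof -
  have F_closed: "F g \<in> carrier M" if "g \<in> carrier G" for g
    using F that by (simp add: crossed_hom_def)
  have F_mult: "F (g \<otimes>\<^bsub>G\<^esub> h) = F g \<oplus>\<^bsub>M\<^esub> act g (F h)" if "g \<in> carrier G" "h \<in> carrier G" for g h
    using F that by (simp add: crossed_hom_def)
  show "j < k \<Longrightarrow> m j \<in> carrier M" using F_closed x by (simp add: m_def)
  assume j: "j < k"
  note xj = x[OF j] F_closed[OF x[OF j]]
  then show "\<phi> (x j [^]\<^bsub>G\<^esub> p) = \<ominus>\<^bsub>M\<^esub> (\<Oplus>\<^bsub>M\<^esub>i\<in>{..<p}. act (x j [^]\<^bsub>G\<^esub> i) (m j))"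
    using xj pow[OF j] by (simp add: m_def sum_act_minus ext[symmetric] crossed_hom_pow[OF F] Pi_def)
  assume i: "i < j"
  let ?c = "x j \<otimes>\<^bsub>G\<^esub> x i \<otimes>\<^bsub>G\<^esub> inv\<^bsub>G\<^esub> x j \<otimes>\<^bsub>G\<^esub> inv\<^bsub>G\<^esub> x i"
  have c: "?c \<in> N" using comm i j by blast
  have xi: "x i \<in> carrier G" "F (x i) \<in> carrier M"
    using x[OF less_trans[OF i j]] F_closed[OF x[OF less_trans[OF i j]]] by this+
  have eq: "?c \<otimes>\<^bsub>G\<^esub> (x i \<otimes>\<^bsub>G\<^esub> x j) = x j \<otimes>\<^bsub>G\<^esub> x i"
    using xi xj by (simp add: G.commutator_mult)
  \<comment> \<open>The commutator lies in \<open>N\<close> and acts trivially, so its value splits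
    off as a plain summand.\<close>
  have "F ?c \<oplus>\<^bsub>M\<^esub> (F (x i) \<oplus>\<^bsub>M\<^esub> act (x i) (F (x j))) = F (x j) \<oplus>\<^bsub>M\<^esub> act (x j) (F (x i))"
    using arg_cong[OF eq, of F] xi xj N_carrier[OF c] kernel_acts[OF c] by (simp add: F_mult)
  then have "F ?c = F (x j) \<oplus>\<^bsub>M\<^esub> act (x j) (F (x i)) \<ominus>\<^bsub>M\<^esub> (F (x i) \<oplus>\<^bsub>M\<^esub> act (x i) (F (x j)))"
    using xi xj N_carrier[OF c] F_closed
    by (metis M.add.inv_solve_right M.minus_eq act_closed M.a_closed)
  also have "\<dots> = (m i \<ominus>\<^bsub>M\<^esub> act (x j) (m i)) \<ominus>\<^bsub>M\<^esub> (m j \<ominus>\<^bsub>M\<^esub> act (x i) (m j))"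
    using act_closed[OF xj(1) xi(2)] act_closed[OF xi(1) xj(2)] xi(2) xj(2)
    unfolding m_def act_minus[OF xj(1) xi(2)] act_minus[OF xi(1) xj(2)] by algebra
  finally show "\<phi> ?c = (m i \<ominus>\<^bsub>M\<^esub> act (x j) (m i)) \<ominus>\<^bsub>M\<^esub> (m j \<ominus>\<^bsub>M\<^esub> act (x i) (m j))"
    using ext[OF c] by simp
qed

text \<open>The crossed homomorphism is obtained as a graph in the semidirect product \<open>E = M \<rtimes> G\<close>. The
  graph \<open>K\<close> of \<open>\<phi>\<close> is normal in \<open>E\<close>, and the relations say that the elements \<open>(- m\<^sub>j, x\<^sub>j)\<close> become
  commuting elements of order \<open>p\<close> in \<open>E / K\<close>. They generate a group with at most \<open>p\<^sup>k\<close> elements,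
  which therefore maps bijectively onto \<open>Q\<close>; its preimage in \<open>E\<close> maps bijectively onto \<open>G\<close>.\<close>

lemma relations_imp_crossed_hom:
  fixes p k :: nat
  assumes \<phi>: "\<phi> \<in> hom (G\<lparr>carrier := N\<rparr>) (add_monoid M)"
    and equiv: "\<And>g n. g \<in> carrier G \<Longrightarrow> n \<in> N \<Longrightarrow> \<phi> (g \<otimes>\<^bsub>G\<^esub> n \<otimes>\<^bsub>G\<^esub> inv\<^bsub>G\<^esub> g) = act g (\<phi> n)"
    and p: "p > 0"
    and x: "\<And>j. j < k \<Longrightarrow> x j \<in> carrier G"
    and gen: "generate Q ((\<lambda>j. \<pi> (x j)) ` {..<k}) = carrier Q"
    and card: "card (carrier Q) = p ^ k"
    and pow: "\<And>j. j < k \<Longrightarrow> x j [^]\<^bsub>G\<^esub> p \<in> N"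
    and comm: "\<And>i j. i < j \<Longrightarrow> j < k \<Longrightarrow>
      x j \<otimes>\<^bsub>G\<^esub> x i \<otimes>\<^bsub>G\<^esub> inv\<^bsub>G\<^esub> x j \<otimes>\<^bsub>G\<^esub> inv\<^bsub>G\<^esub> x i \<in> N"
    and m: "\<And>j. j < k \<Longrightarrow> m j \<in> carrier M"
    and rel1: "\<And>j. j < k \<Longrightarrow>
      \<phi> (x j [^]\<^bsub>G\<^esub> p) = \<ominus>\<^bsub>M\<^esub> (\<Oplus>\<^bsub>M\<^esub>i\<in>{..<p}. act (x j [^]\<^bsub>G\<^esub> i) (m j))"
    and rel2: "\<And>i j. i < j \<Longrightarrow> j < k \<Longrightarrow>
      \<phi> (x j \<otimes>\<^bsub>G\<^esub> x i \<otimes>\<^bsub>G\<^esub> inv\<^bsub>G\<^esub> x j \<otimes>\<^bsub>G\<^esub> inv\<^bsub>G\<^esub> x i)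
        = (m i \<ominus>\<^bsub>M\<^esub> act (x j) (m i)) \<ominus>\<^bsub>M\<^esub> (m j \<ominus>\<^bsub>M\<^esub> act (x i) (m j))"
  shows "\<exists>F. crossed_hom F \<and> (\<forall>n\<in>N. F n = \<phi> n)"
proof -
  let ?E = semidirect
  interpret E: group ?E by (rule group_semidirect)
  have \<phi>_closed: "\<phi> n \<in> carrier M" if "n \<in> N" for n
    using \<phi> that by (auto simp: hom_def)
  have \<phi>_mult: "\<phi> (n \<otimes>\<^bsub>G\<^esub> n') = \<phi> n \<oplus>\<^bsub>M\<^esub> \<phi> n'" if "n \<in> N" "n' \<in> N" for n n'
    using \<phi> that by (auto simp: hom_def)
  have N_sub: "subgroup N G" by (rule subgroup_kernel)
  have one_N: "\<one>\<^bsub>G\<^esub> \<in> N" using N_sub by (rule subgroup.one_closed)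
  have \<phi>_one: "\<phi> \<one>\<^bsub>G\<^esub> = \<zero>\<^bsub>M\<^esub>"
    using \<phi>_mult[OF one_N one_N] \<phi>_closed[OF one_N] by (simp add: M.add.r_cancel_one')
  define K where "K = (\<lambda>n. (\<phi> n, n)) ` N"
  have K_iff: "(a, g) \<in> K \<longleftrightarrow> g \<in> N \<and> a = \<phi> g" for a g by (auto simp: K_def)
  have mult_K: "(\<phi> n, n) \<otimes>\<^bsub>?E\<^esub> (a, g) = (\<phi> n \<oplus>\<^bsub>M\<^esub> a, n \<otimes>\<^bsub>G\<^esub> g)" if "n \<in> N" "a \<in> carrier M" for n a g
    using that kernel_acts by simp
  have K_sub: "subgroup K ?E"
  proof (rule E.subgroupI)
    show "K \<subseteq> carrier ?E" using \<phi>_closed N_carrier by (auto simp: K_def)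
    show "K \<noteq> {}" using one_N by (auto simp: K_def)
  next
    fix u assume "u \<in> K"
    then obtain n where n: "n \<in> N" "u = (\<phi> n, n)" by (auto simp: K_def)
    have inv_n: "inv\<^bsub>G\<^esub> n \<in> N" using N_sub n(1) by (rule subgroup.m_inv_closed)
    have "(\<phi> (inv\<^bsub>G\<^esub> n), inv\<^bsub>G\<^esub> n) \<otimes>\<^bsub>?E\<^esub> u = \<one>\<^bsub>?E\<^esub>"
      using n inv_n \<phi>_closed N_carrier
      by (simp add: kernel_acts \<phi>_one flip: \<phi>_mult)
    then have "inv\<^bsub>?E\<^esub> u = (\<phi> (inv\<^bsub>G\<^esub> n), inv\<^bsub>G\<^esub> n)"
      using n inv_n \<phi>_closed N_carrier by (intro E.inv_equality) auto
    then show "inv\<^bsub>?E\<^esub> u \<in> K" using inv_n by (simp add: K_iff)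
  next
    fix u v assume "u \<in> K" "v \<in> K"
    then show "u \<otimes>\<^bsub>?E\<^esub> v \<in> K"
      using \<phi>_closed subgroup.m_closed[OF N_sub]
      by (cases u; cases v) (auto simp: K_iff kernel_acts \<phi>_mult)
  qed
  have K_normal: "K \<lhd> ?E"
  proof (rule E.normalI[OF K_sub], intro ballI)
    fix u assume "u \<in> carrier ?E"
    then obtain a g where u: "u = (a, g)" "a \<in> carrier M" "g \<in> carrier G" by auto
    \<comment> \<open>Conjugation by \<open>(a, g)\<close> carries the graph point over
      \<open>n\<close> to the one over \<open>g n g^-1\<close>: \<open>a\<close> cancels because
      \<open>N\<close> acts trivially, and equivariance of \<open>\<phi>\<close> gives the first
      component.\<close>
    have right: "(a, g) \<otimes>\<^bsub>?E\<^esub> (\<phi> n, n) = (\<phi> (g \<otimes>\<^bsub>G\<^esub> n \<otimes>\<^bsub>G\<^esub> inv\<^bsub>G\<^esub> g), g \<otimes>\<^bsub>G\<^esub> n \<otimes>\<^bsub>G\<^esub> inv\<^bsub>G\<^esub> g) \<otimes>\<^bsub>?E\<^esub> (a, g)"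
      if "n \<in> N" for n
    proof -
      have "g \<otimes>\<^bsub>G\<^esub> n = g \<otimes>\<^bsub>G\<^esub> n \<otimes>\<^bsub>G\<^esub> inv\<^bsub>G\<^esub> g \<otimes>\<^bsub>G\<^esub> g"
        using u N_carrier[OF that] by (simp add: G.m_assoc)
      then show ?thesis
        using that u \<phi>_closed N_conj[OF that u(3)] by (simp add: kernel_acts equiv M.a_comm)
    qed
    \<comment> \<open>The previous identity, applied to \<open>g^-1 n g\<close> in place of
      \<open>n\<close>.\<close>
    have left: "(\<phi> n, n) \<otimes>\<^bsub>?E\<^esub> (a, g)
        = (a, g) \<otimes>\<^bsub>?E\<^esub> (\<phi> (inv\<^bsub>G\<^esub> g \<otimes>\<^bsub>G\<^esub> n \<otimes>\<^bsub>G\<^esub> g), inv\<^bsub>G\<^esub> g \<otimes>\<^bsub>G\<^esub> n \<otimes>\<^bsub>G\<^esub> g)" if "n \<in> N" for n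
    proof -
      have "inv\<^bsub>G\<^esub> g \<otimes>\<^bsub>G\<^esub> n \<otimes>\<^bsub>G\<^esub> g \<in> N"
        using N_conj[OF that, of "inv\<^bsub>G\<^esub> g"] u by simp
      moreover have "g \<otimes>\<^bsub>G\<^esub> (inv\<^bsub>G\<^esub> g \<otimes>\<^bsub>G\<^esub> n \<otimes>\<^bsub>G\<^esub> g) \<otimes>\<^bsub>G\<^esub> inv\<^bsub>G\<^esub> g = n"
        using u N_carrier[OF that] by (simp add: G.m_assoc) (simp flip: G.m_assoc)
      ultimately show ?thesis using right[of "inv\<^bsub>G\<^esub> g \<otimes>\<^bsub>G\<^esub> n \<otimes>\<^bsub>G\<^esub> g"] by (simp only:)
    qed
    show "K #>\<^bsub>?E\<^esub> u = u <#\<^bsub>?E\<^esub> K"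
    proof
      show "K #>\<^bsub>?E\<^esub> u \<subseteq> u <#\<^bsub>?E\<^esub> K"
      proof
        fix z assume "z \<in> K #>\<^bsub>?E\<^esub> u"
        then obtain n where n: "n \<in> N" "z = (\<phi> n, n) \<otimes>\<^bsub>?E\<^esub> (a, g)"
          by (auto simp: r_coset_def K_def u simp del: semidirect_simps)
        have "inv\<^bsub>G\<^esub> g \<otimes>\<^bsub>G\<^esub> n \<otimes>\<^bsub>G\<^esub> g \<in> N"
          using N_conj[OF n(1), of "inv\<^bsub>G\<^esub> g"] u by simp
        then show "z \<in> u <#\<^bsub>?E\<^esub> K"
          unfolding l_coset_def K_def u n(2) left[OF n(1)] by blast
      qed
      show "u <#\<^bsub>?E\<^esub> K \<subseteq> K #>\<^bsub>?E\<^esub> u"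
      proof
        fix z assume "z \<in> u <#\<^bsub>?E\<^esub> K"
        then obtain n where n: "n \<in> N" "z = (a, g) \<otimes>\<^bsub>?E\<^esub> (\<phi> n, n)"
          by (auto simp: l_coset_def K_def u simp del: semidirect_simps)
        then show "z \<in> K #>\<^bsub>?E\<^esub> u"
          unfolding r_coset_def K_def u n(2) right[OF n(1)]
          using N_conj[OF n(1) u(3)] by blast
      qed
    qed
  qed
  interpret K: normal K ?E by (rule K_normal)
  interpret EK: group "?E Mod K" by (rule K.factorgroup_is_group)
  let ?c = "\<lambda>u. K #>\<^bsub>?E\<^esub> u"
  interpret c: group_hom ?E "?E Mod K" ?c
    using K.r_coset_hom_Mod by unfold_locales
  have c_eq: "?c u = ?c v" if "u = w \<otimes>\<^bsub>?E\<^esub> v" "w \<in> K" "v \<in> carrier ?E" for u v w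
  proof -
    have "u \<in> ?c v" using that by (auto simp: r_coset_def)
    then show ?thesis using E.repr_independence[OF _ that(3) K_sub] by simp
  qed
  \<comment> \<open>The points that the graph of the wanted \<open>F\<close> must contain,
    \<open>F (x j)\<close> being prescribed as \<open>- m j\<close>.\<close>
  define y where "y j = (\<ominus>\<^bsub>M\<^esub> m j, x j)" for j
  have y: "y j \<in> carrier ?E" if "j < k" for j using that m x by (simp add: y_def)
  have y_pow: "?c (y j) [^]\<^bsub>?E Mod K\<^esub> p = \<one>\<^bsub>?E Mod K\<^esub>" if j: "j < k" for j
  proof -
    \<comment> \<open>The first component of this power is minus the norm of \<open>m j\<close>, so
      (1) says precisely that the power lies on the graph of \<open>\<phi>\<close>.\<close>
    have "y j [^]\<^bsub>?E\<^esub> p \<in> K"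
      unfolding y_def using semidirect_pow[of "\<ominus>\<^bsub>M\<^esub> m j" "x j" p] j m x pow rel1
      by (simp add: K_iff sum_act_minus)
    then have "?c (y j [^]\<^bsub>?E\<^esub> p) = \<one>\<^bsub>?E Mod K\<^esub>"
      using K_sub E.coset_join2 K.mem_carrier by (simp add: FactGroup_def del: semidirect_simps)
    then show ?thesis using y[OF j] c.hom_nat_pow by (simp del: semidirect_simps)
  qed
  have y_comm: "?c (y i) \<otimes>\<^bsub>?E Mod K\<^esub> ?c (y j) = ?c (y j) \<otimes>\<^bsub>?E Mod K\<^esub> ?c (y i)"
    if ij: "i < j" "j < k" for i j
  proof -
    let ?w = "x j \<otimes>\<^bsub>G\<^esub> x i \<otimes>\<^bsub>G\<^esub> inv\<^bsub>G\<^esub> x j \<otimes>\<^bsub>G\<^esub> inv\<^bsub>G\<^esub> x i"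
    have w: "?w \<in> N" using comm ij by blast
    have i: "i < k" using ij by simp
    note carr = x[OF i] x[OF ij(2)] m[OF i] m[OF ij(2)]
    have "?w \<otimes>\<^bsub>G\<^esub> (x i \<otimes>\<^bsub>G\<^esub> x j) = x j \<otimes>\<^bsub>G\<^esub> x i"
      using carr by (simp add: G.commutator_mult)
    \<comment> \<open>Comparison of first components in
      \<open>y j * y i = (\<phi> w, w) * (y i * y j)\<close>; the first bracket on the right is the
      value of \<open>\<phi> w\<close> given by (2).\<close>
    moreover have "\<ominus>\<^bsub>M\<^esub> m j \<oplus>\<^bsub>M\<^esub> \<ominus>\<^bsub>M\<^esub> act (x j) (m i)
        = ((m i \<ominus>\<^bsub>M\<^esub> act (x j) (m i)) \<ominus>\<^bsub>M\<^esub> (m j \<ominus>\<^bsub>M\<^esub> act (x i) (m j)))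
          \<oplus>\<^bsub>M\<^esub> (\<ominus>\<^bsub>M\<^esub> m i \<oplus>\<^bsub>M\<^esub> \<ominus>\<^bsub>M\<^esub> act (x i) (m j))"
      using act_closed[OF carr(1,4)] act_closed[OF carr(2,3)] carr(3,4) by algebra
    ultimately have "y j \<otimes>\<^bsub>?E\<^esub> y i = (\<phi> ?w, ?w) \<otimes>\<^bsub>?E\<^esub> (y i \<otimes>\<^bsub>?E\<^esub> y j)"
      unfolding y_def using w carr rel2[OF ij] by (simp add: kernel_acts act_minus)
    then have "?c (y j \<otimes>\<^bsub>?E\<^esub> y i) = ?c (y i \<otimes>\<^bsub>?E\<^esub> y j)"
      using w y[OF i] y[OF ij(2)]
      by (intro c_eq[where w = "(\<phi> ?w, ?w)"]) (auto simp: K_iff simp del: semidirect_simps)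
    then show ?thesis
      using y[OF i] y[OF ij(2)] by (simp del: semidirect_simps)
  qed
  define H where "H = generate (?E Mod K) ((\<lambda>j. ?c (y j)) ` {..<k})"
  have gens: "(\<lambda>j. ?c (y j)) ` {..<k} \<subseteq> carrier (?E Mod K)"
    using y by (auto simp del: semidirect_simps)
  have H_sub: "subgroup H (?E Mod K)"
    unfolding H_def by (rule EK.generate_is_subgroup[OF gens])
  have H: "finite H" "card H \<le> p ^ k"
    using EK.card_generate_commuting[OF p, of k "\<lambda>j. ?c (y j)"] y y_pow y_comm
    by (auto simp: H_def simp del: semidirect_simps)
  text \<open>\<open>\<theta>\<close> is the map \<open>E / K \<rightarrow> Q\<close> induced by \<open>\<pi>\<close>.\<close>
  define \<theta> where "\<theta> Y = \<pi> (snd (SOME u. u \<in> Y))" for Y :: "('m \<times> 'g) set"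
  have \<theta>: "\<theta> (?c u) = \<pi> (snd u)" if u: "u \<in> carrier ?E" for u
  proof -
    have "u \<in> ?c u" by (rule E.rcos_self[OF u K_sub])
    then have "(SOME v. v \<in> ?c u) \<in> ?c u" by (rule someI)
    then obtain n where n: "n \<in> N" "(SOME v. v \<in> ?c u) = (\<phi> n, n) \<otimes>\<^bsub>?E\<^esub> u"
      by (auto simp: r_coset_def K_def simp del: semidirect_simps)
    show ?thesis
      using u unfolding \<theta>_def n(2) by (cases u) (use n(1) N_carrier N_pi in auto)
  qed
  \<comment> \<open>Lifts are built along the generation of \<open>Q\<close>: each generator lifts
    to some \<open>y j\<close>, and products and inverses of lifts stay in the preimage of
    \<open>H\<close>.\<close>
  have H_surj: "\<exists>u\<in>carrier ?E. ?c u \<in> H \<and> \<pi> (snd u) = q" if "q \<in> carrier Q" for q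
  proof -
    have "q \<in> generate Q ((\<lambda>j. \<pi> (x j)) ` {..<k})" using gen that by simp
    then show ?thesis
    proof induction
      case one
      show ?case
        using subgroup.one_closed[OF H_sub] c.hom_one by (intro bexI[of _ "\<one>\<^bsub>?E\<^esub>"]) auto
    next
      case (incl h)
      then obtain j where j: "j < k" "h = \<pi> (x j)" by auto
      then have "?c (y j) \<in> H" by (auto simp: H_def intro: generate.incl)
      then show ?case using j y by (intro bexI[of _ "y j"]) (auto simp: y_def)
    next
      case (inv h)
      then obtain j where j: "j < k" "h = \<pi> (x j)" by auto
      then have "?c (y j) \<in> H" by (auto simp: H_def intro: generate.incl)
      then have "?c (inv\<^bsub>?E\<^esub> y j) \<in> H"
        using subgroup.m_inv_closed[OF H_sub] y[OF j(1)] by (simp del: semidirect_simps)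
      moreover have "inv\<^bsub>?E\<^esub> y j = (act (inv\<^bsub>G\<^esub> x j) (m j), inv\<^bsub>G\<^esub> x j)"
        using m x j by (intro E.inv_equality) (auto simp: y_def M.r_neg simp flip: act_add)
      ultimately show ?case using j m x by (intro bexI[of _ "inv\<^bsub>?E\<^esub> y j"]) auto
    next
      case (eng q1 q2)
      then obtain u1 u2 where u: "u1 \<in> carrier ?E" "?c u1 \<in> H" "\<pi> (snd u1) = q1"
        "u2 \<in> carrier ?E" "?c u2 \<in> H" "\<pi> (snd u2) = q2" by blast
      then have "?c (u1 \<otimes>\<^bsub>?E\<^esub> u2) \<in> H"
        using subgroup.m_closed[OF H_sub] by (simp del: semidirect_simps)
      moreover have "\<pi> (snd (u1 \<otimes>\<^bsub>?E\<^esub> u2)) = q1 \<otimes>\<^bsub>Q\<^esub> q2"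
        using u by (cases u1; cases u2) auto
      ultimately show ?case using u E.m_closed by blast
    qed
  qed
  have "carrier Q \<subseteq> \<theta> ` H"
  proof
    fix q assume "q \<in> carrier Q"
    then obtain u where "u \<in> carrier ?E" "?c u \<in> H" "\<pi> (snd u) = q" using H_surj by blast
    then show "q \<in> \<theta> ` H" using \<theta>[of u] by (intro image_eqI[of _ _ "?c u"]) simp_all
  qed
  then have "p ^ k \<le> card (\<theta> ` H)"
    using H(1) by (simp add: card_mono flip: card)
  then have "card (\<theta> ` H) = card H"
    using H card_image_le[OF H(1), of \<theta>] by linarith
  then have \<theta>_inj: "inj_on \<theta> H"
    by (rule eq_card_imp_inj_on[OF H(1)])
  have graph_ex: "\<exists>a\<in>carrier M. ?c (a, g) \<in> H" if g: "g \<in> carrier G" for g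
  proof -
    obtain a g' where u: "a \<in> carrier M" "g' \<in> carrier G" "?c (a, g') \<in> H" "\<pi> g' = \<pi> g"
      using H_surj[of "\<pi> g"] g by auto
    \<comment> \<open>Two elements over the same point of \<open>Q\<close> differ by
      \<open>n\<close> in \<open>N\<close>. Multiplying by \<open>(\<phi> n, n)\<close> stays in the
      same coset of \<open>K\<close> and moves the second component from \<open>g'\<close> to
      \<open>g\<close>.\<close>
    define n where "n = g \<otimes>\<^bsub>G\<^esub> inv\<^bsub>G\<^esub> g'"
    have n: "n \<in> N" unfolding n_def using u g by (intro N_quotient) auto
    have "(\<phi> n \<oplus>\<^bsub>M\<^esub> a, g) = (\<phi> n, n) \<otimes>\<^bsub>?E\<^esub> (a, g')"
      using n u g by (simp add: kernel_acts) (simp add: n_def G.m_assoc)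
    then have "?c (\<phi> n \<oplus>\<^bsub>M\<^esub> a, g) = ?c (a, g')"
      using n u by (intro c_eq[where w = "(\<phi> n, n)"]) (auto simp: K_iff)
    then show ?thesis using u n \<phi>_closed by (intro bexI[of _ "\<phi> n \<oplus>\<^bsub>M\<^esub> a"]) auto
  qed
  \<comment> \<open>Both cosets have the same image in \<open>Q\<close>, hence coincide by
    injectivity of \<open>\<theta>\<close> on \<open>H\<close>; and \<open>K\<close> has only the
    identity over the identity of \<open>G\<close>.\<close>
  have graph_unique: "a = b" if "a \<in> carrier M" "b \<in> carrier M" "g \<in> carrier G"
    "?c (a, g) \<in> H" "?c (b, g) \<in> H" for a b g
  proof -
    have "?c (a, g) = ?c (b, g)"
      using \<theta>_inj that \<theta> by (auto simp: inj_on_def)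
    then have "(a, g) \<in> ?c (b, g)"
      using E.rcos_self[OF _ K_sub, of "(a, g)"] that by simp
    then obtain n where n: "n \<in> N" "(a, g) = (\<phi> n, n) \<otimes>\<^bsub>?E\<^esub> (b, g)"
      by (auto simp: r_coset_def K_def simp del: semidirect_simps)
    then have "n \<otimes>\<^bsub>G\<^esub> g = g" "a = \<phi> n \<oplus>\<^bsub>M\<^esub> b" using that kernel_acts by auto
    moreover have "n = \<one>\<^bsub>G\<^esub>"
      using G.r_cancel_one[OF that(3) N_carrier[OF n(1)]] \<open>n \<otimes>\<^bsub>G\<^esub> g = g\<close> by simp
    ultimately show "a = b" using that \<phi>_one by simp
  qed
  define F where "F g = (SOME a. a \<in> carrier M \<and> ?c (a, g) \<in> H)" for g
  have F: "F g \<in> carrier M \<and> ?c (F g, g) \<in> H" if "g \<in> carrier G" for g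
    unfolding F_def
    by (rule someI_ex[of "\<lambda>a. a \<in> carrier M \<and> ?c (a, g) \<in> H"]) (use graph_ex[OF that] in blast)
  have F_eq: "F g = a" if "a \<in> carrier M" "g \<in> carrier G" "?c (a, g) \<in> H" for a g
    using F[OF that(2)] by (intro graph_unique[OF _ that(1,2) _ that(3)]) simp_all
  have "F n = \<phi> n" if n: "n \<in> N" for n
  proof (rule F_eq)
    have "?c (\<phi> n, n) = K"
      using n \<phi>_closed N_carrier K_sub by (intro E.coset_join2) (auto simp: K_iff)
    then show "?c (\<phi> n, n) \<in> H"
      using subgroup.one_closed[OF H_sub] by (simp add: FactGroup_def)
  qed (use n \<phi>_closed N_carrier in auto)
  moreover have "F (g \<otimes>\<^bsub>G\<^esub> h) = F g \<oplus>\<^bsub>M\<^esub> act g (F h)" if "g \<in> carrier G" "h \<in> carrier G" for g h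
  proof (rule F_eq)
    \<comment> \<open>The preimage of the subgroup \<open>H\<close> is closed under products, and it
      contains only one point over \<open>g h\<close>.\<close>
    have "?c ((F g, g) \<otimes>\<^bsub>?E\<^esub> (F h, h)) \<in> H"
      using F that subgroup.m_closed[OF H_sub] c.hom_mult[of "(F g, g)" "(F h, h)"] by simp
    then show "?c (F g \<oplus>\<^bsub>M\<^esub> act g (F h), g \<otimes>\<^bsub>G\<^esub> h) \<in> H" by simp
  qed (use F that in auto)
  ultimately show ?thesis using F by (intro exI[of _ F]) (auto simp: crossed_hom_def)
qed

end

section \<open>Low-degree cochains\<close>

abbreviation tup1 :: "'g \<Rightarrow> nat \<Rightarrow> 'g" where
  "tup1 g \<equiv> (\<lambda>i\<in>{..<1}. g)"

abbreviation tup2 :: "'g \<Rightarrow> 'g \<Rightarrow> nat \<Rightarrow> 'g" where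
  "tup2 g h \<equiv> (\<lambda>i\<in>{..<2}. if i = 0 then g else h)"

abbreviation tup3 :: "'g \<Rightarrow> 'g \<Rightarrow> 'g \<Rightarrow> nat \<Rightarrow> 'g" where
  "tup3 g h k \<equiv> (\<lambda>i\<in>{..<3}. if i = 0 then g else if i = 1 then h else k)"

lemma tuples_1E:
  assumes "x \<in> tuples G 1" obtains g where "g \<in> carrier G" "x = tup1 g"
proof
  show "x 0 \<in> carrier G" using assms by (auto simp: PiE_iff)
  show "x = tup1 (x 0)"
    using assms by (intro ext) (auto simp: PiE_iff extensional_def)
qed

lemma tuples_2E:
  assumes "x \<in> tuples G 2" obtains g h where "g \<in> carrier G" "h \<in> carrier G" "x = tup2 g h"
proof
  show "x 0 \<in> carrier G" "x 1 \<in> carrier G" using assms by (auto simp: PiE_iff)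
  show "x = tup2 (x 0) (x 1)"
    using assms by (intro ext) (auto simp: PiE_iff extensional_def less_2_cases_iff)
qed

lemma tuples_3E:
  assumes "x \<in> tuples G 3"
  obtains g h k where "g \<in> carrier G" "h \<in> carrier G" "k \<in> carrier G" "x = tup3 g h k"
proof
  show "x 0 \<in> carrier G" "x 1 \<in> carrier G" "x 2 \<in> carrier G" using assms by (auto simp: PiE_iff)
  show "x = tup3 (x 0) (x 1) (x 2)"
  proof
    fix i :: nat
    consider "i = 0" | "i = 1" | "i = 2" | "i \<ge> 3" by linarith
    then show "x i = tup3 (x 0) (x 1) (x 2) i"
      using assms by cases (auto simp: PiE_iff extensional_def)
  qed
qed

lemma tuples_I:
  "g \<in> carrier G \<Longrightarrow> tup1 g \<in> tuples G 1"
  "g \<in> carrier G \<Longrightarrow> h \<in> carrier G \<Longrightarrow> tup2 g h \<in> tuples G 2"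
  "g \<in> carrier G \<Longrightarrow> h \<in> carrier G \<Longrightarrow> k \<in> carrier G \<Longrightarrow> tup3 g h k \<in> tuples G 3"
  by auto

lemma coboundary_extensional: "coboundary G M act n f \<in> extensional (tuples G (Suc n))"
  unfolding coboundary_def by (rule restrict_extensional)

lemma zero_cochain_extensional: "zero_cochain G M n \<in> extensional (tuples G n)"
  unfolding zero_cochain_def by (rule restrict_extensional)

section \<open>The coboundary map in low degrees\<close>

context gmodule
begin

abbreviation mvals :: "nat \<Rightarrow> ((nat \<Rightarrow> 'g) \<Rightarrow> 'm) set" where
  "mvals n \<equiv> tuples G n \<rightarrow> carrier M"

abbreviation cob :: "nat \<Rightarrow> ((nat \<Rightarrow> 'g) \<Rightarrow> 'm) \<Rightarrow> (nat \<Rightarrow> 'g) \<Rightarrow> 'm" where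
  "cob \<equiv> coboundary G M act"

text \<open>The inner faces of the bar complex, spelled as in \<open>coboundary\<close> so that
  unfolding produces them literally.\<close>

abbreviation merge :: "nat \<Rightarrow> nat \<Rightarrow> (nat \<Rightarrow> 'g) \<Rightarrow> nat \<Rightarrow> 'g" where
  "merge n i x \<equiv> (\<lambda>j\<in>{..<n}. if j < i then x j
     else if j = i then x i \<otimes>\<^bsub>G\<^esub> x (Suc i) else x (Suc j))"

lemma face_tuples:
  assumes "x \<in> tuples G (Suc n)"
  shows "(\<lambda>j\<in>{..<n}. x (Suc j)) \<in> tuples G n" "(\<lambda>j\<in>{..<n}. x j) \<in> tuples G n"
    and "i < n \<Longrightarrow> merge n i x \<in> tuples G n"
  using assms by (auto simp: PiE_iff)

lemma add_pow_sign_eq: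
  assumes "m \<in> carrier M"
  shows "add_pow M ((- 1 :: int) ^ k) m = (if even k then m else \<ominus>\<^bsub>M\<^esub> m)"
  using assms by (auto simp: add_pow_int_lt add_pow_int_ge)

text \<open>Integer multiples by powers of -1 become a case distinction. The exponent of the inner
  face \<open>i\<close> is \<open>Suc i\<close>, so odd \<open>i\<close> carries the positive sign;
  the last face follows the same rule with \<open>n\<close>.\<close>

lemma coboundary_apply:
  assumes f: "f \<in> mvals n" and x: "x \<in> tuples G (Suc n)"
  shows "cob n f x = act (x 0) (f (\<lambda>j\<in>{..<n}. x (Suc j)))
    \<oplus>\<^bsub>M\<^esub> (\<Oplus>\<^bsub>M\<^esub>i\<in>{..<n}. if odd i then f (merge n i x) else \<ominus>\<^bsub>M\<^esub> f (merge n i x))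
    \<oplus>\<^bsub>M\<^esub> (if odd n then f (\<lambda>j\<in>{..<n}. x j) else \<ominus>\<^bsub>M\<^esub> f (\<lambda>j\<in>{..<n}. x j))"
proof -
  have "(\<Oplus>\<^bsub>M\<^esub>i\<in>{..<n}. add_pow M ((- 1 :: int) ^ Suc i) (f (merge n i x)))
      = (\<Oplus>\<^bsub>M\<^esub>i\<in>{..<n}. if odd i then f (merge n i x) else \<ominus>\<^bsub>M\<^esub> f (merge n i x))"
  proof (rule M.finsum_cong')
    fix i assume "i \<in> {..<n}"
    then have "f (merge n i x) \<in> carrier M"
      by (intro funcset_mem[OF f] face_tuples(3)[OF x]) simp
    then show "add_pow M ((- 1 :: int) ^ Suc i) (f (merge n i x))
        = (if odd i then f (merge n i x) else \<ominus>\<^bsub>M\<^esub> f (merge n i x))"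
      by (subst add_pow_sign_eq) auto
  next
    show "(\<lambda>i. if odd i then f (merge n i x) else \<ominus>\<^bsub>M\<^esub> f (merge n i x)) \<in> {..<n} \<rightarrow> carrier M"
      using funcset_mem[OF f face_tuples(3)[OF x]] by (intro funcsetI) auto
  qed simp
  moreover have "add_pow M ((- 1 :: int) ^ Suc n) (f (\<lambda>j\<in>{..<n}. x j))
      = (if odd n then f (\<lambda>j\<in>{..<n}. x j) else \<ominus>\<^bsub>M\<^esub> f (\<lambda>j\<in>{..<n}. x j))"
    using funcset_mem[OF f face_tuples(2)[OF x]] by (subst add_pow_sign_eq) auto
  ultimately show ?thesis unfolding coboundary_def using x by simp
qed

lemma coboundary_values:
  assumes f: "f \<in> mvals n" shows "cob n f \<in> mvals (Suc n)"
proof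
  fix x assume x: "x \<in> tuples G (Suc n)"
  then have "x 0 \<in> carrier G" by auto
  moreover have "f (merge n i x) \<in> carrier M" if "i < n" for i
    using funcset_mem[OF f face_tuples(3)[OF x that]] .
  ultimately show "cob n f x \<in> carrier M"
    unfolding coboundary_apply[OF f x]
    using funcset_mem[OF f face_tuples(1)[OF x]] funcset_mem[OF f face_tuples(2)[OF x]]
    by (intro M.a_closed M.finsum_closed act_closed) auto
qed

lemma add_add_add:
  assumes "a \<in> carrier M" "a' \<in> carrier M" "b \<in> carrier M" "b' \<in> carrier M"
    "c \<in> carrier M" "c' \<in> carrier M"
  shows "(a \<oplus>\<^bsub>M\<^esub> a') \<oplus>\<^bsub>M\<^esub> (b \<oplus>\<^bsub>M\<^esub> b') \<oplus>\<^bsub>M\<^esub> (c \<oplus>\<^bsub>M\<^esub> c')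
    = (a \<oplus>\<^bsub>M\<^esub> b \<oplus>\<^bsub>M\<^esub> c) \<oplus>\<^bsub>M\<^esub> (a' \<oplus>\<^bsub>M\<^esub> b' \<oplus>\<^bsub>M\<^esub> c')"
  using assms by algebra

lemma coboundary_add:
  assumes f: "f \<in> mvals n" and f': "f' \<in> mvals n"
  shows "cob n (\<lambda>x\<in>tuples G n. f x \<oplus>\<^bsub>M\<^esub> f' x) = (\<lambda>x\<in>tuples G (Suc n). cob n f x \<oplus>\<^bsub>M\<^esub> cob n f' x)"
proof (rule extensionalityI[OF coboundary_extensional restrict_extensional])
  fix x assume x: "x \<in> tuples G (Suc n)"
  let ?s = "\<lambda>x\<in>tuples G n. f x \<oplus>\<^bsub>M\<^esub> f' x"
  have s: "?s \<in> mvals n" using f f' by auto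
  \<comment> \<open>The face term of index \<open>k\<close> with its sign; \<open>k = n\<close>
    gives the last face.\<close>
  let ?e = "\<lambda>h k (y :: nat \<Rightarrow> 'g). if odd (k :: nat) then h y else \<ominus>\<^bsub>M\<^esub> (h y :: 'm)"
  have e: "?e ?s k y = ?e f k y \<oplus>\<^bsub>M\<^esub> ?e f' k y" if "y \<in> tuples G n" for k y
    using that funcset_mem[OF f that] funcset_mem[OF f' that] by (auto simp: M.minus_add)
  have vals: "h y \<in> carrier M" if "h \<in> mvals n" "y \<in> tuples G n" for h y
    using that by (rule funcset_mem)
  have sum: "(\<Oplus>\<^bsub>M\<^esub>i\<in>{..<n}. ?e ?s i (merge n i x))
      = (\<Oplus>\<^bsub>M\<^esub>i\<in>{..<n}. ?e f i (merge n i x)) \<oplus>\<^bsub>M\<^esub> (\<Oplus>\<^bsub>M\<^esub>i\<in>{..<n}. ?e f' i (merge n i x))"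
  proof -
    have "(\<Oplus>\<^bsub>M\<^esub>i\<in>{..<n}. ?e ?s i (merge n i x))
        = (\<Oplus>\<^bsub>M\<^esub>i\<in>{..<n}. ?e f i (merge n i x) \<oplus>\<^bsub>M\<^esub> ?e f' i (merge n i x))"
      using face_tuples(3)[OF x] vals[OF f] vals[OF f']
      by (intro M.finsum_cong' e) auto
    also have "\<dots> = (\<Oplus>\<^bsub>M\<^esub>i\<in>{..<n}. ?e f i (merge n i x)) \<oplus>\<^bsub>M\<^esub> (\<Oplus>\<^bsub>M\<^esub>i\<in>{..<n}. ?e f' i (merge n i x))"
      using face_tuples(3)[OF x] vals[OF f] vals[OF f']
      by (intro M.finsum_addf) auto
    finally show ?thesis .
  qed
  have S: "(\<Oplus>\<^bsub>M\<^esub>i\<in>{..<n}. ?e h i (merge n i x)) \<in> carrier M" if "h \<in> mvals n" for h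
    using face_tuples(3)[OF x] vals[OF that] by (intro M.finsum_closed) auto
  have L: "?e h n (\<lambda>j\<in>{..<n}. x j) \<in> carrier M" if "h \<in> mvals n" for h
    using face_tuples(2)[OF x] vals[OF that] by auto
  have x0: "x 0 \<in> carrier G" using x by auto
  have A: "act (x 0) (h (\<lambda>j\<in>{..<n}. x (Suc j))) \<in> carrier M" if "h \<in> mvals n" for h
    using face_tuples(1)[OF x] vals[OF that] x0 by auto
  have act: "act (x 0) (?s (\<lambda>j\<in>{..<n}. x (Suc j)))
      = act (x 0) (f (\<lambda>j\<in>{..<n}. x (Suc j))) \<oplus>\<^bsub>M\<^esub> act (x 0) (f' (\<lambda>j\<in>{..<n}. x (Suc j)))"
    using face_tuples(1)[OF x] vals[OF f] vals[OF f'] x0 by (simp add: act_add)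
  have "cob n ?s x = cob n f x \<oplus>\<^bsub>M\<^esub> cob n f' x"
    unfolding coboundary_apply[OF f x] coboundary_apply[OF f' x] coboundary_apply[OF s x]
      sum act e[OF face_tuples(2)[OF x]]
    by (intro add_add_add A S L f f')
  then show "cob n ?s x = (\<lambda>x\<in>tuples G (Suc n). cob n f x \<oplus>\<^bsub>M\<^esub> cob n f' x) x"
    using x by simp
qed

lemma coboundary_zero: "cob n (zero_cochain G M n) = zero_cochain G M (Suc n)"
proof (rule extensionalityI[OF coboundary_extensional zero_cochain_extensional])
  fix x assume x: "x \<in> tuples G (Suc n)"
  have z: "zero_cochain G M n \<in> mvals n" by (auto simp: zero_cochain_def)
  have "(\<Oplus>\<^bsub>M\<^esub>i\<in>{..<n}. if odd i then zero_cochain G M n (merge n i x)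
      else \<ominus>\<^bsub>M\<^esub> zero_cochain G M n (merge n i x)) = (\<Oplus>\<^bsub>M\<^esub>i\<in>{..<n}. \<zero>\<^bsub>M\<^esub>)"
    using face_tuples(3)[OF x] by (intro M.finsum_cong') (auto simp: zero_cochain_def minus_zero)
  moreover have "x 0 \<in> carrier G" using x by auto
  ultimately show "cob n (zero_cochain G M n) x = zero_cochain G M (Suc n) x"
    unfolding coboundary_apply[OF z x] using x face_tuples(1,2)[OF x]
    by (auto simp: zero_cochain_def minus_zero)
qed

lemma finsum_lessThan_1: "P 0 \<in> carrier M \<Longrightarrow> finsum M P {..<1::nat} = P 0"
  by (simp add: lessThan_Suc)

lemma finsum_lessThan_2:
  "P 0 \<in> carrier M \<Longrightarrow> P 1 \<in> carrier M \<Longrightarrow> finsum M P {..<2::nat} = P 0 \<oplus>\<^bsub>M\<^esub> P 1"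
  by (simp add: numeral_2_eq_2 lessThan_Suc M.a_comm)

text \<open>\<open>\<lambda>_. undefined\<close> is the only 0-tuple, so a 0-cochain is its value
  there.\<close>

lemma coboundary_0_tup1:
  assumes "f \<in> mvals 0" "g \<in> carrier G"
  shows "cob 0 f (tup1 g) = act g (f (\<lambda>_. undefined)) \<ominus>\<^bsub>M\<^esub> f (\<lambda>_. undefined)"
proof -
  have x: "tup1 g \<in> tuples G (Suc 0)" using tuples_I(1)[OF assms(2)] by simp
  have "f (\<lambda>_. undefined) \<in> carrier M" using assms(1) by auto
  then show ?thesis
    unfolding coboundary_apply[OF assms(1) x] using assms(2) by (simp add: M.minus_eq restrict_def)
qed

lemma coboundary_1_tup2:
  assumes f: "f \<in> mvals 1" and g: "g \<in> carrier G" and h: "h \<in> carrier G"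
  shows "cob 1 f (tup2 g h) = act g (f (tup1 h)) \<ominus>\<^bsub>M\<^esub> f (tup1 (g \<otimes>\<^bsub>G\<^esub> h)) \<oplus>\<^bsub>M\<^esub> f (tup1 g)"
proof -
  have x: "tup2 g h \<in> tuples G (Suc 1)" using tuples_I(2)[OF g h] by (simp add: numeral_2_eq_2)
  have 1: "(\<lambda>j\<in>{..<1}. tup2 g h (Suc j)) = tup1 h" "(\<lambda>j\<in>{..<1}. tup2 g h j) = tup1 g"
    "merge 1 0 (tup2 g h) = tup1 (g \<otimes>\<^bsub>G\<^esub> h)"
    by (auto intro!: restrict_ext)
  have c: "f (tup1 (g \<otimes>\<^bsub>G\<^esub> h)) \<in> carrier M"
    using f tuples_I(1)[OF G.m_closed[OF g h]] by (rule funcset_mem)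
  have 2: "(\<Oplus>\<^bsub>M\<^esub>i\<in>{..<1::nat}. if odd i then f (merge 1 i (tup2 g h)) else \<ominus>\<^bsub>M\<^esub> f (merge 1 i (tup2 g h)))
      = \<ominus>\<^bsub>M\<^esub> f (tup1 (g \<otimes>\<^bsub>G\<^esub> h))"
    by (subst finsum_lessThan_1) (simp_all only: 1 even_zero not_True_eq_False if_False c M.a_inv_closed)
  show ?thesis
    unfolding coboundary_apply[OF f x] 1 2 by (simp add: M.minus_eq)
qed

lemma coboundary_2_tup3:
  assumes f: "f \<in> mvals 2" and g: "g \<in> carrier G" and h: "h \<in> carrier G" and k: "k \<in> carrier G"
  shows "cob 2 f (tup3 g h k) = act g (f (tup2 h k)) \<ominus>\<^bsub>M\<^esub> f (tup2 (g \<otimes>\<^bsub>G\<^esub> h) k)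
    \<oplus>\<^bsub>M\<^esub> f (tup2 g (h \<otimes>\<^bsub>G\<^esub> k)) \<ominus>\<^bsub>M\<^esub> f (tup2 g h)"
proof -
  have x: "tup3 g h k \<in> tuples G (Suc 2)" using tuples_I(3)[OF g h k] by (simp add: eval_nat_numeral)
  have 1: "(\<lambda>j\<in>{..<2}. tup3 g h k (Suc j)) = tup2 h k" "(\<lambda>j\<in>{..<2}. tup3 g h k j) = tup2 g h"
    "merge 2 0 (tup3 g h k) = tup2 (g \<otimes>\<^bsub>G\<^esub> h) k" "merge 2 1 (tup3 g h k) = tup2 g (h \<otimes>\<^bsub>G\<^esub> k)"
    by (auto intro!: restrict_ext simp: less_2_cases_iff)
  have c: "f (tup2 (g \<otimes>\<^bsub>G\<^esub> h) k) \<in> carrier M" "f (tup2 g (h \<otimes>\<^bsub>G\<^esub> k)) \<in> carrier M"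
    "f (tup2 h k) \<in> carrier M" "f (tup2 g h) \<in> carrier M"
    by (intro funcset_mem[OF f] tuples_I(2) G.m_closed g h k)+
  have 2: "(\<Oplus>\<^bsub>M\<^esub>i\<in>{..<2::nat}. if odd i then f (merge 2 i (tup3 g h k)) else \<ominus>\<^bsub>M\<^esub> f (merge 2 i (tup3 g h k)))
      = \<ominus>\<^bsub>M\<^esub> f (tup2 (g \<otimes>\<^bsub>G\<^esub> h) k) \<oplus>\<^bsub>M\<^esub> f (tup2 g (h \<otimes>\<^bsub>G\<^esub> k))"
    by (subst finsum_lessThan_2)
      (simp_all only: 1 even_zero odd_one not_True_eq_False not_False_eq_True if_False if_True c M.a_inv_closed)
  have "tup3 g h k 0 = g" by simp
  then show ?thesis
    unfolding coboundary_apply[OF f x] 1 2 using c act_closed[OF g c(3)]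
    by (simp add: M.minus_eq M.a_assoc)
qed

text \<open>Used to see that an exact summand in a representative of E_2^{0,1} does not change its
  coboundary.\<close>

lemma coboundary_coboundary_0:
  assumes f: "f \<in> mvals 0" shows "cob 1 (cob 0 f) = zero_cochain G M 2"
proof (rule extensionalityI[of _ "tuples G 2"])
  show "cob 1 (cob 0 f) \<in> extensional (tuples G 2)"
    using coboundary_extensional[of G M act 1] by (simp add: numeral_2_eq_2)
  fix x assume "x \<in> tuples G 2"
  then obtain g h where x: "g \<in> carrier G" "h \<in> carrier G" "x = tup2 g h" by (rule tuples_2E)
  have df: "cob 0 f \<in> mvals 1" using coboundary_values[OF f] by simp
  let ?m = "f (\<lambda>_. undefined)"
  have m: "?m \<in> carrier M" using f by auto
  note c = m act_closed[OF x(1) m] act_closed[OF x(2) m] act_closed[OF x(1) act_closed[OF x(2) m]]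
  \<comment> \<open>The cancellation is stated for variables, so that \<open>algebra\<close> meets
    atoms instead of cochain values.\<close>
  have cancel: "(a \<oplus>\<^bsub>M\<^esub> \<ominus>\<^bsub>M\<^esub> b) \<oplus>\<^bsub>M\<^esub> \<ominus>\<^bsub>M\<^esub> (a \<oplus>\<^bsub>M\<^esub> \<ominus>\<^bsub>M\<^esub> c) \<oplus>\<^bsub>M\<^esub> (b \<oplus>\<^bsub>M\<^esub> \<ominus>\<^bsub>M\<^esub> c) = \<zero>\<^bsub>M\<^esub>"
    if "a \<in> carrier M" "b \<in> carrier M" "c \<in> carrier M" for a b c
    using that by algebra
  have "cob 1 (cob 0 f) (tup2 g h) = \<zero>\<^bsub>M\<^esub>"
    unfolding coboundary_1_tup2[OF df x(1,2)] coboundary_0_tup1[OF f x(1)]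
      coboundary_0_tup1[OF f x(2)] coboundary_0_tup1[OF f G.m_closed[OF x(1,2)]]
      M.minus_eq act_mult[OF x(1,2) m] act_add[OF x(1) c(3) M.a_inv_closed[OF m]] act_minus[OF x(1) m]
    using c by (intro cancel)
  then show "cob 1 (cob 0 f) x = zero_cochain G M 2 x"
    using x by (simp add: zero_cochain_def)
qed (rule zero_cochain_extensional)

text \<open>Used to see that the 2-cochain on \<open>Q\<close> representing the transgression is a
  cocycle.\<close>

lemma coboundary_coboundary_1:
  assumes f: "f \<in> mvals 1" shows "cob 2 (cob 1 f) = zero_cochain G M 3"
proof (rule extensionalityI[of _ "tuples G 3"])
  show "cob 2 (cob 1 f) \<in> extensional (tuples G 3)"
    using coboundary_extensional[of G M act 2] by (simp add: eval_nat_numeral)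
  fix x assume "x \<in> tuples G 3"
  then obtain g h k where x: "g \<in> carrier G" "h \<in> carrier G" "k \<in> carrier G" "x = tup3 g h k"
    by (rule tuples_3E)
  have df: "cob 1 f \<in> mvals 2" using coboundary_values[OF f] by (simp add: numeral_2_eq_2)
  let ?f = "\<lambda>g. f (tup1 g)"
  have c: "?f u \<in> carrier M" if "u \<in> carrier G" for u using f tuples_I(1)[OF that] by (rule funcset_mem)
  note gh = G.m_closed[OF x(1,2)] and hk = G.m_closed[OF x(2,3)]
  note ghk = G.m_closed[OF x(1) hk]
  note ak = act_closed[OF x(2) c[OF x(3)]]
  note cs = c[OF x(1)] c[OF x(2)] c[OF x(3)] c[OF gh] c[OF hk] c[OF ghk] ak
    act_closed[OF x(1) ak] act_closed[OF x(1) c[OF hk]] act_closed[OF x(1) c[OF x(2)]]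
  have *: "act g (cob 1 f (tup2 h k)) = act g (act h (?f k)) \<ominus>\<^bsub>M\<^esub> act g (?f (h \<otimes>\<^bsub>G\<^esub> k)) \<oplus>\<^bsub>M\<^esub> act g (?f h)"
    unfolding coboundary_1_tup2[OF f x(2,3)] M.minus_eq using x cs
    by (simp only: act_add act_minus M.a_closed M.a_inv_closed)
  have cancel: "(a \<ominus>\<^bsub>M\<^esub> b \<oplus>\<^bsub>M\<^esub> c) \<ominus>\<^bsub>M\<^esub> (a \<ominus>\<^bsub>M\<^esub> d \<oplus>\<^bsub>M\<^esub> e) \<oplus>\<^bsub>M\<^esub> (b \<ominus>\<^bsub>M\<^esub> d \<oplus>\<^bsub>M\<^esub> u) \<ominus>\<^bsub>M\<^esub> (c \<ominus>\<^bsub>M\<^esub> e \<oplus>\<^bsub>M\<^esub> u) = \<zero>\<^bsub>M\<^esub>"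
    if "a \<in> carrier M" "b \<in> carrier M" "c \<in> carrier M" "d \<in> carrier M" "e \<in> carrier M" "u \<in> carrier M"
    for a b c d e u
    using that by algebra
  have "cob 2 (cob 1 f) (tup3 g h k) = \<zero>\<^bsub>M\<^esub>"
    unfolding coboundary_2_tup3[OF df x(1-3)] *
    unfolding coboundary_1_tup2[OF f x(1,2)] coboundary_1_tup2[OF f gh x(3)] coboundary_1_tup2[OF f x(1) hk]
      G.m_assoc[OF x(1-3)] act_mult[OF x(1,2) c[OF x(3)]]
    using cs by (intro cancel)
  then show "cob 2 (cob 1 f) x = zero_cochain G M 3 x"
    using x by (simp add: zero_cochain_def)
qed (rule zero_cochain_extensional)

text \<open>If one argument is the identity, two of the three terms cancel and the third is the
  value at the identity, up to the action.\<close>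

lemma coboundary_1_normalized:
  assumes f: "f \<in> mvals 1" and f0: "f (tup1 \<one>\<^bsub>G\<^esub>) = \<zero>\<^bsub>M\<^esub>"
    and x: "x \<in> tuples G 2" "i < 2" "x i = \<one>\<^bsub>G\<^esub>"
  shows "cob 1 f x = \<zero>\<^bsub>M\<^esub>"
proof -
  obtain g h where gh: "g \<in> carrier G" "h \<in> carrier G" "x = tup2 g h" using x(1) by (rule tuples_2E)
  have c: "f (tup1 u) \<in> carrier M" if "u \<in> carrier G" for u using f tuples_I(1)[OF that] by (rule funcset_mem)
  have "g = \<one>\<^bsub>G\<^esub> \<or> h = \<one>\<^bsub>G\<^esub>" using x gh by (auto simp: less_2_cases_iff)
  then show ?thesis
    unfolding gh(3) coboundary_1_tup2[OF f gh(1,2)]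
    using gh c[OF gh(1)] c[OF gh(2)] f0 by (auto simp: M.minus_eq M.r_neg M.l_neg minus_zero)
qed

end

section \<open>Cochain groups of a discrete group\<close>

context gmodule
begin

lemma cochains_values: "f \<in> cochains G T M n \<Longrightarrow> topspace T = carrier G \<Longrightarrow> f \<in> mvals n"
  unfolding cochains_def continuous_map_def by auto

text \<open>On a discrete product, continuity says only that the values lie in
  \<open>M\<close>.\<close>

lemma cochains_discrete:
  assumes "product_topology (\<lambda>_. T) {..<n} = discrete_topology (tuples G n)"
  shows "cochains G T M n = {f \<in> extensional (tuples G n) \<inter> mvals n.
    \<forall>x\<in>tuples G n. (\<exists>i<n. x i = \<one>\<^bsub>G\<^esub>) \<longrightarrow> f x = \<zero>\<^bsub>M\<^esub>}"
  unfolding cochains_def assms by auto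

text \<open>Stated for the discrete case, to be applied to \<open>Q\<close>: there pointwise sums
  and negatives raise no question of continuity.\<close>

lemma comm_group_cochains:
  assumes T: "product_topology (\<lambda>_. T) {..<n} = discrete_topology (tuples G n)"
  shows "comm_group (cochain_group G T M n)"
proof (rule comm_groupI)
  note [simp] = cochain_group_def cochains_discrete[OF T] zero_cochain_def
  let ?C = "cochain_group G T M n"
  show "\<one>\<^bsub>?C\<^esub> \<in> carrier ?C" by auto
  fix f assume f: "f \<in> carrier ?C"
  have vf: "f x \<in> carrier M" if "x \<in> tuples G n" for x using f that by auto
  show "\<one>\<^bsub>?C\<^esub> \<otimes>\<^bsub>?C\<^esub> f = f"
  proof (rule extensionalityI[of _ "tuples G n"])
    fix x assume "x \<in> tuples G n"
    then show "(\<one>\<^bsub>?C\<^esub> \<otimes>\<^bsub>?C\<^esub> f) x = f x" using vf[of x] by simp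
  qed (use f in auto)
  show "\<exists>h\<in>carrier ?C. h \<otimes>\<^bsub>?C\<^esub> f = \<one>\<^bsub>?C\<^esub>"
  proof (intro bexI[of _ "\<lambda>x\<in>tuples G n. \<ominus>\<^bsub>M\<^esub> f x"])
    show "(\<lambda>x\<in>tuples G n. \<ominus>\<^bsub>M\<^esub> f x) \<otimes>\<^bsub>?C\<^esub> f = \<one>\<^bsub>?C\<^esub>"
      using vf by (auto simp: M.l_neg intro!: restrict_ext)
    show "(\<lambda>x\<in>tuples G n. \<ominus>\<^bsub>M\<^esub> f x) \<in> carrier ?C"
      using f by (auto simp: minus_zero)
  qed
  fix f' assume f': "f' \<in> carrier ?C"
  have vf': "f' x \<in> carrier M" if "x \<in> tuples G n" for x using f' that by auto
  show "f \<otimes>\<^bsub>?C\<^esub> f' \<in> carrier ?C"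
    using f f' by auto
  show "f \<otimes>\<^bsub>?C\<^esub> f' = f' \<otimes>\<^bsub>?C\<^esub> f"
    using vf vf' by (auto simp: M.a_comm intro!: restrict_ext)
  fix f'' assume f'': "f'' \<in> carrier ?C"
  have vf'': "f'' x \<in> carrier M" if "x \<in> tuples G n" for x using f'' that by auto
  show "f \<otimes>\<^bsub>?C\<^esub> f' \<otimes>\<^bsub>?C\<^esub> f'' = f \<otimes>\<^bsub>?C\<^esub> (f' \<otimes>\<^bsub>?C\<^esub> f'')"
    using vf vf' vf'' by (auto simp: M.a_assoc intro!: restrict_ext)
qed

lemma coboundary_1_cochain:
  assumes T: "\<And>n. product_topology (\<lambda>_. T) {..<n} = discrete_topology (tuples G n)"
    and f: "f \<in> cochains G T M 1"
  shows "cob 1 f \<in> cochains G T M 2"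
proof -
  have v: "f \<in> mvals 1" and f1: "f (tup1 \<one>\<^bsub>G\<^esub>) = \<zero>\<^bsub>M\<^esub>"
    using f tuples_I(1)[OF G.one_closed] by (auto simp: cochains_discrete[OF T])
  then show ?thesis
    using coboundary_values[OF v] coboundary_extensional[of G M act 1] coboundary_1_normalized[OF v f1]
    by (auto simp: cochains_discrete[OF T] numeral_2_eq_2)
qed

lemma coboundary_1_subgroup:
  assumes T: "\<And>n. product_topology (\<lambda>_. T) {..<n} = discrete_topology (tuples G n)"
  shows "subgroup (cob 1 ` cochains G T M 1) (cochain_group G T M 2)"
proof -
  interpret C1: comm_group "cochain_group G T M 1" by (rule comm_group_cochains[OF T])
  interpret C2: comm_group "cochain_group G T M 2" by (rule comm_group_cochains[OF T])
  interpret d: group_hom "cochain_group G T M 1" "cochain_group G T M 2" "cob 1"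
  proof unfold_locales
    show "cob 1 \<in> hom (cochain_group G T M 1) (cochain_group G T M 2)"
    proof (rule homI)
      show "cob 1 f \<in> carrier (cochain_group G T M 2)" if "f \<in> carrier (cochain_group G T M 1)" for f
        using coboundary_1_cochain[OF T] that by (simp add: cochain_group_def)
    next
      fix f f' assume "f \<in> carrier (cochain_group G T M 1)" "f' \<in> carrier (cochain_group G T M 1)"
      then have "f \<in> mvals 1" "f' \<in> mvals 1"
        by (auto simp: cochain_group_def cochains_discrete[OF T])
      from coboundary_add[OF this]
      show "cob 1 (f \<otimes>\<^bsub>cochain_group G T M 1\<^esub> f') = cob 1 f \<otimes>\<^bsub>cochain_group G T M 2\<^esub> cob 1 f'"
        by (simp add: cochain_group_def numeral_2_eq_2)
    qed
  qed
  show ?thesis using d.img_is_subgroup by (simp add: cochain_group_def)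
qed

end


section \<open>Inflation\<close>

context module_extension
begin

interpretation Q: gmodule Q M qact by (rule gmodule_Q)

text \<open>The cochain map inside \<open>edge_inflation\<close>, in every degree: degrees 1, 2 and
  3 all occur.\<close>

definition infl :: "nat \<Rightarrow> ((nat \<Rightarrow> 'q) \<Rightarrow> 'm) \<Rightarrow> (nat \<Rightarrow> 'g) \<Rightarrow> 'm" where
  "infl n f = (\<lambda>x\<in>tuples G n. f (\<lambda>i\<in>{..<n}. \<pi> (x i)))"

lemma infl_extensional: "infl n f \<in> extensional (tuples G n)"
  unfolding infl_def by (rule restrict_extensional)

lemma proj_tuples: "x \<in> tuples G n \<Longrightarrow> (\<lambda>i\<in>{..<n}. \<pi> (x i)) \<in> tuples Q n"
  by (auto simp: PiE_iff)

text \<open>The identity lifts to the identity so that composition with \<open>lift\<close> preserves normalization.\<close>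

definition lift :: "nat \<Rightarrow> (nat \<Rightarrow> 'q) \<Rightarrow> nat \<Rightarrow> 'g" where
  "lift n y = (\<lambda>i\<in>{..<n}. if y i = \<one>\<^bsub>Q\<^esub> then \<one>\<^bsub>G\<^esub> else inv_into (carrier G) \<pi> (y i))"

lemma lift_tuples:
  assumes "y \<in> tuples Q n"
  shows "lift n y \<in> tuples G n" "i < n \<Longrightarrow> \<pi> (lift n y i) = y i"
    "(\<lambda>i\<in>{..<n}. \<pi> (lift n y i)) = y"
proof -
  have "y i \<in> \<pi> ` carrier G" if "i < n" for i using assms that surj by auto
  then have *: "inv_into (carrier G) \<pi> (y i) \<in> carrier G" "\<pi> (inv_into (carrier G) \<pi> (y i)) = y i"
    if "i < n" for i using that by (auto intro: inv_into_into f_inv_into_f)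
  then show "lift n y \<in> tuples G n" by (auto simp: lift_def)
  show pi: "\<pi> (lift n y i) = y i" if "i < n" for i using * that by (auto simp: lift_def)
  show "(\<lambda>i\<in>{..<n}. \<pi> (lift n y i)) = y"
    using assms pi by (intro ext) (auto simp: PiE_iff extensional_def)
qed

text \<open>Every tuple of \<open>Q\<close> is the projection of a tuple of \<open>G\<close>, where
  the two inflations agree.\<close>

lemma infl_inj:
  assumes "f \<in> extensional (tuples Q n)" "f' \<in> extensional (tuples Q n)" "infl n f = infl n f'"
  shows "f = f'"
proof (rule extensionalityI[OF assms(1,2)])
  fix y assume y: "y \<in> tuples Q n"
  show "f y = f' y"
    using fun_cong[OF assms(3), of "lift n y"] lift_tuples[OF y] by (simp add: infl_def)
qed

lemma infl_zero: "infl n (zero_cochain Q M n) = zero_cochain G M n"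
  using proj_tuples by (auto simp: infl_def zero_cochain_def intro!: restrict_ext)

lemma infl_add:
  "infl n (\<lambda>y\<in>tuples Q n. f y \<oplus>\<^bsub>M\<^esub> f' y) = (\<lambda>x\<in>tuples G n. infl n f x \<oplus>\<^bsub>M\<^esub> infl n f' x)"
proof (rule extensionalityI[OF infl_extensional restrict_extensional])
  fix x assume x: "x \<in> tuples G n"
  then show "infl n (\<lambda>y\<in>tuples Q n. f y \<oplus>\<^bsub>M\<^esub> f' y) x = (\<lambda>x\<in>tuples G n. infl n f x \<oplus>\<^bsub>M\<^esub> infl n f' x) x"
    using proj_tuples[OF x] by (simp add: infl_def)
qed

lemma infl_values: "f \<in> Q.mvals n \<Longrightarrow> infl n f \<in> mvals n"
  unfolding infl_def using proj_tuples by (intro funcsetI) (simp add: Pi_def)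

text \<open>All faces commute with \<open>\<pi>\<close>, the inner ones because \<open>\<pi>\<close>
  is a homomorphism; the outer action agrees by \<open>qact_eq\<close>.\<close>

lemma infl_coboundary:
  assumes f: "f \<in> Q.mvals n"
  shows "cob n (infl n f) = infl (Suc n) (coboundary Q M qact n f)"
proof (rule extensionalityI[OF coboundary_extensional infl_extensional])
  fix x assume x: "x \<in> tuples G (Suc n)"
  define y where "y = (\<lambda>i\<in>{..<Suc n}. \<pi> (x i))"
  have y: "y \<in> tuples Q (Suc n)" unfolding y_def using x by (rule proj_tuples)
  have xc: "x i \<in> carrier G" if "i \<le> n" for i
    using PiE_mem[OF x, of i] that by simp
  have infl: "infl n f z = f w" if "z \<in> tuples G n" "(\<lambda>i\<in>{..<n}. \<pi> (z i)) = w" for z w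
    using that by (simp add: infl_def)
  have 1: "infl n f (\<lambda>j\<in>{..<n}. x (Suc j)) = f (\<lambda>j\<in>{..<n}. y (Suc j))"
    using face_tuples(1)[OF x] by (rule infl) (auto simp: y_def intro!: restrict_ext)
  have 2: "infl n f (\<lambda>j\<in>{..<n}. x j) = f (\<lambda>j\<in>{..<n}. y j)"
    using face_tuples(2)[OF x] by (rule infl) (auto simp: y_def intro!: restrict_ext)
  have 3: "infl n f (merge n i x) = f (Q.merge n i y)" if "i < n" for i
    using face_tuples(3)[OF x that] by (rule infl) (use xc that in \<open>auto simp: y_def intro!: restrict_ext\<close>)
  have vals: "f z \<in> carrier M" if "z \<in> tuples Q n" for z using f that by (rule funcset_mem)
  have sum: "(\<Oplus>\<^bsub>M\<^esub>i\<in>{..<n}. if odd i then infl n f (merge n i x) else \<ominus>\<^bsub>M\<^esub> infl n f (merge n i x))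
      = (\<Oplus>\<^bsub>M\<^esub>i\<in>{..<n}. if odd i then f (Q.merge n i y) else \<ominus>\<^bsub>M\<^esub> f (Q.merge n i y))"
    using vals[OF Q.face_tuples(3)[OF y]] by (intro M.finsum_cong') (auto simp only: 3 lessThan_iff M.a_inv_closed split: if_splits intro!: funcsetI)
  have "act (x 0) (f (\<lambda>j\<in>{..<n}. y (Suc j))) = qact (y 0) (f (\<lambda>j\<in>{..<n}. y (Suc j)))"
    using xc[of 0] vals[OF Q.face_tuples(1)[OF y]] by (simp add: y_def)
  then have "cob n (infl n f) x = coboundary Q M qact n f y"
    unfolding coboundary_apply[OF infl_values[OF f] x] Q.coboundary_apply[OF f y] sum 1 2 by simp
  then show "cob n (infl n f) x = infl (Suc n) (coboundary Q M qact n f) x"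
    using x by (simp add: infl_def y_def)
qed

end

section \<open>Continuity and the Hochschild-Serre filtration\<close>

locale topological_extension = module_extension G M act Q \<pi>
  for G :: "('g, 'a) monoid_scheme" and M :: "('m, 'b) ring_scheme"
    and act :: "'g \<Rightarrow> 'm \<Rightarrow> 'm" and Q :: "('q, 'c) monoid_scheme" and \<pi> :: "'g \<Rightarrow> 'q" +
  fixes TG :: "'g topology" and TQ :: "'q topology"
  assumes topspace_TG: "topspace TG = carrier G"
    and finite_Q: "finite (carrier Q)"
    and TQ: "TQ = discrete_topology (carrier Q)"
    and pi_continuous: "continuous_map TG TQ \<pi>"
    and right_mult_continuous: "g \<in> carrier G \<Longrightarrow> continuous_map TG TG (\<lambda>x. x \<otimes>\<^bsub>G\<^esub> g)"
begin

sublocale Q: gmodule Q M qact by (rule gmodule_Q)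

lemma product_TQ: "product_topology (\<lambda>_. TQ) {..<n} = discrete_topology (tuples Q n)"
  by (rule finite_topspace_imp_discrete_topology)
    (simp_all add: TQ finite_Q finite_PiE Hausdorff_space_product_topology)

lemma infl_cochain:
  assumes "f \<in> cochains Q TQ M n" shows "infl n f \<in> cochains G TG M n"
proof -
  let ?p = "\<lambda>x. \<lambda>i\<in>{..<n}. \<pi> (x i)"
  have f: "f \<in> Q.mvals n" "\<And>y. y \<in> tuples Q n \<Longrightarrow> (\<exists>i<n. y i = \<one>\<^bsub>Q\<^esub>) \<Longrightarrow> f y = \<zero>\<^bsub>M\<^esub>"
    using assms by (auto simp: Q.cochains_discrete[OF product_TQ])
  have "continuous_map (product_topology (\<lambda>_. TG) {..<n}) (product_topology (\<lambda>_. TQ) {..<n}) ?p"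
    unfolding continuous_map_componentwise
  proof (intro conjI ballI)
    fix k assume k: "k \<in> {..<n}"
    have "continuous_map (product_topology (\<lambda>_. TG) {..<n}) TQ (\<pi> \<circ> (\<lambda>x. x k))"
      by (rule continuous_map_compose[OF continuous_map_product_projection[OF k] pi_continuous])
    then show "continuous_map (product_topology (\<lambda>_. TG) {..<n}) TQ (\<lambda>x. ?p x k)"
      using k by (simp add: comp_def)
  qed auto
  moreover have "continuous_map (product_topology (\<lambda>_. TQ) {..<n}) (discrete_topology (carrier M)) f"
    unfolding product_TQ using f(1) by simp
  ultimately have "continuous_map (product_topology (\<lambda>_. TG) {..<n}) (discrete_topology (carrier M)) (f \<circ> ?p)"
    by (rule continuous_map_compose)
  then have "continuous_map (product_topology (\<lambda>_. TG) {..<n}) (discrete_topology (carrier M)) (infl n f)"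
    by (rule continuous_map_eq) (simp add: topspace_TG infl_def)
  moreover have "infl n f x = \<zero>\<^bsub>M\<^esub>" if x: "x \<in> tuples G n" "i < n" "x i = \<one>\<^bsub>G\<^esub>" for x i
  proof -
    have "?p x i = \<one>\<^bsub>Q\<^esub>" using x by simp
    then have "f (?p x) = \<zero>\<^bsub>M\<^esub>" using x(2) by (intro f(2)[OF proj_tuples[OF x(1)]]) blast
    then show ?thesis using x(1) by (simp add: infl_def)
  qed
  ultimately show ?thesis
    unfolding cochains_def using infl_extensional by blast
qed

text \<open>At \<open>p = n\<close> every argument counts only through its coset, so the cochain
  factors through \<open>\<pi>\<close>. The factor is its composite with \<open>lift\<close>, and it
  is normalized because \<open>lift\<close> preserves the identity.\<close>

lemma hs_filtration_full: "hs_filtration G TG M \<pi> (int n) n = infl n ` cochains Q TQ M n"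
proof -
  have eq: "hs_filtration G TG M \<pi> (int n) n = {f \<in> cochains G TG M n.
    \<forall>x\<in>tuples G n. \<forall>y\<in>tuples G n. (\<forall>i<n. \<pi> (x i) = \<pi> (y i)) \<longrightarrow> f x = f y}"
    by (simp add: hs_filtration_def)
  show ?thesis unfolding eq
  proof (intro equalityI subsetI)
    fix f assume "f \<in> {f \<in> cochains G TG M n.
      \<forall>x\<in>tuples G n. \<forall>y\<in>tuples G n. (\<forall>i<n. \<pi> (x i) = \<pi> (y i)) \<longrightarrow> f x = f y}"
    then have f: "f \<in> cochains G TG M n"
      and dep: "\<And>x y. x \<in> tuples G n \<Longrightarrow> y \<in> tuples G n \<Longrightarrow> (\<forall>i<n. \<pi> (x i) = \<pi> (y i)) \<Longrightarrow> f x = f y"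
      by blast+
    have v: "f \<in> mvals n" using f topspace_TG by (rule cochains_values)
    have norm: "\<And>x. x \<in> tuples G n \<Longrightarrow> (\<exists>i<n. x i = \<one>\<^bsub>G\<^esub>) \<Longrightarrow> f x = \<zero>\<^bsub>M\<^esub>"
      and ext: "f \<in> extensional (tuples G n)"
      using f unfolding cochains_def by blast+
    define f' where "f' = (\<lambda>y\<in>tuples Q n. f (lift n y))"
    have "f' \<in> cochains Q TQ M n"
      unfolding Q.cochains_discrete[OF product_TQ]
    proof (intro CollectI conjI IntI ballI impI)
      show "f' \<in> Q.mvals n"
        using funcset_mem[OF v lift_tuples(1)] by (simp add: f'_def)
      fix y assume y: "y \<in> tuples Q n" "\<exists>i<n. y i = \<one>\<^bsub>Q\<^esub>"
      then have "\<exists>i<n. lift n y i = \<one>\<^bsub>G\<^esub>" by (auto simp: lift_def)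
      from norm[OF lift_tuples(1)[OF y(1)] this]
      show "f' y = \<zero>\<^bsub>M\<^esub>" using y(1) by (simp add: f'_def)
    qed (simp add: f'_def)
    moreover have "f = infl n f'"
    proof (rule extensionalityI[OF ext infl_extensional])
      fix x assume x: "x \<in> tuples G n"
      note p = proj_tuples[OF x]
      have "f x = f (lift n (\<lambda>i\<in>{..<n}. \<pi> (x i)))"
        using lift_tuples[OF p] by (intro dep[OF x]) auto
      then show "f x = infl n f' x" using x p by (simp add: infl_def f'_def)
    qed
    ultimately show "f \<in> infl n ` cochains Q TQ M n" by blast
  next
    fix f assume "f \<in> infl n ` cochains Q TQ M n"
    then obtain f' where f': "f' \<in> cochains Q TQ M n" "f = infl n f'" by blast
    have "f x = f y" if "x \<in> tuples G n" "y \<in> tuples G n" "\<forall>i<n. \<pi> (x i) = \<pi> (y i)" for x y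
    proof -
      have "(\<lambda>i\<in>{..<n}. \<pi> (x i)) = (\<lambda>i\<in>{..<n}. \<pi> (y i))" using that by (auto intro!: restrict_ext)
      then show ?thesis using that by (simp add: f' infl_def)
    qed
    then show "f \<in> {f \<in> cochains G TG M n.
      \<forall>x\<in>tuples G n. \<forall>y\<in>tuples G n. (\<forall>i<n. \<pi> (x i) = \<pi> (y i)) \<longrightarrow> f x = f y}"
      using infl_cochain[OF f'(1)] f'(2) by blast
  qed
qed

text \<open>At \<open>p = 0\<close> the condition compares only equal tuples.\<close>

lemma hs_filtration_zero: "hs_filtration G TG M \<pi> 0 n = cochains G TG M n"
proof -
  let ?P = "\<lambda>f :: (nat \<Rightarrow> 'g) \<Rightarrow> 'm. \<forall>x\<in>tuples G n. \<forall>y\<in>tuples G n.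
    (\<forall>i<n. \<pi> (x i) = \<pi> (y i)) \<and> (\<forall>i<n. x i = y i) \<longrightarrow> f x = f y"
  have P: "?P f" for f
  proof (intro ballI impI)
    fix x y assume "x \<in> tuples G n" "y \<in> tuples G n"
      and "(\<forall>i<n. \<pi> (x i) = \<pi> (y i)) \<and> (\<forall>i<n. x i = y i)"
    then have "x = y" by (intro PiE_ext[of x "{..<n}" _ y]) simp_all
    then show "f x = f y" by simp
  qed
  have "hs_filtration G TG M \<pi> 0 n = {f \<in> cochains G TG M n. ?P f}"
    by (simp add: hs_filtration_def)
  also have "\<dots> = cochains G TG M n"
    by (intro subset_antisym Collect_restrict subsetI CollectI conjI P)
  finally show ?thesis .
qed

text \<open>On the coset over \<open>q\<close> the function is \<open>\<phi>\<close> after a right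
  translation, plus the constant \<open>e q\<close>. The cosets are open, as fibres of a continuous
  map to a discrete space, so continuity may be checked on each of them.\<close>

lemma continuous_by_cosets:
  assumes s: "\<And>q. q \<in> carrier Q \<Longrightarrow> s q \<in> carrier G \<and> \<pi> (s q) = q"
    and \<phi>: "continuous_map (subtopology TG N) (discrete_topology (carrier M)) \<phi>"
    and e: "\<And>q. q \<in> carrier Q \<Longrightarrow> e q \<in> carrier M"
    and f: "\<And>g. g \<in> carrier G \<Longrightarrow> f g = \<phi> (g \<otimes>\<^bsub>G\<^esub> inv\<^bsub>G\<^esub> s (\<pi> g)) \<oplus>\<^bsub>M\<^esub> e (\<pi> g)"
  shows "continuous_map TG (discrete_topology (carrier M)) f"
  unfolding continuous_map_def
proof (intro conjI allI impI)
  have \<phi>_closed: "\<phi> n \<in> carrier M" if "n \<in> N" for n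
    using \<phi> that N_carrier by (auto simp: continuous_map_def topspace_TG)
  have diff: "g \<otimes>\<^bsub>G\<^esub> inv\<^bsub>G\<^esub> s (\<pi> g) \<in> N" if "g \<in> carrier G" for g
    using s that by (intro N_quotient) auto
  show "f \<in> topspace TG \<rightarrow> topspace (discrete_topology (carrier M))"
    using f e \<phi>_closed diff by (auto simp: topspace_TG)
  fix V assume "openin (discrete_topology (carrier M)) V"
  let ?V = "\<lambda>q. {m \<in> carrier M. m \<oplus>\<^bsub>M\<^esub> e q \<in> V}"
  let ?U = "\<lambda>q. {g \<in> carrier G. \<pi> g = q}"
  have "\<exists>W. openin TG W \<and> {n \<in> N. \<phi> n \<in> ?V q} = W \<inter> N" for q
  proof -
    have "openin (subtopology TG N) {n \<in> topspace (subtopology TG N). \<phi> n \<in> ?V q}"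
      by (rule openin_continuous_map_preimage[OF \<phi>]) auto
    moreover have "topspace (subtopology TG N) = N"
      using N_carrier by (auto simp: topspace_TG)
    ultimately show ?thesis by (auto simp: openin_subtopology)
  qed
  \<comment> \<open>The set \<open>W q\<close> is open in \<open>G\<close> but agrees with the
    preimage only inside \<open>N\<close>. This suffices, because the translated element always lies
    in \<open>N\<close> by \<open>diff\<close>.\<close>
  then obtain W where W: "\<And>q. openin TG (W q)" "\<And>q. {n \<in> N. \<phi> n \<in> ?V q} = W q \<inter> N" by metis
  have "{g \<in> topspace TG. f g \<in> V}
      = (\<Union>q\<in>carrier Q. ?U q \<inter> {g \<in> topspace TG. g \<otimes>\<^bsub>G\<^esub> inv\<^bsub>G\<^esub> s q \<in> W q})"
  proof (intro equalityI subsetI)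
    fix g assume "g \<in> {g \<in> topspace TG. f g \<in> V}"
    then have g: "g \<in> carrier G" "f g \<in> V" by (auto simp: topspace_TG)
    have "g \<otimes>\<^bsub>G\<^esub> inv\<^bsub>G\<^esub> s (\<pi> g) \<in> {n \<in> N. \<phi> n \<in> ?V (\<pi> g)}"
      using g f diff \<phi>_closed by simp
    then show "g \<in> (\<Union>q\<in>carrier Q. ?U q \<inter> {g \<in> topspace TG. g \<otimes>\<^bsub>G\<^esub> inv\<^bsub>G\<^esub> s q \<in> W q})"
      unfolding W(2) using g by (auto simp: topspace_TG)
  next
    fix g assume "g \<in> (\<Union>q\<in>carrier Q. ?U q \<inter> {g \<in> topspace TG. g \<otimes>\<^bsub>G\<^esub> inv\<^bsub>G\<^esub> s q \<in> W q})"
    then have g: "g \<in> carrier G" "g \<otimes>\<^bsub>G\<^esub> inv\<^bsub>G\<^esub> s (\<pi> g) \<in> W (\<pi> g)" by auto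
    then have "g \<otimes>\<^bsub>G\<^esub> inv\<^bsub>G\<^esub> s (\<pi> g) \<in> {n \<in> N. \<phi> n \<in> ?V (\<pi> g)}"
      unfolding W(2) using diff by simp
    then show "g \<in> {g \<in> topspace TG. f g \<in> V}" using g f by (simp add: topspace_TG)
  qed
  moreover have "openin TG (?U q \<inter> {g \<in> topspace TG. g \<otimes>\<^bsub>G\<^esub> inv\<^bsub>G\<^esub> s q \<in> W q})"
    if q: "q \<in> carrier Q" for q
  proof (rule openin_Int)
    have "openin TG {g \<in> topspace TG. \<pi> g \<in> {q}}"
      by (rule openin_continuous_map_preimage[OF pi_continuous]) (use q in \<open>simp add: TQ\<close>)
    then show "openin TG (?U q)" by (simp add: topspace_TG)
    show "openin TG {g \<in> topspace TG. g \<otimes>\<^bsub>G\<^esub> inv\<^bsub>G\<^esub> s q \<in> W q}"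
      using s q by (intro openin_continuous_map_preimage[OF right_mult_continuous W(1)]) auto
  qed
  ultimately show "openin TG {g \<in> topspace TG. f g \<in> V}" by auto
qed

definition cochain1 :: "('g \<Rightarrow> 'm) \<Rightarrow> (nat \<Rightarrow> 'g) \<Rightarrow> 'm" where
  "cochain1 f = (\<lambda>x\<in>tuples G 1. f (x 0))"

lemma cochain1_tup1 [simp]: "g \<in> carrier G \<Longrightarrow> cochain1 f (tup1 g) = f g"
  using tuples_I(1) by (simp add: cochain1_def)

lemma cochain1_cochain:
  assumes "continuous_map TG (discrete_topology (carrier M)) f" "f \<one>\<^bsub>G\<^esub> = \<zero>\<^bsub>M\<^esub>"
  shows "cochain1 f \<in> cochains G TG M 1"
  unfolding cochains_def
proof (intro CollectI conjI ballI impI)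
  have proj: "continuous_map (product_topology (\<lambda>_. TG) {..<1::nat}) TG (\<lambda>x. x 0)"
    by (rule continuous_map_product_projection) simp
  have "continuous_map (product_topology (\<lambda>_. TG) {..<1::nat}) (discrete_topology (carrier M)) (f \<circ> (\<lambda>x. x 0))"
    by (rule continuous_map_compose[OF proj assms(1)])
  then show "continuous_map (product_topology (\<lambda>_. TG) {..<1}) (discrete_topology (carrier M)) (cochain1 f)"
    by (rule continuous_map_eq) (simp add: topspace_TG cochain1_def)
qed (use assms in \<open>auto simp: cochain1_def\<close>)

end

section \<open>The transgression of a homomorphism\<close>

lemma r_coset_cochains:
  "B #>\<^bsub>cochain_group G T M n\<^esub> f = (\<lambda>h. \<lambda>x\<in>tuples G n. h x \<oplus>\<^bsub>M\<^esub> f x) ` B"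
  by (auto simp: r_coset_def cochain_group_def)

text \<open>Restricting the carrier leaves the multiplication alone, so cosets may be formed in the
  full cochain group.\<close>

lemma carrier_cochains_Mod:
  "carrier ((cochain_group G T M n)\<lparr>carrier := Z\<rparr> Mod B)
    = (\<lambda>f. B #>\<^bsub>cochain_group G T M n\<^esub> f) ` Z"
  by (auto simp: FactGroup_def RCOSETS_def r_coset_def)

text \<open>The edge maps and \<open>lhs_d\<close> are all instances of \<open>map_class\<close>, so
  evaluating them amounts to constancy on a coset.\<close>

lemma map_class_const:
  assumes "Y \<noteq> {}" "\<And>y. y \<in> Y \<Longrightarrow> F y = c" shows "map_class F Y = c"
proof -
  have "F ` Y = {c}" using assms by auto
  then show ?thesis by (simp add: map_class_def)
qed

context topological_extension
begin

abbreviation GN :: "('g, 'a) monoid_scheme" where "GN \<equiv> subgroup_of G N"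

abbreviation TN :: "'g topology" where "TN \<equiv> subtopology TG N"

abbreviation CQ :: "nat \<Rightarrow> ((nat \<Rightarrow> 'q) \<Rightarrow> 'm) set" where "CQ \<equiv> cochains Q TQ M"

abbreviation BQ :: "((nat \<Rightarrow> 'q) \<Rightarrow> 'm) set" where "BQ \<equiv> Q.cob 1 ` CQ 1"

sublocale GN: gmodule GN M act
proof (intro gmodule.intro gmodule_axioms.intro)
  show "group GN" by (rule subgroup.subgroup_is_group[OF subgroup_kernel G.group_axioms])
  show "abelian_group M" by (rule M.abelian_group_axioms)
qed (use N_carrier in \<open>auto simp: act_add act_mult\<close>)

lemma GN_carrier: "carrier GN = N" by simp

lemma GN_tuples: "x \<in> tuples GN n \<Longrightarrow> x \<in> tuples G n"
  using N_carrier by (auto simp: PiE_iff)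

lemma zero_cochain_0: "zero_cochain G' M 0 \<in> cochains G' T M 0"
proof -
  have "continuous_map (product_topology (\<lambda>_. T) {..<0::nat}) (discrete_topology (carrier M)) (\<lambda>_. \<zero>\<^bsub>M\<^esub>)"
    by simp
  then have "continuous_map (product_topology (\<lambda>_. T) {..<0::nat}) (discrete_topology (carrier M)) (zero_cochain G' M 0)"
    by (rule continuous_map_eq) (simp add: zero_cochain_def)
  then show ?thesis
    unfolding cochains_def using zero_cochain_extensional[of G' M 0] by simp
qed

lemma coboundary_0_N:
  assumes f: "f \<in> mvals 0" and n: "n \<in> N"
  shows "cob 0 f (tup1 n) = \<zero>\<^bsub>M\<^esub>"
proof -
  have "f (\<lambda>_. undefined) \<in> carrier M" using f by auto
  then show ?thesis
    unfolding coboundary_0_tup1[OF f N_carrier[OF n]] by (simp add: kernel_acts[OF n] M.minus_eq M.r_neg)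
qed

text \<open>For a trivial action \<open>n m - m = 0\<close>. Hence classes in H^1(N, M) are
  singletons, which is the identification with Hom(N, M).\<close>

lemma coboundaries_N: "coboundaries GN TN M act 1 = {zero_cochain GN M 1}"
proof -
  have "GN.cob 0 f = zero_cochain GN M 1" if f: "f \<in> cochains GN TN M 0" for f
  proof (rule extensionalityI[of _ "tuples GN 1"])
    show "GN.cob 0 f \<in> extensional (tuples GN 1)"
      using coboundary_extensional[of GN M act 0] by simp
    fix x assume "x \<in> tuples GN 1"
    then obtain n where n: "n \<in> carrier GN" "x = tup1 n" by (rule tuples_1E)
    have "topspace TN = carrier GN" using N_carrier by (auto simp: topspace_TG)
    then have v: "f \<in> GN.mvals 0" by (rule GN.cochains_values[OF f])
    then have "f (\<lambda>_. undefined) \<in> carrier M" by auto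
    then have "GN.cob 0 f (tup1 n) = \<zero>\<^bsub>M\<^esub>"
      unfolding GN.coboundary_0_tup1[OF v n(1)] using n by (simp add: kernel_acts M.minus_eq M.r_neg)
    then show "GN.cob 0 f x = zero_cochain GN M 1 x"
      using n tuples_I(1)[OF n(1)] by (simp add: zero_cochain_def)
  qed (rule zero_cochain_extensional)
  then show ?thesis
    using zero_cochain_0[of GN TN] by (auto simp: coboundaries_def)
qed

lemma zero_r_coset:
  assumes "f \<in> extensional (tuples G' n)" "f \<in> tuples G' n \<rightarrow> carrier M"
  shows "{zero_cochain G' M n} #>\<^bsub>cochain_group G' T M n\<^esub> f = {f}"
proof -
  have "(\<lambda>x\<in>tuples G' n. zero_cochain G' M n x \<oplus>\<^bsub>M\<^esub> f x) = f"
  proof (rule extensionalityI[OF restrict_extensional assms(1)])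
    fix x assume "x \<in> tuples G' n"
    then show "(\<lambda>x\<in>tuples G' n. zero_cochain G' M n x \<oplus>\<^bsub>M\<^esub> f x) x = f x"
      using funcset_mem[OF assms(2)] by (simp add: zero_cochain_def)
  qed
  then show ?thesis by (simp add: r_coset_cochains)
qed

lemma hom_class_eq:
  assumes "\<And>n. n \<in> N \<Longrightarrow> \<phi> n \<in> carrier M"
  shows "hom_class G TG M act N \<phi> = {\<lambda>x\<in>tuples GN 1. \<phi> (x 0)}"
  unfolding hom_class_def coboundaries_N
  using assms by (intro zero_r_coset) auto

text \<open>The class is a singleton, so its invariance is invariance of the cochain itself,
  evaluated here at \<open>g n g^-1\<close>.\<close>

lemma invariant_imp_equivariant:
  assumes \<phi>: "\<And>n. n \<in> N \<Longrightarrow> \<phi> n \<in> carrier M"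
    and inv: "hom_class G TG M act N \<phi> \<in> carrier (invariant_cohomology G TG M act N 1)"
    and g: "g \<in> carrier G" and n: "n \<in> N"
  shows "\<phi> (g \<otimes>\<^bsub>G\<^esub> n \<otimes>\<^bsub>G\<^esub> inv\<^bsub>G\<^esub> g) = act g (\<phi> n)"
proof -
  let ?f = "\<lambda>x\<in>tuples GN 1. \<phi> (x 0)" and ?n = "g \<otimes>\<^bsub>G\<^esub> n \<otimes>\<^bsub>G\<^esub> inv\<^bsub>G\<^esub> g"
  have n': "?n \<in> carrier GN" using N_conj[OF n g] by simp
  have "conj_cochain G act N 1 g ` {?f} = {?f}"
  proof -
    have "\<forall>g\<in>carrier G. conj_cochain G act N 1 g ` hom_class G TG M act N \<phi> = hom_class G TG M act N \<phi>"
      using inv by (simp add: invariant_cohomology_def Let_def)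
    moreover have "hom_class G TG M act N \<phi> = {?f}" using \<phi> by (rule hom_class_eq)
    ultimately show ?thesis using g by metis
  qed
  then have "conj_cochain G act N 1 g ?f (tup1 ?n) = ?f (tup1 ?n)" by simp
  moreover have conj: "inv\<^bsub>G\<^esub> g \<otimes>\<^bsub>G\<^esub> ?n \<otimes>\<^bsub>G\<^esub> g = n"
    using g N_carrier[OF n] by (simp add: G.m_assoc) (simp flip: G.m_assoc)
  then have "(\<lambda>i\<in>{..<1}. inv\<^bsub>G\<^esub> g \<otimes>\<^bsub>G\<^esub> tup1 ?n i \<otimes>\<^bsub>G\<^esub> g) = tup1 n"
    by (intro restrict_ext) simp
  ultimately show ?thesis
    using tuples_I(1)[OF n'] tuples_I(1)[of n GN] n unfolding conj_cochain_def
    by (simp only: restrict_apply if_True GN_carrier lessThan_iff zero_less_one conj)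
qed

section \<open>The terms entering d_2 from E_2^{0,1} to E_2^{2,0}\<close>

text \<open>The digits in this and the next names are page, filtration degree and total degree, with
  \<open>m\<close> for a minus sign. Here the cochain is unrestricted and its coboundary must be
  inflated.\<close>

lemma lhs_Z_201: "lhs_Z G TG M act \<pi> 2 0 1 = {f \<in> cochains G TG M 1. cob 1 f \<in> infl 2 ` CQ 2}"
  using hs_filtration_full[of 2] by (simp add: lhs_Z_def hs_filtration_zero numeral_2_eq_2)

text \<open>Inflation commutes with the coboundary, so inflated 1-cochains meet the condition on the
  coboundary automatically.\<close>

lemma lhs_Z_111: "lhs_Z G TG M act \<pi> 1 1 1 = infl 1 ` CQ 1"
proof -
  have "cob 1 (infl 1 h) \<in> infl 2 ` CQ 2" if h: "h \<in> CQ 1" for h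
  proof -
    have "h \<in> Q.mvals 1" using h by (simp add: Q.cochains_discrete[OF product_TQ])
    from infl_coboundary[OF this] show ?thesis
      using Q.coboundary_1_cochain[OF product_TQ h] by (simp add: numeral_2_eq_2)
  qed
  then show ?thesis
    using hs_filtration_full[of 1] hs_filtration_full[of 2]
    by (auto simp: lhs_Z_def numeral_2_eq_2)
qed

lemma lhs_Z_132: "lhs_Z G TG M act \<pi> 1 3 2 = {zero_cochain G M 2}"
  using coboundary_zero[of 2] by (auto simp: lhs_Z_def hs_filtration_def)

text \<open>The exact part of the denominator of E_2^{0,1} comes from here. The second fact serves
  to show that the cosets of that denominator are nonempty.\<close>

lemma lhs_Z_1m10: "lhs_Z G TG M act \<pi> 1 (- 1) 0 \<subseteq> cochains G TG M 0"
  "zero_cochain G M 0 \<in> lhs_Z G TG M act \<pi> 1 (- 1) 0"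
proof -
  have z0: "zero_cochain G M 0 \<in> cochains G TG M 0" by (rule zero_cochain_0)
  have "zero_cochain Q M 1 \<in> CQ 1"
    by (auto simp: Q.cochains_discrete[OF product_TQ] zero_cochain_def)
  then have "zero_cochain G M 1 \<in> cochains G TG M 1"
    using infl_cochain[of "zero_cochain Q M 1" 1] by (simp add: infl_zero)
  then show "zero_cochain G M 0 \<in> lhs_Z G TG M act \<pi> 1 (- 1) 0"
    using z0 coboundary_zero[of 0] hs_filtration_zero[of 1]
    by (simp add: lhs_Z_def hs_filtration_def)
  show "lhs_Z G TG M act \<pi> 1 (- 1) 0 \<subseteq> cochains G TG M 0"
    by (auto simp: lhs_Z_def hs_filtration_def)
qed

text \<open>The first summand is zero by \<open>lhs_Z_132\<close>, and the second is the coboundary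
  of the inflated 1-cochains. So the denominator of E_2^{2,0} is the inflation of the 2-coboundaries
  of \<open>Q\<close>.\<close>

lemma lhs_B_222: "lhs_B G TG M act \<pi> 2 2 2 = infl 2 ` BQ"
proof -
  have "cob 1 ` infl 1 ` CQ 1 = infl 2 ` BQ"
    unfolding image_image
  proof (rule image_cong)
    fix h assume "h \<in> CQ 1"
    then have "h \<in> Q.mvals 1" by (simp add: Q.cochains_discrete[OF product_TQ])
    from infl_coboundary[OF this] show "cob 1 (infl 1 h) = infl 2 (Q.cob 1 h)"
      by (simp add: numeral_2_eq_2)
  qed simp
  then have "lhs_B G TG M act \<pi> 2 2 2 = {zero_cochain G M 2} <#>\<^bsub>cochain_group G TG M 2\<^esub> infl 2 ` BQ"
    using lhs_Z_132 lhs_Z_111 unfolding lhs_B_def by (simp add: numeral_2_eq_2)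
  also have "\<dots> = (\<Union>b\<in>infl 2 ` BQ. {zero_cochain G M 2} #>\<^bsub>cochain_group G TG M 2\<^esub> b)"
    by (auto simp: set_mult_def r_coset_def)
  also have "\<dots> = (\<Union>b\<in>infl 2 ` BQ. {b})"
  proof (rule SUP_cong)
    fix b assume "b \<in> infl 2 ` BQ"
    then obtain c where "c \<in> CQ 2" "b = infl 2 c"
      using Q.coboundary_1_cochain[OF product_TQ] by blast
    then show "{zero_cochain G M 2} #>\<^bsub>cochain_group G TG M 2\<^esub> b = {b}"
      using infl_values[of c 2]
      by (intro zero_r_coset) (auto simp: infl_extensional Q.cochains_discrete[OF product_TQ])
  qed simp
  finally show ?thesis by simp
qed

section \<open>Classes in H^2(Q, M) and their inflation\<close>

lemma BQ_subgroup: "subgroup BQ (cochain_group Q TQ M 2)"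
  by (rule Q.coboundary_1_subgroup[OF product_TQ])

lemma comm_group_CQ: "comm_group (cochain_group Q TQ M n)"
  by (rule Q.comm_group_cochains[OF product_TQ])

abbreviation qclass :: "((nat \<Rightarrow> 'q) \<Rightarrow> 'm) \<Rightarrow> ((nat \<Rightarrow> 'q) \<Rightarrow> 'm) set" where
  "qclass c \<equiv> BQ #>\<^bsub>cochain_group Q TQ M 2\<^esub> c"

text \<open>The denominator is itself inflated and inflation is additive, so a coset upstairs is the
  image of a coset downstairs.\<close>

lemma infl_class:
  "lhs_B G TG M act \<pi> 2 2 2 #>\<^bsub>cochain_group G TG M 2\<^esub> infl 2 c = infl 2 ` qclass c"
  unfolding lhs_B_222 r_coset_cochains image_image infl_add ..

lemma qclass_eq:
  assumes "c \<in> CQ 2" "c' \<in> qclass c" shows "qclass c' = qclass c"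
proof -
  interpret C2: comm_group "cochain_group Q TQ M 2" by (rule comm_group_CQ)
  show ?thesis
    using C2.repr_independence[OF assms(2) _ BQ_subgroup] assms(1) by (simp add: cochain_group_def)
qed

lemma qclass_self: "c \<in> CQ 2 \<Longrightarrow> c \<in> qclass c"
proof -
  interpret C2: comm_group "cochain_group Q TQ M 2" by (rule comm_group_CQ)
  show "c \<in> CQ 2 \<Longrightarrow> c \<in> qclass c"
    using C2.rcos_self[OF _ BQ_subgroup] by (simp add: cochain_group_def)
qed

lemma qclass_trivial_iff:
  assumes "c \<in> CQ 2" shows "qclass c = BQ \<longleftrightarrow> c \<in> BQ"
proof -
  interpret C2: comm_group "cochain_group Q TQ M 2" by (rule comm_group_CQ)
  show ?thesis
    using C2.coset_join1[OF _ _ BQ_subgroup] C2.coset_join2[OF _ BQ_subgroup] assms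
    by (auto simp: cochain_group_def)
qed

lemma qclass_subset:
  assumes "c \<in> CQ 2" shows "qclass c \<subseteq> CQ 2"
proof -
  interpret C2: comm_group "cochain_group Q TQ M 2" by (rule comm_group_CQ)
  show ?thesis
    using C2.r_coset_subset_G[OF subgroup.subset[OF BQ_subgroup]] assms by (simp add: cochain_group_def)
qed

lemma CQ_extensional: "c \<in> CQ n \<Longrightarrow> c \<in> extensional (tuples Q n)"
  by (simp add: cochains_def)

lemma CQ_values: "c \<in> CQ n \<Longrightarrow> c \<in> Q.mvals n"
  by (simp add: Q.cochains_discrete[OF product_TQ])

lemma coboundaries_Q: "coboundaries Q TQ M qact 2 = BQ"
  by (simp add: coboundaries_def numeral_2_eq_2)

lemma edge_inflation_qclass:
  assumes c: "c \<in> CQ 2" shows "edge_inflation G TG M act \<pi> (qclass c) = infl 2 ` qclass c"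
  unfolding edge_inflation_def
proof (rule map_class_const)
  show "qclass c \<noteq> {}" using qclass_self[OF c] by blast
  fix c' assume "c' \<in> qclass c"
  then show "lhs_B G TG M act \<pi> 2 2 2 #>\<^bsub>cochain_group G TG M 2\<^esub> (\<lambda>x\<in>tuples G 2. c' (\<lambda>i\<in>{..<2}. \<pi> (x i)))
      = infl 2 ` qclass c"
    unfolding infl_def[symmetric] infl_class by (simp only: qclass_eq[OF c])
qed

text \<open>Injectivity on cochains passes to cosets, since the image of a coset is taken
  elementwise.\<close>

lemma qclass_infl_inj:
  assumes c: "c \<in> CQ 2" and c': "c' \<in> CQ 2" and eq: "infl 2 ` qclass c = infl 2 ` qclass c'"
  shows "qclass c = qclass c'"
proof -
  obtain b where b: "b \<in> qclass c'" "infl 2 c = infl 2 b"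
    using eq qclass_self[OF c] by blast
  then have "c = b"
    using infl_inj[OF CQ_extensional[OF c] CQ_extensional] qclass_subset[OF c'] by blast
  then show ?thesis using qclass_eq[OF c' b(1)] by simp
qed

section \<open>Values of the edge maps, of d_2 and of the transgression\<close>

text \<open>Another representative differs from \<open>f0\<close> by an inflated \<open>h\<close>
  plus the coboundary of a 0-cochain. The latter has zero coboundary, so \<open>c\<close> changes
  only by the coboundary of \<open>h\<close>. On \<open>N\<close> both vanish: the first by
  normalization of \<open>h\<close>, the second because \<open>N\<close> acts trivially.\<close>

lemma coset_of_lhs_B_201:
  assumes f0: "f0 \<in> lhs_Z G TG M act \<pi> 2 0 1" and c: "c \<in> CQ 2" "cob 1 f0 = infl 2 c"
    and f: "f \<in> lhs_B G TG M act \<pi> 2 0 1 #>\<^bsub>cochain_group G TG M 1\<^esub> f0"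
  shows "\<exists>c'\<in>qclass c. cob 1 f = infl 2 c'"
    and "restrict f (tuples GN 1) = restrict f0 (tuples GN 1)"
proof -
  obtain b where b: "b \<in> lhs_B G TG M act \<pi> 2 0 1" and f_eq: "f = (\<lambda>x\<in>tuples G 1. b x \<oplus>\<^bsub>M\<^esub> f0 x)"
    using f by (auto simp: r_coset_cochains)
  obtain z e where z: "z \<in> infl 1 ` CQ 1" and e: "e \<in> lhs_Z G TG M act \<pi> 1 (- 1) 0"
    and b_eq: "b = (\<lambda>x\<in>tuples G 1. z x \<oplus>\<^bsub>M\<^esub> cob 0 e x)"
    using b unfolding lhs_B_def set_mult_def lhs_Z_111[symmetric] by (auto simp: cochain_group_def)
  obtain h where h: "h \<in> CQ 1" "z = infl 1 h" using z by blast
  have e_v: "e \<in> mvals 0" using e lhs_Z_1m10(1) cochains_values[OF _ topspace_TG] by blast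
  have de_v: "cob 0 e \<in> mvals 1" using coboundary_values[OF e_v] by simp
  have z_v: "z \<in> mvals 1" using infl_values[OF CQ_values[OF h(1)]] h(2) by simp
  have b_v: "b \<in> mvals 1"
    unfolding b_eq using funcset_mem[OF z_v] funcset_mem[OF de_v] by (intro funcsetI) simp
  have f0_c: "f0 \<in> cochains G TG M 1" using f0 unfolding lhs_Z_201 by blast
  have f0_v: "f0 \<in> mvals 1" using f0_c topspace_TG by (rule cochains_values)
  have h_v: "Q.cob 1 h \<in> Q.mvals 2" using Q.coboundary_values[OF CQ_values[OF h(1)]] by (simp add: numeral_2_eq_2)
  have dz: "cob 1 z = infl 2 (Q.cob 1 h)"
    using infl_coboundary[OF CQ_values[OF h(1)]] h(2) by (simp add: numeral_2_eq_2)
  have db: "cob 1 b = infl 2 (Q.cob 1 h)"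
  proof (rule extensionalityI[of _ "tuples G (Suc 1)"])
    show "infl 2 (Q.cob 1 h) \<in> extensional (tuples G (Suc 1))"
      using infl_extensional[of 2] by (simp add: numeral_2_eq_2)
    fix x assume x: "x \<in> tuples G (Suc 1)"
    then have x2: "x \<in> tuples G 2" by (simp add: numeral_2_eq_2)
    have "cob 1 b x = cob 1 z x \<oplus>\<^bsub>M\<^esub> cob 1 (cob 0 e) x"
      unfolding b_eq coboundary_add[OF z_v de_v] using x by (simp only: restrict_apply if_True)
    then show "cob 1 b x = infl 2 (Q.cob 1 h) x"
      unfolding coboundary_coboundary_0[OF e_v] dz
      using funcset_mem[OF infl_values[OF h_v] x2] x2 by (simp only: zero_cochain_def restrict_apply if_True M.r_zero)
  qed (rule coboundary_extensional)
  have "cob 1 f = (\<lambda>x\<in>tuples G 2. infl 2 (Q.cob 1 h) x \<oplus>\<^bsub>M\<^esub> infl 2 c x)"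
    unfolding f_eq coboundary_add[OF b_v f0_v] db c(2) by (simp add: numeral_2_eq_2)
  also have "\<dots> = infl 2 (\<lambda>y\<in>tuples Q 2. Q.cob 1 h y \<oplus>\<^bsub>M\<^esub> c y)"
    by (rule infl_add[symmetric])
  finally show "\<exists>c'\<in>qclass c. cob 1 f = infl 2 c'"
    unfolding r_coset_cochains using h(1) by blast
  show "restrict f (tuples GN 1) = restrict f0 (tuples GN 1)"
  proof (rule restrict_ext)
    fix x assume "x \<in> tuples GN 1"
    then obtain n where n: "n \<in> N" "x = tup1 n" using tuples_1E[of x GN] by auto
    have x: "tup1 n \<in> tuples G 1" by (rule tuples_I(1)[OF N_carrier[OF n(1)]])
    have "(\<lambda>i\<in>{..<1}. \<pi> (tup1 n i)) = tup1 \<one>\<^bsub>Q\<^esub>"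
      using N_pi[OF n(1)] by (intro restrict_ext) simp
    then have "z (tup1 n) = h (tup1 \<one>\<^bsub>Q\<^esub>)"
      unfolding h(2) infl_def using x by (simp only: restrict_apply if_True)
    also have "\<dots> = \<zero>\<^bsub>M\<^esub>"
    proof -
      have "tup1 \<one>\<^bsub>Q\<^esub> \<in> tuples Q 1" "\<exists>i<1. tup1 \<one>\<^bsub>Q\<^esub> i = \<one>\<^bsub>Q\<^esub>"
        using tuples_I(1)[OF H.one_closed] by auto
      then show ?thesis using h(1) unfolding Q.cochains_discrete[OF product_TQ] by blast
    qed
    finally have "b (tup1 n) = \<zero>\<^bsub>M\<^esub>"
      unfolding b_eq using x coboundary_0_N[OF e_v n(1)] by (simp only: restrict_apply if_True M.r_zero M.zero_closed)
    then show "f x = f0 x"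
      unfolding f_eq n(2) using x funcset_mem[OF f0_v x] by (simp only: restrict_apply if_True M.l_zero)
  qed
qed

lemma coset_of_lhs_B_201_nonempty:
  "lhs_B G TG M act \<pi> 2 0 1 #>\<^bsub>cochain_group G TG M 1\<^esub> f0 \<noteq> {}"
proof -
  have "zero_cochain Q M 1 \<in> CQ 1"
    by (auto simp: Q.cochains_discrete[OF product_TQ] zero_cochain_def)
  then have "lhs_Z G TG M act \<pi> 1 1 1 \<noteq> {}" unfolding lhs_Z_111 by blast
  then show ?thesis
    using lhs_Z_1m10(2) unfolding r_coset_cochains lhs_B_def set_mult_def by auto
qed

lemma edge_restriction_class:
  assumes f0: "f0 \<in> lhs_Z G TG M act \<pi> 2 0 1"
  shows "edge_restriction G TG M act N (lhs_B G TG M act \<pi> 2 0 1 #>\<^bsub>cochain_group G TG M 1\<^esub> f0)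
    = {restrict f0 (tuples GN 1)}"
  unfolding edge_restriction_def
proof (rule map_class_const[OF coset_of_lhs_B_201_nonempty])
  obtain c where c: "c \<in> CQ 2" "cob 1 f0 = infl 2 c" using f0 unfolding lhs_Z_201 by blast
  have "f0 \<in> cochains G TG M 1" using f0 unfolding lhs_Z_201 by blast
  then have f0_v: "f0 \<in> mvals 1" using topspace_TG by (rule cochains_values)
  have "restrict f0 (tuples GN 1) \<in> GN.mvals 1"
  proof (rule funcsetI)
    fix x assume "x \<in> tuples GN 1"
    then show "restrict f0 (tuples GN 1) x \<in> carrier M"
      using funcset_mem[OF f0_v GN_tuples] by (simp only: restrict_apply if_True)
  qed
  then have eq: "coboundaries GN TN M act 1 #>\<^bsub>cochain_group GN TN M 1\<^esub> restrict f0 (tuples GN 1)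
      = {restrict f0 (tuples GN 1)}"
    unfolding coboundaries_N by (intro zero_r_coset restrict_extensional)
  fix f assume "f \<in> lhs_B G TG M act \<pi> 2 0 1 #>\<^bsub>cochain_group G TG M 1\<^esub> f0"
  from coset_of_lhs_B_201(2)[OF f0 c this]
  show "coboundaries GN TN M act 1 #>\<^bsub>cochain_group GN TN M 1\<^esub> restrict f (tuples GN 1)
      = {restrict f0 (tuples GN 1)}"
    by (simp only: eq)
qed

lemma lhs_d_class:
  assumes f0: "f0 \<in> lhs_Z G TG M act \<pi> 2 0 1" and c: "c \<in> CQ 2" "cob 1 f0 = infl 2 c"
  shows "lhs_d G TG M act \<pi> 2 0 1 (lhs_B G TG M act \<pi> 2 0 1 #>\<^bsub>cochain_group G TG M 1\<^esub> f0)
    = infl 2 ` qclass c"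
  unfolding lhs_d_def
proof (rule map_class_const[OF coset_of_lhs_B_201_nonempty])
  fix f assume "f \<in> lhs_B G TG M act \<pi> 2 0 1 #>\<^bsub>cochain_group G TG M 1\<^esub> f0"
  from coset_of_lhs_B_201(1)[OF f0 c this]
  obtain c' where c': "c' \<in> qclass c" "cob 1 f = infl 2 c'" by blast
  have "lhs_B G TG M act \<pi> 2 2 2 #>\<^bsub>cochain_group G TG M 2\<^esub> cob 1 f = infl 2 ` qclass c"
    unfolding c'(2) infl_class by (simp only: qclass_eq[OF c(1) c'(1)])
  then show "lhs_B G TG M act \<pi> 2 (0 + 2) (Suc 1) #>\<^bsub>cochain_group G TG M (Suc 1)\<^esub> cob 1 f = infl 2 ` qclass c"
    by (simp add: numeral_2_eq_2)
qed

text \<open>The first \<open>inv_into\<close> yields a class known only through its restriction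
  \<open>Y\<close>, so \<open>f0\<close> is obtained and not prescribed; \<open>ex\<close>
  guarantees that a preimage exists. The outer \<open>inv_into\<close> recovers
  \<open>qclass c\<close> because inflation is injective on H^2(Q, M).\<close>

lemma transgression_eq:
  assumes Y: "Y = {y}" and ex: "\<exists>f0\<in>lhs_Z G TG M act \<pi> 2 0 1. restrict f0 (tuples GN 1) = y"
  obtains f0 c where "f0 \<in> cochains G TG M 1" "c \<in> CQ 2" "cob 1 f0 = infl 2 c"
    "restrict f0 (tuples GN 1) = y" "transgression G TG Q TQ \<pi> M act Y = qclass c"
proof -
  let ?E = "lhs_E G TG M act \<pi> 2 0 1" and ?r = "edge_restriction G TG M act N"
  let ?cl = "\<lambda>f. lhs_B G TG M act \<pi> 2 0 1 #>\<^bsub>cochain_group G TG M 1\<^esub> f"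
  have E: "carrier ?E = ?cl ` lhs_Z G TG M act \<pi> 2 0 1"
    unfolding lhs_E_def by (rule carrier_cochains_Mod)
  have "Y \<in> ?r ` carrier ?E"
    unfolding E Y image_image using ex edge_restriction_class by (metis (no_types, lifting) image_iff)
  then have X: "inv_into (carrier ?E) ?r Y \<in> carrier ?E" "?r (inv_into (carrier ?E) ?r Y) = Y"
    by (rule inv_into_into, rule f_inv_into_f)
  from X(1) obtain f0 where f0: "f0 \<in> lhs_Z G TG M act \<pi> 2 0 1" "inv_into (carrier ?E) ?r Y = ?cl f0"
    unfolding E by blast
  have f0_y: "restrict f0 (tuples GN 1) = y"
    using X(2) Y unfolding f0(2) edge_restriction_class[OF f0(1)] by simp
  obtain c where c: "c \<in> CQ 2" "cob 1 f0 = infl 2 c" and f0_c: "f0 \<in> cochains G TG M 1"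
    using f0(1) unfolding lhs_Z_201 by blast
  \<comment> \<open>The inflation of the coboundary of \<open>c\<close> is the double coboundary of
    \<open>f0\<close>; injectivity of inflation then makes \<open>c\<close> a cocycle.\<close>
  have "infl 3 (Q.cob 2 c) = zero_cochain G M 3"
    using infl_coboundary[OF CQ_values[OF c(1)]]
      coboundary_coboundary_1[OF cochains_values[OF f0_c topspace_TG]] c(2)
    by (simp add: numeral_3_eq_3 numeral_2_eq_2)
  then have "infl 3 (Q.cob 2 c) = infl 3 (zero_cochain Q M 3)" unfolding infl_zero .
  moreover have "Q.cob 2 c \<in> extensional (tuples Q 3)"
    using coboundary_extensional[of Q M qact 2 c] by (simp add: numeral_3_eq_3 numeral_2_eq_2)
  ultimately have "Q.cob 2 c = zero_cochain Q M 3"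
    by (intro infl_inj[OF _ zero_cochain_extensional])
  then have cocycle: "c \<in> cocycles Q TQ M qact 2"
    using c(1) by (simp add: cocycles_def numeral_3_eq_3 numeral_2_eq_2)
  let ?H = "cohomology Q TQ M qact 2" and ?i = "edge_inflation G TG M act \<pi>"
  have H: "carrier ?H = qclass ` cocycles Q TQ M qact 2"
    unfolding cohomology_def carrier_cochains_Mod coboundaries_Q ..
  have Z: "cocycles Q TQ M qact 2 \<subseteq> CQ 2" by (auto simp: cocycles_def)
  have "transgression G TG Q TQ \<pi> M act Y = inv_into (carrier ?H) ?i (infl 2 ` qclass c)"
    unfolding transgression_def f0(2) lhs_d_class[OF f0(1) c] ..
  also have "\<dots> = inv_into (carrier ?H) ?i (?i (qclass c))"
    unfolding edge_inflation_qclass[OF c(1)] ..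
  also have "\<dots> = qclass c"
  proof (rule inv_into_f_f)
    show "qclass c \<in> carrier ?H" unfolding H using cocycle by blast
    show "inj_on ?i (carrier ?H)"
    proof (rule inj_onI)
      fix U V assume "U \<in> carrier ?H" "V \<in> carrier ?H" and eq: "?i U = ?i V"
      then obtain u v where uv: "u \<in> CQ 2" "U = qclass u" "v \<in> CQ 2" "V = qclass v"
        unfolding H using Z by blast
      show "U = V"
        using eq unfolding uv(2,4) edge_inflation_qclass[OF uv(1)] edge_inflation_qclass[OF uv(3)]
        by (rule qclass_infl_inj[OF uv(1,3)])
    qed
  qed
  finally show ?thesis using that f0_c c f0_y by blast
qed

end

section \<open>Vanishing of the transgression and crossed homomorphisms\<close>

context topological_extension
begin

lemma kernel_transgression_iff:
  assumes \<phi>: "\<phi> \<in> hom GN (add_monoid M)"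
    and cont: "continuous_map TN (discrete_topology (carrier M)) \<phi>"
    and inv: "hom_class G TG M act N \<phi> \<in> carrier (invariant_cohomology G TG M act N 1)"
  shows "hom_class G TG M act N \<phi> \<in>
      kernel (invariant_cohomology G TG M act N 1) (cohomology Q TQ M qact 2)
        (transgression G TG Q TQ \<pi> M act)
    \<longleftrightarrow> (\<exists>F. crossed_hom F \<and> (\<forall>n\<in>N. F n = \<phi> n))"
proof -
  let ?y = "\<lambda>x\<in>tuples GN 1. \<phi> (x 0)"
  have \<phi>_closed: "\<phi> n \<in> carrier M" if "n \<in> N" for n
    using \<phi> that by (auto simp: hom_def)
  have \<phi>_mult: "\<phi> (n \<otimes>\<^bsub>G\<^esub> n') = \<phi> n \<oplus>\<^bsub>M\<^esub> \<phi> n'" if "n \<in> N" "n' \<in> N" for n n'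
    using \<phi> that by (auto simp: hom_def)
  have equiv: "\<phi> (g \<otimes>\<^bsub>G\<^esub> n \<otimes>\<^bsub>G\<^esub> inv\<^bsub>G\<^esub> g) = act g (\<phi> n)" if "g \<in> carrier G" "n \<in> N" for g n
    using invariant_imp_equivariant[OF \<phi>_closed inv that] .
  have N_sub: "subgroup N G" by (rule subgroup_kernel)
  have one_N: "\<one>\<^bsub>G\<^esub> \<in> N" using N_sub by (rule subgroup.one_closed)
  have \<phi>_one: "\<phi> \<one>\<^bsub>G\<^esub> = \<zero>\<^bsub>M\<^esub>"
    using \<phi>_mult[OF one_N one_N] \<phi>_closed[OF one_N] by (simp add: M.add.r_cancel_one')
  \<comment> \<open>A section sending identity to identity: this makes \<open>F0\<close> below agree
    with \<open>\<phi>\<close> on \<open>N\<close>, and the 2-cochain \<open>c\<close>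
    normalized.\<close>
  define s where "s q = (if q = \<one>\<^bsub>Q\<^esub> then \<one>\<^bsub>G\<^esub> else inv_into (carrier G) \<pi> q)" for q
  have s: "s q \<in> carrier G \<and> \<pi> (s q) = q" if "q \<in> carrier Q" for q
  proof -
    have "q \<in> \<pi> ` carrier G" using that surj by simp
    then show ?thesis by (auto simp: s_def inv_into_into f_inv_into_f)
  qed
  have s_one: "s \<one>\<^bsub>Q\<^esub> = \<one>\<^bsub>G\<^esub>" by (simp add: s_def)
  define \<nu> where "\<nu> g = g \<otimes>\<^bsub>G\<^esub> inv\<^bsub>G\<^esub> s (\<pi> g)" for g
  have \<nu>: "\<nu> g \<in> N" "g = \<nu> g \<otimes>\<^bsub>G\<^esub> s (\<pi> g)" if "g \<in> carrier G" for g
    using s[of "\<pi> g"] that by (auto simp: \<nu>_def G.m_assoc intro!: N_quotient)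
  have act_s: "act (s (\<pi> g)) m = act g m" if "g \<in> carrier G" "m \<in> carrier M" for g m
  proof -
    have "act g m = qact (\<pi> (s (\<pi> g))) m" using s[of "\<pi> g"] that by simp
    then show ?thesis using s[of "\<pi> g"] that qact_eq[of "s (\<pi> g)" m] by simp
  qed

  \<comment> \<open>The lift sends \<open>n s(q)\<close> to \<open>\<phi> n\<close>. It fails to be
    a crossed homomorphism exactly by \<open>\<phi>\<close> of the factor set of \<open>s\<close>,
    which depends only on the images in \<open>Q\<close>.\<close>
  have ex: "\<exists>f0\<in>lhs_Z G TG M act \<pi> 2 0 1. restrict f0 (tuples GN 1) = ?y"
  proof
    define F0 where "F0 g = \<phi> (\<nu> g)" for g
    have F0_closed: "F0 g \<in> carrier M" if "g \<in> carrier G" for g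
      using \<nu>(1)[OF that] \<phi>_closed by (simp add: F0_def)
    have F0_N: "F0 n = \<phi> n" if "n \<in> N" for n
      using N_carrier[OF that] N_pi[OF that] by (simp add: F0_def \<nu>_def s_one)
    have "continuous_map TG (discrete_topology (carrier M)) F0"
      using \<nu> \<phi>_closed by (intro continuous_by_cosets[of s \<phi> "\<lambda>_. \<zero>\<^bsub>M\<^esub>"] s cont) (auto simp: F0_def \<nu>_def)
    then have coch: "cochain1 F0 \<in> cochains G TG M 1"
      using F0_N[OF one_N] \<phi>_one by (intro cochain1_cochain) simp_all
    then have v: "cochain1 F0 \<in> mvals 1" using topspace_TG by (rule cochains_values)
    \<comment> \<open>The factor set of the section \<open>s\<close>.\<close>
    let ?\<gamma> = "\<lambda>q q'. s q \<otimes>\<^bsub>G\<^esub> s q' \<otimes>\<^bsub>G\<^esub> inv\<^bsub>G\<^esub> s (q \<otimes>\<^bsub>Q\<^esub> q')"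
    have \<gamma>_N: "?\<gamma> q q' \<in> N" if "q \<in> carrier Q" "q' \<in> carrier Q" for q q'
      using s that by (intro N_quotient) auto
    have \<gamma>_one: "?\<gamma> q q' = \<one>\<^bsub>G\<^esub>" if "q \<in> carrier Q" "q' \<in> carrier Q" "q = \<one>\<^bsub>Q\<^esub> \<or> q' = \<one>\<^bsub>Q\<^esub>" for q q'
      using that s by (auto simp: s_one)
    define c where "c = (\<lambda>y\<in>tuples Q 2. \<ominus>\<^bsub>M\<^esub> \<phi> (?\<gamma> (y 0) (y 1)))"
    have c_tup: "c (tup2 q q') = \<ominus>\<^bsub>M\<^esub> \<phi> (?\<gamma> q q')" if "q \<in> carrier Q" "q' \<in> carrier Q" for q q'
      using tuples_I(2)[OF that] by (simp add: c_def)
    have c: "c \<in> CQ 2"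
      unfolding Q.cochains_discrete[OF product_TQ]
    proof (intro CollectI conjI IntI ballI impI)
      show "c \<in> extensional (tuples Q 2)" by (simp add: c_def)
      show "c \<in> Q.mvals 2"
      proof (rule funcsetI)
        fix y assume "y \<in> tuples Q 2"
        then obtain q q' where q: "q \<in> carrier Q" "q' \<in> carrier Q" "y = tup2 q q'" by (rule tuples_2E)
        then show "c y \<in> carrier M" unfolding q(3) c_tup[OF q(1,2)] using \<gamma>_N \<phi>_closed by simp
      qed
      fix y assume y: "y \<in> tuples Q 2" "\<exists>i<2. y i = \<one>\<^bsub>Q\<^esub>"
      obtain q q' where q: "q \<in> carrier Q" "q' \<in> carrier Q" "y = tup2 q q'" using y(1) by (rule tuples_2E)
      have "q = \<one>\<^bsub>Q\<^esub> \<or> q' = \<one>\<^bsub>Q\<^esub>" using y(2) q(3) by (auto simp: less_2_cases_iff)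
      then show "c y = \<zero>\<^bsub>M\<^esub>" unfolding q(3) c_tup[OF q(1,2)] using \<gamma>_one[OF q(1,2)] \<phi>_one minus_zero by simp
    qed
    have "cob 1 (cochain1 F0) = infl 2 c"
    proof (rule extensionalityI[of _ "tuples G 2"])
      show "cob 1 (cochain1 F0) \<in> extensional (tuples G 2)"
        using coboundary_extensional[of G M act 1] by (simp add: numeral_2_eq_2)
      fix x assume x: "x \<in> tuples G 2"
      then obtain g h where gh: "g \<in> carrier G" "h \<in> carrier G" "x = tup2 g h" by (rule tuples_2E)
      note sg = s[OF hom_closed[OF gh(1)]] and sh = s[OF hom_closed[OF gh(2)]]
      let ?q = "\<pi> g" and ?q' = "\<pi> h"
      let ?s = "s ?q" and ?s' = "s ?q'" and ?s'' = "s (?q \<otimes>\<^bsub>Q\<^esub> ?q')"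
      have s'': "?s'' \<in> carrier G" using s gh by simp
      \<comment> \<open>In \<open>g h = \<nu> g s \<nu> h s'\<close>, the factor
        \<open>\<nu> h\<close> is moved to the left past \<open>s\<close>, and \<open>s s'\<close>
        is replaced by the factor set times \<open>s''\<close>. All three factors on the right lie
        in \<open>N\<close>, where \<open>\<phi>\<close> is additive.\<close>
      have \<nu>_gh: "\<nu> (g \<otimes>\<^bsub>G\<^esub> h) = \<nu> g \<otimes>\<^bsub>G\<^esub> (?s \<otimes>\<^bsub>G\<^esub> \<nu> h \<otimes>\<^bsub>G\<^esub> inv\<^bsub>G\<^esub> ?s) \<otimes>\<^bsub>G\<^esub> ?\<gamma> ?q ?q'"
      proof -
        note nc = N_carrier[OF \<nu>(1)[OF gh(1)]] N_carrier[OF \<nu>(1)[OF gh(2)]]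
        have cancel: "inv\<^bsub>G\<^esub> ?s \<otimes>\<^bsub>G\<^esub> (?s \<otimes>\<^bsub>G\<^esub> z) = z" if "z \<in> carrier G" for z
          using sg that by (simp flip: G.m_assoc)
        have "\<nu> g \<otimes>\<^bsub>G\<^esub> (?s \<otimes>\<^bsub>G\<^esub> \<nu> h \<otimes>\<^bsub>G\<^esub> inv\<^bsub>G\<^esub> ?s) \<otimes>\<^bsub>G\<^esub> ?\<gamma> ?q ?q'
            = (\<nu> g \<otimes>\<^bsub>G\<^esub> ?s) \<otimes>\<^bsub>G\<^esub> (\<nu> h \<otimes>\<^bsub>G\<^esub> ?s') \<otimes>\<^bsub>G\<^esub> inv\<^bsub>G\<^esub> ?s''"
          using nc sg sh s'' by (simp add: G.m_assoc cancel)
        also have "\<dots> = \<nu> (g \<otimes>\<^bsub>G\<^esub> h)"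
          unfolding \<nu>(2)[OF gh(1), symmetric] \<nu>(2)[OF gh(2), symmetric]
          using gh by (simp add: \<nu>_def)
        finally show ?thesis by simp
      qed
      have "?s \<otimes>\<^bsub>G\<^esub> \<nu> h \<otimes>\<^bsub>G\<^esub> inv\<^bsub>G\<^esub> ?s \<in> N"
        using N_conj[OF \<nu>(1)[OF gh(2)]] sg by simp
      moreover have \<gamma>N: "?\<gamma> ?q ?q' \<in> N" using gh by (intro \<gamma>_N) auto
      ultimately have "F0 (g \<otimes>\<^bsub>G\<^esub> h) = F0 g \<oplus>\<^bsub>M\<^esub> act ?s (F0 h) \<oplus>\<^bsub>M\<^esub> \<phi> (?\<gamma> ?q ?q')"
        unfolding F0_def \<nu>_gh using \<nu>(1) gh sg
        by (simp add: \<phi>_mult subgroup.m_closed[OF N_sub] equiv)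
      then have F0_gh: "F0 (g \<otimes>\<^bsub>G\<^esub> h) = F0 g \<oplus>\<^bsub>M\<^esub> act g (F0 h) \<oplus>\<^bsub>M\<^esub> \<phi> (?\<gamma> ?q ?q')"
        using act_s gh F0_closed by simp
      have alg: "a \<ominus>\<^bsub>M\<^esub> (b \<oplus>\<^bsub>M\<^esub> a \<oplus>\<^bsub>M\<^esub> d) \<oplus>\<^bsub>M\<^esub> b = \<ominus>\<^bsub>M\<^esub> d"
        if "a \<in> carrier M" "b \<in> carrier M" "d \<in> carrier M" for a b d
        using that by algebra
      have "cob 1 (cochain1 F0) (tup2 g h) = act g (F0 h) \<ominus>\<^bsub>M\<^esub> F0 (g \<otimes>\<^bsub>G\<^esub> h) \<oplus>\<^bsub>M\<^esub> F0 g"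
        unfolding coboundary_1_tup2[OF v gh(1,2)]
        by (simp only: cochain1_tup1 gh(1,2) G.m_closed)
      also have "\<dots> = \<ominus>\<^bsub>M\<^esub> \<phi> (?\<gamma> ?q ?q')"
        unfolding F0_gh using F0_closed gh \<gamma>N \<phi>_closed by (intro alg) auto
      also have "\<dots> = c (tup2 ?q ?q')"
        using c_tup[of ?q ?q'] gh by simp
      also have "tup2 ?q ?q' = (\<lambda>i\<in>{..<2}. \<pi> (tup2 g h i))"
        by (intro restrict_ext) simp
      also have "c \<dots> = infl 2 c (tup2 g h)"
        using x gh(3) by (simp add: infl_def)
      finally show "cob 1 (cochain1 F0) x = infl 2 c x" unfolding gh(3) .
    qed (rule infl_extensional)
    then show "cochain1 F0 \<in> lhs_Z G TG M act \<pi> 2 0 1"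
      unfolding lhs_Z_201 using coch c by blast
    show "restrict (cochain1 F0) (tuples GN 1) = ?y"
    proof (rule restrict_ext)
      fix x assume x: "x \<in> tuples GN 1"
      then have "x 0 \<in> N" by auto
      then show "cochain1 F0 x = \<phi> (x 0)"
        unfolding cochain1_def using GN_tuples[OF x] F0_N by (simp only: restrict_apply if_True)
    qed
  qed
  have Y: "hom_class G TG M act N \<phi> = {?y}" using \<phi>_closed by (rule hom_class_eq)
  obtain f0 c where f0: "f0 \<in> cochains G TG M 1" and c: "c \<in> CQ 2" and df0: "cob 1 f0 = infl 2 c"
    and f0_N: "restrict f0 (tuples GN 1) = ?y"
    and tr: "transgression G TG Q TQ \<pi> M act (hom_class G TG M act N \<phi>) = qclass c"
    using transgression_eq[OF Y ex] by blast
  have f0_v: "f0 \<in> mvals 1" using f0 topspace_TG by (rule cochains_values)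
  have f0_c: "f0 (tup1 g) \<in> carrier M" if "g \<in> carrier G" for g
    using f0_v tuples_I(1)[OF that] by (rule funcset_mem)
  have f0_\<phi>: "f0 (tup1 n) = \<phi> n" if "n \<in> N" for n
  proof -
    have "tup1 n \<in> tuples GN 1" using that by (intro tuples_I(1)) simp
    then show ?thesis using fun_cong[OF f0_N, of "tup1 n"]
      by (simp only: restrict_apply if_True lessThan_iff zero_less_one)
  qed
  have "\<one>\<^bsub>cohomology Q TQ M qact 2\<^esub> = BQ"
    unfolding cohomology_def coboundaries_Q by (simp add: FactGroup_def)
  then have "hom_class G TG M act N \<phi> \<in>
      kernel (invariant_cohomology G TG M act N 1) (cohomology Q TQ M qact 2)
        (transgression G TG Q TQ \<pi> M act) \<longleftrightarrow> c \<in> BQ"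
    using inv tr qclass_trivial_iff[OF c] by (simp add: kernel_def)
  also have "\<dots> \<longleftrightarrow> (\<exists>F. crossed_hom F \<and> (\<forall>n\<in>N. F n = \<phi> n))"
  proof
    assume "c \<in> BQ"
    then obtain h where h: "h \<in> CQ 1" "c = Q.cob 1 h" by blast
    define k where "k g = infl 1 h (tup1 g)" for g
    have k_v: "infl 1 h \<in> mvals 1" using CQ_values[OF h(1)] by (rule infl_values)
    have k_c: "k g \<in> carrier M" if "g \<in> carrier G" for g
      unfolding k_def using k_v tuples_I(1)[OF that] by (rule funcset_mem)
    have eq: "cob 1 f0 = cob 1 (infl 1 h)"
      using df0 infl_coboundary[OF CQ_values[OF h(1)]] h(2) by (simp add: numeral_2_eq_2)
    define F where "F g = f0 (tup1 g) \<ominus>\<^bsub>M\<^esub> k g" for g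
    have "F (g \<otimes>\<^bsub>G\<^esub> h') = F g \<oplus>\<^bsub>M\<^esub> act g (F h')" if g: "g \<in> carrier G" "h' \<in> carrier G" for g h'
    proof -
      note gh = G.m_closed[OF g]
      have e: "act g (f0 (tup1 h')) \<ominus>\<^bsub>M\<^esub> f0 (tup1 (g \<otimes>\<^bsub>G\<^esub> h')) \<oplus>\<^bsub>M\<^esub> f0 (tup1 g)
          = act g (k h') \<ominus>\<^bsub>M\<^esub> k (g \<otimes>\<^bsub>G\<^esub> h') \<oplus>\<^bsub>M\<^esub> k g"
        using fun_cong[OF eq, of "tup2 g h'"]
        unfolding coboundary_1_tup2[OF f0_v g] coboundary_1_tup2[OF k_v g] k_def .
      have alg: "v \<ominus>\<^bsub>M\<^esub> v' = (w \<ominus>\<^bsub>M\<^esub> w') \<oplus>\<^bsub>M\<^esub> (u \<ominus>\<^bsub>M\<^esub> u')"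
        if e: "u \<ominus>\<^bsub>M\<^esub> v \<oplus>\<^bsub>M\<^esub> w = u' \<ominus>\<^bsub>M\<^esub> v' \<oplus>\<^bsub>M\<^esub> w'"
          and uvw: "u \<in> carrier M" "v \<in> carrier M" "w \<in> carrier M"
          "u' \<in> carrier M" "v' \<in> carrier M" "w' \<in> carrier M" for u v w u' v' w'
      proof -
        \<comment> \<open>\<open>algebra\<close> proves identities valid for all values, so the
          hypothesis \<open>e\<close> enters as the difference of its two sides, which is then
          rewritten to zero.\<close>
        have "v \<ominus>\<^bsub>M\<^esub> v' = (w \<ominus>\<^bsub>M\<^esub> w') \<oplus>\<^bsub>M\<^esub> (u \<ominus>\<^bsub>M\<^esub> u') \<oplus>\<^bsub>M\<^esub> ((u' \<ominus>\<^bsub>M\<^esub> v' \<oplus>\<^bsub>M\<^esub> w') \<ominus>\<^bsub>M\<^esub> (u \<ominus>\<^bsub>M\<^esub> v \<oplus>\<^bsub>M\<^esub> w))"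
          using uvw by algebra
        then show ?thesis unfolding e using uvw by (simp add: M.minus_eq M.r_neg)
      qed
      have "act g (F h') = act g (f0 (tup1 h')) \<ominus>\<^bsub>M\<^esub> act g (k h')"
        unfolding F_def M.minus_eq
        by (simp only: act_add act_minus g f0_c k_c M.a_inv_closed)
      then show ?thesis
        using alg[OF e] g gh f0_c k_c unfolding F_def by simp
    qed
    moreover have "F n = \<phi> n" if n: "n \<in> N" for n
    proof -
      have "(\<lambda>i\<in>{..<1}. \<pi> (tup1 n i)) = tup1 \<one>\<^bsub>Q\<^esub>"
        using N_pi[OF n] by (intro restrict_ext) simp
      then have "k n = h (tup1 \<one>\<^bsub>Q\<^esub>)"
        unfolding k_def infl_def using tuples_I(1)[OF N_carrier[OF n]] by (simp only: restrict_apply if_True)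
      also have "\<dots> = \<zero>\<^bsub>M\<^esub>"
      proof -
        have "tup1 \<one>\<^bsub>Q\<^esub> \<in> tuples Q 1" "\<exists>i<1. tup1 \<one>\<^bsub>Q\<^esub> i = \<one>\<^bsub>Q\<^esub>"
          using tuples_I(1)[OF H.one_closed] by auto
        then show ?thesis using h(1) unfolding Q.cochains_discrete[OF product_TQ] by blast
      qed
      finally show ?thesis unfolding F_def f0_\<phi>[OF n] using \<phi>_closed[OF n] by (simp add: M.minus_eq minus_zero)
    qed
    moreover have "F g \<in> carrier M" if "g \<in> carrier G" for g
      using that f0_c k_c by (simp add: F_def)
    ultimately show "\<exists>F. crossed_hom F \<and> (\<forall>n\<in>N. F n = \<phi> n)"
      by (intro exI[of _ F]) (simp add: crossed_hom_def)
  next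
    assume "\<exists>F. crossed_hom F \<and> (\<forall>n\<in>N. F n = \<phi> n)"
    then obtain F where F: "crossed_hom F" and F_N: "\<And>n. n \<in> N \<Longrightarrow> F n = \<phi> n" by blast
    have F_c: "F g \<in> carrier M" if "g \<in> carrier G" for g using F that by (simp add: crossed_hom_def)
    have F_mult: "F (g \<otimes>\<^bsub>G\<^esub> g') = F g \<oplus>\<^bsub>M\<^esub> act g (F g')" if "g \<in> carrier G" "g' \<in> carrier G" for g g'
      using F that by (simp add: crossed_hom_def)
    \<comment> \<open>\<open>c\<close> is normalized, so the coboundary of \<open>f0\<close>
      vanishes when its first argument lies in \<open>N\<close>. Since \<open>F\<close> obeys the
      same rule, \<open>f0 - F\<close> is constant on the cosets of \<open>N\<close>.\<close>
    have f0_mult: "f0 (tup1 (n \<otimes>\<^bsub>G\<^esub> g)) = \<phi> n \<oplus>\<^bsub>M\<^esub> f0 (tup1 g)" if n: "n \<in> N" and g: "g \<in> carrier G" for n g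
    proof -
      note nc = N_carrier[OF n]
      have "(\<lambda>i\<in>{..<2}. \<pi> (tup2 n g i)) = tup2 \<one>\<^bsub>Q\<^esub> (\<pi> g)"
        using N_pi[OF n] by (intro restrict_ext) simp
      then have "infl 2 c (tup2 n g) = c (tup2 \<one>\<^bsub>Q\<^esub> (\<pi> g))"
        unfolding infl_def using tuples_I(2)[OF nc g] by (simp only: restrict_apply if_True)
      also have "\<dots> = \<zero>\<^bsub>M\<^esub>"
      proof -
        have "tup2 \<one>\<^bsub>Q\<^esub> (\<pi> g) \<in> tuples Q 2" using g by (intro tuples_I(2)) auto
        moreover have "\<exists>i<2. tup2 \<one>\<^bsub>Q\<^esub> (\<pi> g) i = \<one>\<^bsub>Q\<^esub>" by (intro exI[of _ 0]) simp
        ultimately show ?thesis using c unfolding Q.cochains_discrete[OF product_TQ] by blast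
      qed
      finally have e: "f0 (tup1 g) \<ominus>\<^bsub>M\<^esub> f0 (tup1 (n \<otimes>\<^bsub>G\<^esub> g)) \<oplus>\<^bsub>M\<^esub> \<phi> n = \<zero>\<^bsub>M\<^esub>"
        unfolding df0[symmetric] coboundary_1_tup2[OF f0_v nc g] f0_\<phi>[OF n] kernel_acts[OF n f0_c[OF g]] .
      have alg: "v = w \<oplus>\<^bsub>M\<^esub> u" if e: "u \<ominus>\<^bsub>M\<^esub> v \<oplus>\<^bsub>M\<^esub> w = \<zero>\<^bsub>M\<^esub>"
        and uvw: "u \<in> carrier M" "v \<in> carrier M" "w \<in> carrier M" for u v w
      proof -
        have "v = w \<oplus>\<^bsub>M\<^esub> u \<ominus>\<^bsub>M\<^esub> (u \<ominus>\<^bsub>M\<^esub> v \<oplus>\<^bsub>M\<^esub> w)" using uvw by algebra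
        then show ?thesis unfolding e using uvw by (simp add: M.minus_eq minus_zero)
      qed
      show ?thesis using e f0_c[OF g] f0_c[OF G.m_closed[OF nc g]] \<phi>_closed[OF n] by (rule alg)
    qed
    \<comment> \<open>The function on \<open>Q\<close> induced by \<open>f0 - F\<close>, read off at
      the section. As \<open>Q\<close> is finite and discrete, it is a continuous cochain whether or
      not \<open>F\<close> was known to be continuous.\<close>
    define h where "h = (\<lambda>y\<in>tuples Q 1. f0 (tup1 (s (y 0))) \<ominus>\<^bsub>M\<^esub> F (s (y 0)))"
    have h_tup: "h (tup1 q) = f0 (tup1 (s q)) \<ominus>\<^bsub>M\<^esub> F (s q)" if "q \<in> carrier Q" for q
      unfolding h_def using tuples_I(1)[OF that] by (simp only: restrict_apply if_True lessThan_iff zero_less_one)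
    have h: "h \<in> CQ 1"
      unfolding Q.cochains_discrete[OF product_TQ]
    proof (intro CollectI conjI IntI ballI impI)
      show "h \<in> extensional (tuples Q 1)" by (simp add: h_def)
      show "h \<in> Q.mvals 1"
      proof (rule funcsetI)
        fix y assume "y \<in> tuples Q 1"
        then obtain q where q: "q \<in> carrier Q" "y = tup1 q" by (rule tuples_1E)
        show "h y \<in> carrier M" unfolding q(2) h_tup[OF q(1)]
          using s[OF q(1)] f0_c F_c by blast
      qed
      fix y assume y: "y \<in> tuples Q 1" "\<exists>i<1. y i = \<one>\<^bsub>Q\<^esub>"
      then obtain q where q: "q \<in> carrier Q" "y = tup1 q" by (blast elim: tuples_1E)
      have "q = \<one>\<^bsub>Q\<^esub>" using y(2) q(2) by auto
      then have "h y = f0 (tup1 \<one>\<^bsub>G\<^esub>) \<ominus>\<^bsub>M\<^esub> F \<one>\<^bsub>G\<^esub>"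
        unfolding q(2) h_tup[OF q(1)] by (simp only: s_one)
      also have "\<dots> = \<zero>\<^bsub>M\<^esub>"
        unfolding f0_\<phi>[OF one_N] F_N[OF one_N] \<phi>_one by (simp add: M.minus_eq minus_zero)
      finally show "h y = \<zero>\<^bsub>M\<^esub>" .
    qed
    have infl_h: "infl 1 h (tup1 g) = f0 (tup1 g) \<ominus>\<^bsub>M\<^esub> F g" if g: "g \<in> carrier G" for g
    proof -
      let ?s = "s (\<pi> g)"
      have sc: "?s \<in> carrier G" using s g by simp
      note n = \<nu>(1)[OF g]
      have "(\<lambda>i\<in>{..<1}. \<pi> (tup1 g i)) = tup1 (\<pi> g)" by (intro restrict_ext) simp
      then have 1: "infl 1 h (tup1 g) = f0 (tup1 ?s) \<ominus>\<^bsub>M\<^esub> F ?s"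
        unfolding infl_def using tuples_I(1)[OF g] h_tup[OF hom_closed[OF g]]
        by (simp only: restrict_apply if_True)
      have f0_g: "f0 (tup1 g) = \<phi> (\<nu> g) \<oplus>\<^bsub>M\<^esub> f0 (tup1 ?s)"
        using f0_mult[OF n sc] unfolding \<nu>(2)[OF g, symmetric] .
      have F_g: "F g = \<phi> (\<nu> g) \<oplus>\<^bsub>M\<^esub> F ?s"
        using F_mult[OF N_carrier[OF n] sc]
        unfolding \<nu>(2)[OF g, symmetric] F_N[OF n] kernel_acts[OF n F_c[OF sc]] .
      have alg: "u \<ominus>\<^bsub>M\<^esub> v = (w \<oplus>\<^bsub>M\<^esub> u) \<ominus>\<^bsub>M\<^esub> (w \<oplus>\<^bsub>M\<^esub> v)"
        if "u \<in> carrier M" "v \<in> carrier M" "w \<in> carrier M" for u v w using that by algebra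
      show ?thesis unfolding 1 f0_g F_g using f0_c[OF sc] F_c[OF sc] \<phi>_closed[OF n] by (rule alg)
    qed
    have infl_v: "infl 1 h \<in> mvals 1" using CQ_values[OF h] by (rule infl_values)
    have "cob 1 (infl 1 h) = cob 1 f0"
    proof (rule extensionalityI[OF coboundary_extensional coboundary_extensional])
      fix x assume "x \<in> tuples G (Suc 1)"
      then have "x \<in> tuples G 2" by (simp add: numeral_2_eq_2)
      then obtain g g' where g: "g \<in> carrier G" "g' \<in> carrier G" "x = tup2 g g'" by (rule tuples_2E)
      note gg = G.m_closed[OF g(1,2)]
      \<comment> \<open>\<open>F\<close> at the product is already expanded by the crossed
        homomorphism rule; its terms cancel and leave the coboundary of \<open>f0\<close>.\<close>
      have alg: "(u \<oplus>\<^bsub>M\<^esub> \<ominus>\<^bsub>M\<^esub> u') \<ominus>\<^bsub>M\<^esub> (v \<ominus>\<^bsub>M\<^esub> (w' \<oplus>\<^bsub>M\<^esub> u')) \<oplus>\<^bsub>M\<^esub> (w \<ominus>\<^bsub>M\<^esub> w') = u \<ominus>\<^bsub>M\<^esub> v \<oplus>\<^bsub>M\<^esub> w"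
        if "u \<in> carrier M" "v \<in> carrier M" "w \<in> carrier M" "u' \<in> carrier M" "w' \<in> carrier M"
        for u v w u' w' using that by algebra
      have a: "act g (f0 (tup1 g') \<ominus>\<^bsub>M\<^esub> F g') = act g (f0 (tup1 g')) \<oplus>\<^bsub>M\<^esub> \<ominus>\<^bsub>M\<^esub> act g (F g')"
        unfolding M.minus_eq by (simp only: act_add act_minus g(1,2) f0_c F_c M.a_inv_closed)
      show "cob 1 (infl 1 h) x = cob 1 f0 x"
        unfolding g(3) coboundary_1_tup2[OF infl_v g(1,2)] coboundary_1_tup2[OF f0_v g(1,2)]
          infl_h[OF g(1)] infl_h[OF g(2)] infl_h[OF gg] a F_mult[OF g(1,2)]
        by (rule alg[OF act_closed[OF g(1) f0_c[OF g(2)]] f0_c[OF gg] f0_c[OF g(1)]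
              act_closed[OF g(1) F_c[OF g(2)]] F_c[OF g(1)]])
    qed
    then have "infl 2 c = infl 2 (Q.cob 1 h)"
      using df0 infl_coboundary[OF CQ_values[OF h]] by (simp add: numeral_2_eq_2)
    moreover have "Q.cob 1 h \<in> CQ 2" by (rule Q.coboundary_1_cochain[OF product_TQ h])
    ultimately have "c = Q.cob 1 h"
      using infl_inj[OF CQ_extensional[OF c] CQ_extensional] by blast
    then show "c \<in> BQ" using h by blast
  qed
  finally show ?thesis .
qed

end

section \<open>Elementary abelian quotients\<close>

text \<open>All facts are transported through the isomorphism. Positivity of \<open>p\<close>
  matters because \<open>integer_mod_group 0\<close> is infinite cyclic.\<close>

lemma elementary_abelian_properties:
  assumes "elementary_abelian p n Q" "group Q" "p > 0"
  shows "card (carrier Q) = p ^ n" "finite (carrier Q)"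
    and "x \<in> carrier Q \<Longrightarrow> x [^]\<^bsub>Q\<^esub> p = \<one>\<^bsub>Q\<^esub>"
    and "x \<in> carrier Q \<Longrightarrow> y \<in> carrier Q \<Longrightarrow> x \<otimes>\<^bsub>Q\<^esub> y = y \<otimes>\<^bsub>Q\<^esub> x"
proof -
  let ?P = "product_group {..<n} (\<lambda>_. integer_mod_group p)"
  have iso: "Q \<cong> ?P" using assms(1) by (simp add: elementary_abelian_def)
  show card: "card (carrier Q) = p ^ n"
    using iso_same_card[OF iso] assms(3) by (simp add: card_PiE carrier_integer_mod_group)
  show "finite (carrier Q)" using card assms(3) by (intro card_ge_0_finite) simp
  interpret Q: group Q by fact
  interpret P: group ?P by (rule product_group) simp
  obtain h where h: "h \<in> hom Q ?P" and inj: "inj_on h (carrier Q)"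
    using iso by (auto simp: is_iso_def iso_def bij_betw_def)
  interpret h: group_hom Q ?P h by unfold_locales (rule h)
  show "x [^]\<^bsub>Q\<^esub> p = \<one>\<^bsub>Q\<^esub>" if x: "x \<in> carrier Q"
  proof -
    \<comment> \<open>Powers in the product are componentwise, and each component is annihilated by
      \<open>p\<close>.\<close>
    have pow: "y [^]\<^bsub>?P\<^esub> k = (\<lambda>i\<in>{..<n}. y i [^]\<^bsub>integer_mod_group p\<^esub> k)" for y and k :: nat
      by (induction k) (auto intro!: restrict_ext)
    have "h (x [^]\<^bsub>Q\<^esub> p) = h \<one>\<^bsub>Q\<^esub>"
      using x by (simp only: h.hom_nat_pow h.hom_one pow) (simp add: restrict_def)
    then show ?thesis using inj x by (auto simp: inj_on_def)
  qed
  show "x \<otimes>\<^bsub>Q\<^esub> y = y \<otimes>\<^bsub>Q\<^esub> x" if "x \<in> carrier Q" "y \<in> carrier Q"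
  proof -
    have "h (x \<otimes>\<^bsub>Q\<^esub> y) = h (y \<otimes>\<^bsub>Q\<^esub> x)"
      using that by (simp add: add.commute)
    then show ?thesis using inj that by (auto simp: inj_on_def)
  qed
qed

theorem theorem6p11:
  fixes p r :: nat
    and G :: "('g, 'a) monoid_scheme" and TG :: "'g topology"
    and Q :: "('q, 'c) monoid_scheme" and TQ :: "'q topology"
    and \<pi> :: "'g \<Rightarrow> 'q" and N :: "'g set"
    and M :: "('m, 'b) ring_scheme" and act :: "'g \<Rightarrow> 'm \<Rightarrow> 'm"
    and qact :: "'q \<Rightarrow> 'm \<Rightarrow> 'm"
    and \<tau> :: "nat \<Rightarrow> 'q" and s :: "'q \<Rightarrow> 'g"
    and a :: "nat \<Rightarrow> 'g" and c :: "nat \<Rightarrow> nat \<Rightarrow> 'g"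
    and \<phi> :: "'g \<Rightarrow> 'm"
  assumes "Factorial_Ring.prime p"
    and "profinite_group G TG" and "profinite_group Q TQ"
    and "\<pi> \<in> hom G Q" and "continuous_map TG TQ \<pi>" and "\<pi> ` carrier G = carrier Q"
    and "N = kernel G Q \<pi>"
    and "elementary_abelian p (r + 1) Q"
    and "\<tau> ` {..r} \<subseteq> carrier Q" and "generate Q (\<tau> ` {..r}) = carrier Q"
    and "discrete_module G TG M act"
    and "\<And>n m. n \<in> N \<Longrightarrow> m \<in> carrier M \<Longrightarrow> act n m = m"
    and "qact = induced_action G \<pi> act"
    and "\<And>x. x \<in> carrier Q \<Longrightarrow> s x \<in> carrier G \<and> \<pi> (s x) = x"
    and "\<And>t. (\<forall>i\<le>r. t i \<le> p - 1) \<Longrightarrow>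
           s (ordered_monomial Q \<tau> t (r + 1)) = ordered_monomial G (\<lambda>i. s (\<tau> i)) t (r + 1)"
    and "\<And>j. j \<le> r \<Longrightarrow> a j = s (\<tau> j) [^]\<^bsub>G\<^esub> p"
    and "\<And>j k. j < k \<Longrightarrow> k \<le> r \<Longrightarrow>
           c j k = s (\<tau> k) \<otimes>\<^bsub>G\<^esub> s (\<tau> j) \<otimes>\<^bsub>G\<^esub> inv\<^bsub>G\<^esub> (s (\<tau> k)) \<otimes>\<^bsub>G\<^esub> inv\<^bsub>G\<^esub> (s (\<tau> j))"
    and "\<phi> \<in> hom (subgroup_of G N) (add_monoid M)"
    and "continuous_map (subtopology TG N) (discrete_topology (carrier M)) \<phi>"
    and "hom_class G TG M act N \<phi> \<in> carrier (invariant_cohomology G TG M act N 1)"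
  shows "hom_class G TG M act N \<phi> \<in>
           kernel (invariant_cohomology G TG M act N 1) (cohomology Q TQ M qact 2)
             (transgression G TG Q TQ \<pi> M act)
    \<longleftrightarrow>
         (\<exists>m. (\<forall>j\<le>r. m j \<in> carrier M) \<and>
              (\<forall>j\<le>r. \<phi> (a j) = \<ominus>\<^bsub>M\<^esub> norm_element Q M qact p (\<tau> j) (m j)) \<and>
              (\<forall>j k. j < k \<and> k \<le> r \<longrightarrow>
                 \<phi> (c j k) = (m j \<ominus>\<^bsub>M\<^esub> qact (\<tau> k) (m j)) \<ominus>\<^bsub>M\<^esub> (m k \<ominus>\<^bsub>M\<^esub> qact (\<tau> j) (m k))))"
proof -
  have p: "p > 0" using assms(1) by (simp add: prime_gt_0_nat)
  have grp: "group G" "group Q" and top: "topspace TG = carrier G" "topspace TQ = carrier Q"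
    using assms(2,3) by (auto simp: profinite_group_def topological_group_def)
  note Qp = elementary_abelian_properties[OF assms(8) grp(2) p]
  have TQ: "TQ = discrete_topology (carrier Q)"
    using assms(3) profinite_group_finite_iff[OF grp(2) Qp(2)] by simp
  have M: "abelian_group M" and action: "group_action G (carrier M) act"
    and act_hom: "\<And>g. g \<in> carrier G \<Longrightarrow> act g \<in> hom (add_monoid M) (add_monoid M)"
    using assms(11) by (auto simp: discrete_module_def)
  interpret A: group_action G "carrier M" act by (rule action)
  have N: "N = kernel G Q \<pi>" by (rule assms(7))
  interpret topological_extension G M act Q \<pi> TG TQ
  proof (intro topological_extension.intro module_extension.intro gmodule.intro gmodule_axioms.intro
      module_extension_axioms.intro topological_extension_axioms.intro group_hom.intro group_hom_axioms.intro)
    show "act \<one>\<^bsub>G\<^esub> m = m" if "m \<in> carrier M" for m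
      using fun_cong[OF A.id_eq_one, of m] that by simp
    show "act g m \<in> carrier M" if "g \<in> carrier G" "m \<in> carrier M" for g m
      using A.element_image[OF that] by simp
    show "act g (m \<oplus>\<^bsub>M\<^esub> m') = act g m \<oplus>\<^bsub>M\<^esub> act g m'"
      if "g \<in> carrier G" "m \<in> carrier M" "m' \<in> carrier M" for g m m'
      using hom_mult[OF act_hom[OF that(1)], of m m'] that by simp
    show "act (g \<otimes>\<^bsub>G\<^esub> h) m = act g (act h m)" if "g \<in> carrier G" "h \<in> carrier G" "m \<in> carrier M" for g h m
      using A.composition_rule[OF that(3,1,2)] .
    show "act n m = m" if "n \<in> kernel G Q \<pi>" "m \<in> carrier M" for n m
      using assms(12) that unfolding N by blast
    show "continuous_map TG TG (\<lambda>x. x \<otimes>\<^bsub>G\<^esub> g)" if g: "g \<in> carrier G" for g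
    proof -
      have "continuous_map TG (prod_topology TG TG) (\<lambda>x. (x, g))"
        using g top by (intro continuous_map_pairedI) simp_all
      moreover have "continuous_map (prod_topology TG TG) TG (\<lambda>(x, y). x \<otimes>\<^bsub>G\<^esub> y)"
        using assms(2) by (simp add: profinite_group_def topological_group_def)
      ultimately have "continuous_map TG TG ((\<lambda>(x, y). x \<otimes>\<^bsub>G\<^esub> y) \<circ> (\<lambda>x. (x, g)))"
        by (rule continuous_map_compose)
      then show ?thesis by (simp add: comp_def)
    qed
  qed (use grp M action assms(4-6) top TQ Qp in auto)
  let ?x = "\<lambda>j. s (\<tau> j)"
  have \<tau>: "\<tau> j \<in> carrier Q" if "j < r + 1" for j using assms(9) that by auto
  have x: "?x j \<in> carrier G" "\<pi> (?x j) = \<tau> j" if "j < r + 1" for j using assms(14) \<tau>[OF that] by auto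
  have pow: "?x j [^]\<^bsub>G\<^esub> p \<in> kernel G Q \<pi>" if "j < r + 1" for j
    using x[OF that] Qp(3)[OF \<tau>[OF that]] by (simp add: kernel_def hom_nat_pow)
  have comm: "?x j \<otimes>\<^bsub>G\<^esub> ?x i \<otimes>\<^bsub>G\<^esub> inv\<^bsub>G\<^esub> ?x j \<otimes>\<^bsub>G\<^esub> inv\<^bsub>G\<^esub> ?x i \<in> kernel G Q \<pi>"
    if "i < j" "j < r + 1" for i j
  proof -
    have i: "i < r + 1" using that by simp
    note xs = x[OF i] x[OF that(2)] and ts = \<tau>[OF i] \<tau>[OF that(2)]
    have "\<tau> j \<otimes>\<^bsub>Q\<^esub> \<tau> i \<otimes>\<^bsub>Q\<^esub> inv\<^bsub>Q\<^esub> \<tau> j \<otimes>\<^bsub>Q\<^esub> inv\<^bsub>Q\<^esub> \<tau> i = \<tau> i \<otimes>\<^bsub>Q\<^esub> \<tau> j \<otimes>\<^bsub>Q\<^esub> inv\<^bsub>Q\<^esub> \<tau> j \<otimes>\<^bsub>Q\<^esub> inv\<^bsub>Q\<^esub> \<tau> i"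
      using Qp(4)[OF ts] by simp
    also have "\<dots> = \<one>\<^bsub>Q\<^esub>" using ts by (simp add: H.m_assoc)
    finally show ?thesis using xs by (simp add: kernel_def)
  qed
  have gen: "generate Q ((\<lambda>j. \<pi> (?x j)) ` {..<r + 1}) = carrier Q"
  proof -
    have "(\<lambda>j. \<pi> (?x j)) ` {..<r + 1} = \<tau> ` {..r}"
      using x(2) by (intro image_cong) auto
    then show ?thesis using assms(10) by simp
  qed
  have \<phi>: "\<phi> \<in> hom GN (add_monoid M)" using assms(18) unfolding N .
  have cont: "continuous_map TN (discrete_topology (carrier M)) \<phi>" using assms(19) unfolding N .
  have inv: "hom_class G TG M act (kernel G Q \<pi>) \<phi> \<in> carrier (invariant_cohomology G TG M act (kernel G Q \<pi>) 1)"
    using assms(20) unfolding N .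
  have \<phi>_closed: "\<phi> n \<in> carrier M" if "n \<in> kernel G Q \<pi>" for n
    using \<phi> that by (auto simp: hom_def)
  note equiv = invariant_imp_equivariant[OF \<phi>_closed inv]
  \<comment> \<open>The relations in terms of \<open>G\<close>: lifts instead of the generators,
    \<open>act\<close> instead of \<open>qact\<close>, and indices below \<open>r + 1\<close>
    instead of up to \<open>r\<close>.\<close>
  let ?R = "\<lambda>m. (\<forall>j<r + 1. m j \<in> carrier M) \<and>
    (\<forall>j<r + 1. \<phi> (?x j [^]\<^bsub>G\<^esub> p) = \<ominus>\<^bsub>M\<^esub> (\<Oplus>\<^bsub>M\<^esub>i\<in>{..<p}. act (?x j [^]\<^bsub>G\<^esub> i) (m j))) \<and>
    (\<forall>i j. i < j \<longrightarrow> j < r + 1 \<longrightarrow> \<phi> (?x j \<otimes>\<^bsub>G\<^esub> ?x i \<otimes>\<^bsub>G\<^esub> inv\<^bsub>G\<^esub> ?x j \<otimes>\<^bsub>G\<^esub> inv\<^bsub>G\<^esub> ?x i)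
      = (m i \<ominus>\<^bsub>M\<^esub> act (?x j) (m i)) \<ominus>\<^bsub>M\<^esub> (m j \<ominus>\<^bsub>M\<^esub> act (?x i) (m j)))"
  have "(\<exists>F. crossed_hom F \<and> (\<forall>n\<in>kernel G Q \<pi>. F n = \<phi> n)) \<longleftrightarrow> (\<exists>m. ?R m)"
  proof
    assume "\<exists>F. crossed_hom F \<and> (\<forall>n\<in>kernel G Q \<pi>. F n = \<phi> n)"
    then obtain F where F: "crossed_hom F" "\<And>n. n \<in> kernel G Q \<pi> \<Longrightarrow> F n = \<phi> n" by blast
    note rel = crossed_hom_imp_relations[where x = ?x and k = "r + 1" and \<phi> = \<phi>, OF F x(1) pow comm]
    show "\<exists>m. ?R m"
      by (intro exI[of _ "\<lambda>j. \<ominus>\<^bsub>M\<^esub> F (?x j)"] conjI allI impI) (rule rel; assumption)+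
  next
    assume "\<exists>m. ?R m"
    then obtain m where m: "?R m" ..
    show "\<exists>F. crossed_hom F \<and> (\<forall>n\<in>kernel G Q \<pi>. F n = \<phi> n)"
    proof (rule relations_imp_crossed_hom[where x = ?x and k = "r + 1" and m = m, OF \<phi> equiv p x(1) gen Qp(1) pow comm])
    qed (use m in blast)+
  qed
  moreover have "?R m \<longleftrightarrow> (\<forall>j\<le>r. m j \<in> carrier M) \<and>
      (\<forall>j\<le>r. \<phi> (a j) = \<ominus>\<^bsub>M\<^esub> norm_element Q M qact p (\<tau> j) (m j)) \<and>
      (\<forall>j k. j < k \<and> k \<le> r \<longrightarrow>
         \<phi> (c j k) = (m j \<ominus>\<^bsub>M\<^esub> qact (\<tau> k) (m j)) \<ominus>\<^bsub>M\<^esub> (m k \<ominus>\<^bsub>M\<^esub> qact (\<tau> j) (m k)))" (is "_ \<longleftrightarrow> ?S m") for m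
  \<comment> \<open>Replacing \<open>qact\<close> by \<open>act\<close> is valid only on elements of
    \<open>M\<close>. If some \<open>m j\<close> lies outside, both sides are false.\<close>
  proof (cases "\<forall>j\<le>r. m j \<in> carrier M")
    case True
    have q: "qact (\<tau> j) u = act (?x j) u" if "j \<le> r" "u \<in> carrier M" for j u
      using x[of j] that qact_eq[of "?x j" u] by (simp add: assms(13))
    have nrm: "norm_element Q M qact p (\<tau> j) (m j) = (\<Oplus>\<^bsub>M\<^esub>i\<in>{..<p}. act (?x j [^]\<^bsub>G\<^esub> i) (m j))" if j: "j \<le> r" for j
      unfolding norm_element_def
    proof (rule M.finsum_cong')
      have xj: "?x j \<in> carrier G" "\<pi> (?x j) = \<tau> j" using x[of j] j by simp_all
      have mj: "m j \<in> carrier M" using True j by blast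
      show "(\<lambda>i. act (?x j [^]\<^bsub>G\<^esub> i) (m j)) \<in> {..<p} \<rightarrow> carrier M"
        using xj mj by (intro funcsetI) simp
      fix i :: nat
      have "\<tau> j [^]\<^bsub>Q\<^esub> i = \<pi> (?x j [^]\<^bsub>G\<^esub> i)" using xj by (simp add: hom_nat_pow)
      then show "qact (\<tau> j [^]\<^bsub>Q\<^esub> i) (m j) = act (?x j [^]\<^bsub>G\<^esub> i) (m j)"
        using xj mj by (simp add: assms(13))
    qed simp
    have 1: "\<phi> (a j) = \<ominus>\<^bsub>M\<^esub> norm_element Q M qact p (\<tau> j) (m j) \<longleftrightarrow>
        \<phi> (?x j [^]\<^bsub>G\<^esub> p) = \<ominus>\<^bsub>M\<^esub> (\<Oplus>\<^bsub>M\<^esub>i\<in>{..<p}. act (?x j [^]\<^bsub>G\<^esub> i) (m j))" if "j \<le> r" for j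
      unfolding assms(16)[OF that] nrm[OF that] ..
    have 2: "\<phi> (c i j) = (m i \<ominus>\<^bsub>M\<^esub> qact (\<tau> j) (m i)) \<ominus>\<^bsub>M\<^esub> (m j \<ominus>\<^bsub>M\<^esub> qact (\<tau> i) (m j)) \<longleftrightarrow>
        \<phi> (?x j \<otimes>\<^bsub>G\<^esub> ?x i \<otimes>\<^bsub>G\<^esub> inv\<^bsub>G\<^esub> ?x j \<otimes>\<^bsub>G\<^esub> inv\<^bsub>G\<^esub> ?x i)
          = (m i \<ominus>\<^bsub>M\<^esub> act (?x j) (m i)) \<ominus>\<^bsub>M\<^esub> (m j \<ominus>\<^bsub>M\<^esub> act (?x i) (m j))" if "i < j" "j \<le> r" for i j
    proof -
      have "i \<le> r" using that by simp
      then show ?thesis unfolding assms(17)[OF that] using True that by (simp add: q)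
    qed
    have lt: "j < r + 1 \<longleftrightarrow> j \<le> r" for j by auto
    show ?thesis unfolding lt using 1 2 by blast
  next
    case False
    have lt: "j < r + 1 \<longleftrightarrow> j \<le> r" for j by auto
    show ?thesis unfolding lt using False by blast
  qed
  ultimately have "(\<exists>F. crossed_hom F \<and> (\<forall>n\<in>kernel G Q \<pi>. F n = \<phi> n)) \<longleftrightarrow> (\<exists>m. ?S m)" by simp
  with kernel_transgression_iff[OF \<phi> cont inv] show ?thesis
    unfolding N assms(13) by simp
qed

end
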